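(* There is a reduction, running in $O(N\,\mathrm{poly}(D))$ time, from BP-Satisfying-Pair on a branching program of length $T$ and width $W$ and two sets of $N$ strings to Gap-Min-TropSim$_\epsilon$ on two sets of $N$ tensors of size $D=2^{O(\log^2W\log^2T(\log\log W+\log\log T+\log\epsilon^{-1}))}$; yes-instances map to the completeness case and no-instances to the soundness case. Here $\epsilon$ is a threshold value that may depend on $N$.
   Context: A (nondeterministic) branching program (BP) of length $T$ and width $W$ on Boolean inputs $x_1,\dots,x_n$ is a layered directed graph with $T$ layers of $W$ nodes; all nodes of layer $i<T$ are labelled by one variable $x_{f(i)}$; edges go between consecutive layers and are marked $0$ or $1$; it accepts $x$ iff there is a path from the first node of layer $1$ to the first node of layer $T$ using only edges whose mark equals the value of the variable labelling their starting node. BP-Satisfying-Pair: given a BP $P$ on $n$ inputs and $A,B\subseteq\{0,1\}^{n/2}$ of $N$ strings each, decide whether $P$ accepts the concatenation of some $a\in A$, $b\in B$. For even $t$, tensors $u,v\in\{0,1\}^{2\times\cdots\times2}$ ($t$ factors, size $D=2^t$) indexed by $i\in\{0,1\}^t$ have tropical similarity $s(u,v)=\mathbb{E}_{i_1}\max_{i_2}\mathbb{E}_{i_3}\cdots\max_{i_t}(u_i\cdot v_i)$, where $\mathbb{E}$ denotes averaging over $\{0,1\}$. Gap-Min-TropSim$_\epsilon$: given two sets $A,B$ of $N$ such tensors, distinguish the completeness case (some $(a,b)\in A\times B$ has $s(a,b)<\epsilon$) from the soundness case (every pair has $s(a,b)=1$). *)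

theory Defs
  imports Complex_Main
begin

section \<open>Branching programs\<close>

text \<open>
  Layers, nodes and variables are numbered from 0.  An edge \<open>(i, j, b, k)\<close> leads from node \<open>j\<close>
  of layer \<open>i\<close> to node \<open>k\<close> of layer \<open>i + 1\<close> and carries the mark \<open>b\<close>; parallel edges with
  different marks are allowed.  The last layer has no label.
\<close>

record bp =
  bp_inputs :: nat
  bp_length :: nat
  bp_width :: nat
  bp_label :: "nat \<Rightarrow> nat"
  bp_edges :: "(nat \<times> nat \<times> bool \<times> nat) set"

definition wf_bp :: "bp \<Rightarrow> bool" where
  "wf_bp P \<longleftrightarrow> 1 \<le> bp_length P \<and> 1 \<le> bp_width P
     \<and> (\<forall>i. Suc i < bp_length P \<longrightarrow> bp_label P i < bp_inputs P)
     \<and> (\<forall>(i, j, b, k) \<in> bp_edges P. Suc i < bp_length P \<and> j < bp_width P \<and> k < bp_width P)"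

definition bp_accepts :: "bp \<Rightarrow> bool list \<Rightarrow> bool" where
  "bp_accepts P x \<longleftrightarrow> (\<exists>p :: nat list. length p = bp_length P
     \<and> p ! 0 = 0 \<and> p ! (bp_length P - 1) = 0
     \<and> (\<forall>i. Suc i < bp_length P \<longrightarrow> (i, p ! i, x ! bp_label P i, p ! Suc i) \<in> bp_edges P))"

text \<open>The input sets are given to an algorithm by repetition-free enumerations.\<close>

definition bp_pair_instance :: "bp \<Rightarrow> nat \<Rightarrow> bool list list \<Rightarrow> bool list list \<Rightarrow> bool" where
  "bp_pair_instance P N A B \<longleftrightarrow> wf_bp P \<and> even (bp_inputs P) \<and> 1 \<le> N
     \<and> length A = N \<and> distinct A \<and> (\<forall>a \<in> set A. length a = bp_inputs P div 2)
     \<and> length B = N \<and> distinct B \<and> (\<forall>b \<in> set B. length b = bp_inputs P div 2)"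

definition bp_satisfying_pair :: "bp \<Rightarrow> bool list list \<Rightarrow> bool list list \<Rightarrow> bool" where
  "bp_satisfying_pair P A B \<longleftrightarrow> (\<exists>a \<in> set A. \<exists>b \<in> set B. bp_accepts P (a @ b))"


section \<open>Tropical similarity\<close>

text \<open>
  A 0/1 tensor with \<open>t\<close> factors is a function on bit strings; only its values at strings of
  length \<open>t\<close> matter.
\<close>

type_synonym tensor = "bool list \<Rightarrow> bool"

fun trop_avg :: "nat \<Rightarrow> (bool list \<Rightarrow> real) \<Rightarrow> real"
and trop_max :: "nat \<Rightarrow> (bool list \<Rightarrow> real) \<Rightarrow> real" where
  "trop_avg 0 h = h []"
| "trop_avg (Suc t) h = (trop_max t (\<lambda>i. h (False # i)) + trop_max t (\<lambda>i. h (True # i))) / 2"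
| "trop_max 0 h = h []"
| "trop_max (Suc t) h = max (trop_avg t (\<lambda>i. h (False # i))) (trop_avg t (\<lambda>i. h (True # i)))"

definition trop_sim :: "nat \<Rightarrow> tensor \<Rightarrow> tensor \<Rightarrow> real" where
  "trop_sim t u v = trop_avg t (\<lambda>i. of_bool (u i) * of_bool (v i))"

text \<open>
  The two sides of the promise problem.  Its two ``sets'' of \<open>N\<close> tensors are families that may
  contain repetitions: there are only \<open>2 ^ (2 ^ t)\<close> different tensors, possibly fewer than \<open>N\<close>.
\<close>

definition min_tropsim_complete :: "real \<Rightarrow> nat \<Rightarrow> tensor list \<Rightarrow> tensor list \<Rightarrow> bool" where
  "min_tropsim_complete \<epsilon> t U V \<longleftrightarrow> (\<exists>u \<in> set U. \<exists>v \<in> set V. trop_sim t u v < \<epsilon>)"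

definition min_tropsim_sound :: "nat \<Rightarrow> tensor list \<Rightarrow> tensor list \<Rightarrow> bool" where
  "min_tropsim_sound t U V \<longleftrightarrow> (\<forall>u \<in> set U. \<forall>v \<in> set V. trop_sim t u v = 1)"


section \<open>Word RAM\<close>

text \<open>
  A word RAM with word size \<open>w\<close>, programmed by structured programs with finitely many registers
  and an addressable memory.  All arithmetic is modulo \<open>2 ^ w\<close> (subtraction is truncated at 0,
  division by 0 gives 0), and every operation, memory access and test has unit cost.
\<close>

datatype exp =
    Lit nat | Reg nat | Load exp
  | Plus exp exp | Minus exp exp | Times exp exp | Div exp exp | Mod exp exp | Less exp exp

datatype com =
    Skip
  | Assign nat exp
  | Store exp exp
  | Seq com com
  | If exp com com
  | While exp com

type_synonym state = "(nat \<Rightarrow> nat) \<times> (nat \<Rightarrow> nat)"  \<comment> \<open>registers, memory\<close>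

primrec eval :: "nat \<Rightarrow> state \<Rightarrow> exp \<Rightarrow> nat" where
  "eval w s (Lit n) = n mod 2 ^ w"
| "eval w s (Reg r) = fst s r"
| "eval w s (Load a) = snd s (eval w s a)"
| "eval w s (Plus a b) = (eval w s a + eval w s b) mod 2 ^ w"
| "eval w s (Minus a b) = eval w s a - eval w s b"
| "eval w s (Times a b) = (eval w s a * eval w s b) mod 2 ^ w"
| "eval w s (Div a b) = eval w s a div eval w s b"
| "eval w s (Mod a b) = eval w s a mod eval w s b"
| "eval w s (Less a b) = of_bool (eval w s a < eval w s b) mod 2 ^ w"

primrec cost :: "exp \<Rightarrow> nat" where
  "cost (Lit n) = 1"
| "cost (Reg r) = 1"
| "cost (Load a) = cost a + 1"
| "cost (Plus a b) = cost a + cost b + 1"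
| "cost (Minus a b) = cost a + cost b + 1"
| "cost (Times a b) = cost a + cost b + 1"
| "cost (Div a b) = cost a + cost b + 1"
| "cost (Mod a b) = cost a + cost b + 1"
| "cost (Less a b) = cost a + cost b + 1"

text \<open>\<open>exec w c s k s'\<close>: started in \<open>s\<close>, program \<open>c\<close> halts in \<open>s'\<close> after \<open>k\<close> time units.\<close>

inductive exec :: "nat \<Rightarrow> com \<Rightarrow> state \<Rightarrow> nat \<Rightarrow> state \<Rightarrow> bool" for w :: nat where
  Skip: "exec w Skip s 1 s"
| Assign: "exec w (Assign r a) s (cost a + 1) ((fst s)(r := eval w s a), snd s)"
| Store: "exec w (Store a b) s (cost a + cost b + 1) (fst s, (snd s)(eval w s a := eval w s b))"
| Seq: "exec w c1 s k1 s1 \<Longrightarrow> exec w c2 s1 k2 s2 \<Longrightarrow> exec w (Seq c1 c2) s (k1 + k2) s2"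
| IfTrue: "eval w s a \<noteq> 0 \<Longrightarrow> exec w c1 s k s1 \<Longrightarrow> exec w (If a c1 c2) s (cost a + 1 + k) s1"
| IfFalse: "eval w s a = 0 \<Longrightarrow> exec w c2 s k s1 \<Longrightarrow> exec w (If a c1 c2) s (cost a + 1 + k) s1"
| WhileFalse: "eval w s a = 0 \<Longrightarrow> exec w (While a c) s (cost a + 1) s"
| WhileTrue: "eval w s a \<noteq> 0 \<Longrightarrow> exec w c s k1 s1 \<Longrightarrow> exec w (While a c) s1 k2 s2
    \<Longrightarrow> exec w (While a c) s (cost a + 1 + k1 + k2) s2"

text \<open>
  The input occupies the memory from address 0 on, everything else being 0; on halting, register 0
  points to the output.
\<close>

definition initial_state :: "nat list \<Rightarrow> state" where
  "initial_state inp = ((\<lambda>_. 0), (\<lambda>a. if a < length inp then inp ! a else 0))"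

definition ram_computes :: "nat \<Rightarrow> com \<Rightarrow> nat list \<Rightarrow> nat \<Rightarrow> nat list \<Rightarrow> bool" where
  "ram_computes w c inp time out \<longleftrightarrow> (\<exists>k R M. k \<le> time \<and> exec w c (initial_state inp) k (R, M)
     \<and> map M [R 0 ..< R 0 + length out] = out)"


section \<open>Encodings\<close>

definition bits_code :: "bool list \<Rightarrow> nat list" where
  "bits_code x = map of_bool x"

text \<open>
  The program has to know the threshold; a RAM cannot be given an arbitrary real \<open>\<epsilon>\<close>, so it
  gets the integer \<open>\<lceil>1 / \<epsilon>\<rceil>\<close>.
\<close>

definition bp_pair_code :: "real \<Rightarrow> bp \<Rightarrow> nat \<Rightarrow> bool list list \<Rightarrow> bool list list \<Rightarrow> nat list" where
  "bp_pair_code \<epsilon> P N A B =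
     [bp_inputs P, bp_length P, bp_width P, N, nat \<lceil>1 / \<epsilon>\<rceil>]
     @ map (bp_label P) [0 ..< bp_length P - 1]
     @ [of_bool ((i, j, b, k) \<in> bp_edges P).
          i \<leftarrow> [0 ..< bp_length P - 1], j \<leftarrow> [0 ..< bp_width P],
          b \<leftarrow> [False, True], k \<leftarrow> [0 ..< bp_width P]]
     @ concat (map bits_code A) @ concat (map bits_code B)"

definition tensor_code :: "nat \<Rightarrow> tensor \<Rightarrow> nat list" where
  "tensor_code t u = map (\<lambda>i. of_bool (u i)) (List.n_lists t [False, True])"

definition tropsim_code :: "nat \<Rightarrow> tensor list \<Rightarrow> tensor list \<Rightarrow> nat list" where
  "tropsim_code t U V =
     [t, length U] @ concat (map (tensor_code t) U) @ concat (map (tensor_code t) V)"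

text \<open>
  Words of \<open>O(log S)\<close> bits, \<open>S\<close> being this quantity, can hold every input word and address the
  input and an output of \<open>N\<close> tensors of size \<open>D\<close>.
\<close>

definition word_scale :: "nat list \<Rightarrow> nat \<Rightarrow> nat \<Rightarrow> nat" where
  "word_scale inp N D = length inp + Max (set inp) + N * D"


section \<open>The dimension bound\<close>

text \<open>
  Binary logarithm, rounded up to 1 when smaller.  Without this the expression inside \<open>O(\<dots>)\<close> would
  be 0 (or undefined) for some small parameters, e.g. for \<open>W = 1\<close> or for \<open>W = T = 2\<close>, \<open>\<epsilon> = 1\<close>.
  For \<open>W, T \<ge> 4\<close>, and also for \<open>W, T \<ge> 2\<close> and \<open>\<epsilon> \<le> 1 / 2\<close>, the expression changes by at most a
  constant factor.
\<close>

definition lg :: "real \<Rightarrow> real" where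
  "lg x = max 1 (log 2 x)"

definition dim_bound :: "nat \<Rightarrow> nat \<Rightarrow> real \<Rightarrow> real" where
  "dim_bound W T \<epsilon> = (lg W)\<^sup>2 * (lg T)\<^sup>2 * (lg (lg W) + lg (lg T) + lg (1 / \<epsilon>))"

end

theory Submission
  imports Defs "HOL-Number_Theory.Cong"
begin

text \<open>
  By repeated squaring, acceptance of a branching program is the truth of a quantified Boolean formula
  with \<open>n = O(log W log T)\<close> variables: at each level a midpoint is guessed existentially and one half
  of the remaining interval is picked universally.  That \<open>P\<close> rejects \<open>(a, b)\<close> is then shown by Shen's
  form of the \<open>IP = PSPACE\<close> protocol over a prime field of size polynomial in \<open>n / \<epsilon>\<close>: linearising all
  variables after every quantifier takes \<open>O(n\<^sup>2)\<close> rounds, in each of which Merlin sends a polynomial of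
  degree 2 and Arthur a random point.  The maxima of the tropical similarity are Merlin's bits and the
  averages are Arthur's.  The matrix of the formula is a sum of a function of \<open>a\<close> and a function of
  \<open>b\<close>, since every layer reads one variable only, so the final value can be split by Merlin and checked
  by the two tensors separately; all other checks do not depend on the input strings.
\<close>

section \<open>Hoare triples for the word RAM\<close>

text \<open>Averaged and maximised digits alternate one by one, whereas a message is a block of
  \<open>K\<close> bits of a single player. So each block spends \<open>K\<close> pairs of digits
  and ignores the other player's half, which costs a factor 2 in \<open>t\<close>. The gap problem
  wants similarity exactly 1 for no-instances. The protocol gives this because an honest Merlin is
  never rejected; so Merlin has to prove that \<open>P\<close> rejects, and \<epsilon> bounds the
  success of cheating. A cheat succeeds with probability at most \<open>4 / p\<close> per round: a
  wrong quadratic agrees with the true one at no more than 2 residues, and a \<open>K\<close>-bit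
  number reduced modulo \<open>p\<close> hits a residue at most twice as often as a uniform one.
  With \<open>n * (n + 1)\<close> rounds, \<open>p\<close> above
  \<open>4 * n * (n + 1) / \<epsilon>\<close> suffices. Only the logarithm of \<open>p\<close>
  enters the dimension, so a crude range for the prime will do, and central binomial coefficients
  supply one. The product of two tensor entries is the conjunction of two verdicts on the same
  transcript. The multilinear extension is summed up by brute force, which is affordable since
  \<open>2 ^ n\<close> is at most \<open>D\<close>.\<close>

abbreviation same_except :: "nat set \<Rightarrow> (nat \<Rightarrow> nat) \<Rightarrow> (nat \<Rightarrow> nat) \<Rightarrow> bool" where
  "same_except X R' R \<equiv> \<forall>i. i \<notin> X \<longrightarrow> R' i = R i"

text \<open>Evaluation over the unbounded naturals. Programs are reasoned about with
  \<open>ev\<close>; word arithmetic is dealt with once, in \<open>eval_ev\<close>.\<close>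

primrec ev :: "(nat \<Rightarrow> nat) \<Rightarrow> (nat \<Rightarrow> nat) \<Rightarrow> exp \<Rightarrow> nat" where
  "ev R M (Lit n) = n"
| "ev R M (Reg r) = R r"
| "ev R M (Load a) = M (ev R M a)"
| "ev R M (Plus a b) = ev R M a + ev R M b"
| "ev R M (Minus a b) = ev R M a - ev R M b"
| "ev R M (Times a b) = ev R M a * ev R M b"
| "ev R M (Div a b) = ev R M a div ev R M b"
| "ev R M (Mod a b) = ev R M a mod ev R M b"
| "ev R M (Less a b) = of_bool (ev R M a < ev R M b)"

text \<open>Exponent of a bound by a power of \<open>Z\<close>. A literal counts its own value since
  \<open>n \<le> Z ^ n\<close>; a sum costs one more than its larger part since
  \<open>2 \<le> Z\<close>. \<open>Load\<close> keeps the exponent of its address because the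
  address must not overflow either.\<close>

primrec edeg :: "exp \<Rightarrow> nat" where
  "edeg (Lit n) = n"
| "edeg (Reg r) = 1"
| "edeg (Load a) = max 1 (edeg a)"
| "edeg (Plus a b) = Suc (max (edeg a) (edeg b))"
| "edeg (Minus a b) = max (edeg a) (edeg b)"
| "edeg (Times a b) = edeg a + edeg b"
| "edeg (Div a b) = max (edeg a) (edeg b)"
| "edeg (Mod a b) = max (edeg a) (edeg b)"
| "edeg (Less a b) = max 1 (max (edeg a) (edeg b))"

primrec loopfree :: "nat \<Rightarrow> com \<Rightarrow> bool" where
  "loopfree q Skip = True"
| "loopfree q (Assign r a) = (edeg a \<le> q)"
| "loopfree q (Store a b) = (edeg a \<le> q \<and> edeg b \<le> q)"
| "loopfree q (Seq c1 c2) = (loopfree q c1 \<and> loopfree q c2)"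
| "loopfree q (If a c1 c2) = (edeg a \<le> q \<and> loopfree q c1 \<and> loopfree q c2)"
| "loopfree q (While a c) = False"

primrec run_time :: "com \<Rightarrow> nat" where
  "run_time Skip = 1"
| "run_time (Assign r a) = cost a + 1"
| "run_time (Store a b) = cost a + cost b + 1"
| "run_time (Seq c1 c2) = run_time c1 + run_time c2"
| "run_time (If a c1 c2) = cost a + 1 + max (run_time c1) (run_time c2)"
| "run_time (While a c) = 0"

text \<open>Besides \<open>Q\<close>, every assignment and store has to show that the value written
  is at most \<open>Z\<close>, which is what preserves \<open>bnd\<close>. \<open>While\<close> gets
  \<open>False\<close> because loops go through \<open>triple_While\<close>.\<close>

primrec wp :: "nat \<Rightarrow> com \<Rightarrow> ((nat \<Rightarrow> nat) \<Rightarrow> (nat \<Rightarrow> nat) \<Rightarrow> bool) \<Rightarrow> (nat \<Rightarrow> nat) \<Rightarrow> (nat \<Rightarrow> nat) \<Rightarrow> bool" where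
  "wp Z Skip Q R M = Q R M"
| "wp Z (Assign r a) Q R M = (ev R M a \<le> Z \<and> Q (R(r := ev R M a)) M)"
| "wp Z (Store a b) Q R M = (ev R M b \<le> Z \<and> Q R (M(ev R M a := ev R M b)))"
| "wp Z (Seq c1 c2) Q R M = wp Z c1 (wp Z c2 Q) R M"
| "wp Z (If a c1 c2) Q R M = ((ev R M a \<noteq> 0 \<longrightarrow> wp Z c1 Q R M) \<and> (ev R M a = 0 \<longrightarrow> wp Z c2 Q R M))"
| "wp Z (While a c) Q R M = False"

locale ram =
  fixes w Z q :: nat
  assumes Z2: "2 \<le> Z" and word: "Z ^ q < 2 ^ w" and q1: "1 \<le> q"
begin

text \<open>All registers and memory cells stay below \<open>Z\<close>; as \<open>Z ^ q\<close> fits into a word, expressions of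
  \<open>edeg\<close> at most \<open>q\<close> are evaluated without overflow.\<close>

definition bnd :: "(nat \<Rightarrow> nat) \<Rightarrow> (nat \<Rightarrow> nat) \<Rightarrow> bool" where
  "bnd R M \<longleftrightarrow> (\<forall>r. R r \<le> Z) \<and> (\<forall>a. M a \<le> Z)"

text \<open>Total correctness with a time bound, from one given start state: what is known about
  that state lives in the proof context instead of a precondition.\<close>

definition triple :: "com \<Rightarrow> (nat \<Rightarrow> nat) \<Rightarrow> (nat \<Rightarrow> nat) \<Rightarrow> nat \<Rightarrow>
    ((nat \<Rightarrow> nat) \<Rightarrow> (nat \<Rightarrow> nat) \<Rightarrow> bool) \<Rightarrow> bool" where
  "triple c R M k Q \<longleftrightarrow> (bnd R M \<longrightarrow>
     (\<exists>k' R' M'. k' \<le> k \<and> exec w c (R, M) k' (R', M') \<and> bnd R' M' \<and> Q R' M'))"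

lemma Z_pow_mono: "a \<le> b \<Longrightarrow> Z ^ a \<le> Z ^ b"
  using Z2 by (simp add: power_increasing)

lemma n_le_Z_pow: "n \<le> Z ^ n"
  by (metis Z2 le_trans less_imp_le_nat less_exp power_mono zero_le)

lemma ev_le: "bnd R M \<Longrightarrow> ev R M e \<le> Z ^ edeg e"
proof (induction e)
  case (Lit n) then show ?case by (simp add: n_le_Z_pow)
next
  case (Reg r) then show ?case by (simp add: bnd_def)
next
  case (Load a)
  have "M (ev R M a) \<le> Z ^ 1" using Load.prems by (simp add: bnd_def)
  also have "\<dots> \<le> Z ^ max 1 (edeg a)" by (rule Z_pow_mono) simp
  finally show ?case by simp
next
  case (Plus a b)
  let ?m = "max (edeg a) (edeg b)"
  have "ev R M a \<le> Z ^ ?m" "ev R M b \<le> Z ^ ?m"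
    using Plus Z_pow_mono[of "edeg a" ?m] Z_pow_mono[of "edeg b" ?m] by (auto intro: order_trans)
  then have "ev R M a + ev R M b \<le> 2 * Z ^ ?m" by simp
  also have "\<dots> \<le> Z * Z ^ ?m" using Z2 by simp
  finally show ?case by simp
next
  case (Minus a b)
  let ?m = "max (edeg a) (edeg b)"
  have "ev R M a \<le> Z ^ ?m"
    using Minus Z_pow_mono[of "edeg a" ?m] by (auto intro: order_trans)
  then show ?case by simp
next
  case (Times a b)
  then show ?case by (simp add: power_add mult_mono)
next
  case (Div a b)
  let ?m = "max (edeg a) (edeg b)"
  have "ev R M a \<le> Z ^ ?m"
    using Div Z_pow_mono[of "edeg a" ?m] by (auto intro: order_trans)
  then show ?case using div_le_dividend order_trans by (simp, blast)
next
  case (Mod a b)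
  let ?m = "max (edeg a) (edeg b)"
  have "ev R M a \<le> Z ^ ?m"
    using Mod Z_pow_mono[of "edeg a" ?m] by (auto intro: order_trans)
  then show ?case using mod_less_eq_dividend order_trans by (simp, blast)
next
  case (Less a b)
  have "1 \<le> Z ^ edeg (Less a b)" using Z2 by simp
  then show ?case by (auto simp: of_bool_def)
qed

lemma word_ge: "a \<le> q \<Longrightarrow> x \<le> Z ^ a \<Longrightarrow> x < 2 ^ w"
  using Z_pow_mono[of a q] word by linarith

lemma eval_ev: "bnd R M \<Longrightarrow> edeg e \<le> q \<Longrightarrow> eval w (R, M) e = ev R M e"
proof (induction e)
  case (Lit n)
  then show ?case using word_ge[of "n" n] n_le_Z_pow by simp
next
  case (Plus a b)
  then show ?case using word_ge[OF Plus.prems(2) ev_le[OF Plus.prems(1)]] by simp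
next
  case (Times a b)
  then show ?case using word_ge[OF Times.prems(2) ev_le[OF Times.prems(1)]] by simp
next
  case (Less a b)
  then show ?case using word_ge[OF Less.prems(2) ev_le[OF Less.prems(1)]]
    by (auto simp: of_bool_def)
qed auto

lemma triple_loopfree:
  assumes "loopfree q c" "wp Z c Q R M" "run_time c \<le> k"
  shows "triple c R M k Q"
proof -
  have "loopfree q c \<Longrightarrow> bnd R M \<Longrightarrow> wp Z c Q R M \<Longrightarrow>
     \<exists>k' R' M'. k' \<le> run_time c \<and> exec w c (R, M) k' (R', M') \<and> bnd R' M' \<and> Q R' M'"
    for c R M Q
  proof (induction c arbitrary: R M Q)
    case Skip
    then show ?case using exec.Skip[of w "(R, M)"] by fastforce
  next
    case (Assign r a)
    have "exec w (Assign r a) (R, M) (cost a + 1) (R(r := ev R M a), M)"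
      using exec.Assign[of w r a "(R, M)"] eval_ev[of R M a] Assign by simp
    moreover have "bnd (R(r := ev R M a)) M" using Assign by (auto simp: bnd_def)
    ultimately show ?case using Assign by auto
  next
    case (Store a b)
    have "exec w (Store a b) (R, M) (cost a + cost b + 1) (R, M(ev R M a := ev R M b))"
      using exec.Store[of w a b "(R, M)"] eval_ev[of R M a] eval_ev[of R M b] Store by simp
    moreover have "bnd R (M(ev R M a := ev R M b))" using Store by (auto simp: bnd_def)
    ultimately show ?case using Store by auto
  next
    case (Seq c1 c2)
    obtain k1 R1 M1 where 1: "k1 \<le> run_time c1" "exec w c1 (R, M) k1 (R1, M1)" "bnd R1 M1"
      "wp Z c2 Q R1 M1" using Seq.IH(1)[of R M "wp Z c2 Q"] Seq.prems by auto
    obtain k2 R2 M2 where 2: "k2 \<le> run_time c2" "exec w c2 (R1, M1) k2 (R2, M2)" "bnd R2 M2"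
      "Q R2 M2" using Seq.IH(2)[of R1 M1 Q] Seq.prems 1 by auto
    show ?case using exec.Seq[OF 1(2) 2(2)] 1(1) 2 by (auto intro!: exI[of _ "k1 + k2"])
  next
    case (If a c1 c2)
    show ?case
    proof (cases "ev R M a = 0")
      case True
      then obtain k1 R1 M1 where 1: "k1 \<le> run_time c2" "exec w c2 (R, M) k1 (R1, M1)" "bnd R1 M1"
        "Q R1 M1" using If.IH(2)[of R M Q] If.prems by auto
      have "exec w (If a c1 c2) (R, M) (cost a + 1 + k1) (R1, M1)"
        using True eval_ev[of R M a] If.prems 1(2) by (intro exec.IfFalse) auto
      moreover have "cost a + 1 + k1 \<le> run_time (If a c1 c2)" using 1(1) by simp
      ultimately show ?thesis using 1 by blast
    next
      case False
      then obtain k1 R1 M1 where 1: "k1 \<le> run_time c1" "exec w c1 (R, M) k1 (R1, M1)" "bnd R1 M1"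
        "Q R1 M1" using If.IH(1)[of R M Q] If.prems by auto
      have "exec w (If a c1 c2) (R, M) (cost a + 1 + k1) (R1, M1)"
        using False eval_ev[of R M a] If.prems 1(2) by (intro exec.IfTrue) auto
      moreover have "cost a + 1 + k1 \<le> run_time (If a c1 c2)" using 1(1) by simp
      ultimately show ?thesis using 1 by blast
    qed
  qed simp
  then show ?thesis using assms unfolding triple_def by (meson order_trans)
qed

lemma triple_conseq:
  assumes "triple c R M k Q" "k \<le> k'" "\<And>R M. bnd R M \<Longrightarrow> Q R M \<Longrightarrow> Q' R M"
  shows "triple c R M k' Q'"
  using assms unfolding triple_def by (meson order_trans)

text \<open>Makes \<open>bnd\<close> of the start state available while a triple is being proved;
  sound because \<open>triple\<close> has it as a premise.\<close>

lemma triple_bnd: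
  assumes "bnd R M \<Longrightarrow> triple c R M k Q"
  shows "triple c R M k Q"
  using assms unfolding triple_def by blast

lemma triple_Seq:
  assumes "triple c1 R M k1 Q1" "\<And>R M. bnd R M \<Longrightarrow> Q1 R M \<Longrightarrow> triple c2 R M k2 Q" "k1 + k2 \<le> k"
  shows "triple (Seq c1 c2) R M k Q"
  unfolding triple_def
proof
  assume "bnd R M"
  then obtain ka Ra Ma where 1: "ka \<le> k1" "exec w c1 (R, M) ka (Ra, Ma)" "bnd Ra Ma" "Q1 Ra Ma"
    using assms(1) unfolding triple_def by blast
  then obtain kb Rb Mb where 2: "kb \<le> k2" "exec w c2 (Ra, Ma) kb (Rb, Mb)" "bnd Rb Mb" "Q Rb Mb"
    using assms(2) unfolding triple_def by blast
  show "\<exists>k' R' M'. k' \<le> k \<and> exec w (Seq c1 c2) (R, M) k' (R', M') \<and> bnd R' M' \<and> Q R' M'"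
    using exec.Seq[OF 1(2) 2(2)] 1(1) 2 assms(3) by (intro exI[of _ "ka + kb"] exI) auto
qed

lemma triple_Assign_Seq:
  assumes "edeg a \<le> q" "ev R M a \<le> Z" "cost a + 1 + k \<le> k'"
    and c: "\<And>R'. R' = R(r := ev R M a) \<Longrightarrow> triple c R' M k Q"
  shows "triple (Seq (Assign r a) c) R M k' Q"
proof (rule triple_Seq[OF _ _ assms(3)])
  show "triple (Assign r a) R M (cost a + 1) (\<lambda>R' M'. R' = R(r := ev R M a) \<and> M' = M)"
    by (rule triple_loopfree) (use assms in simp_all)
qed (use c in blast)

text \<open>The invariant counts the iterations done and their total \<open>n\<close> is known in
  advance, so termination and the time bound come from one induction on
  \<open>n - m\<close>.\<close>

lemma triple_While:
  assumes "I 0 R M" "edeg b \<le> q"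
    and step: "\<And>m R M. m < n \<Longrightarrow> bnd R M \<Longrightarrow> I m R M \<Longrightarrow> ev R M b \<noteq> 0 \<and> triple c R M kb (I (Suc m))"
    and stop: "\<And>R M. bnd R M \<Longrightarrow> I n R M \<Longrightarrow> ev R M b = 0"
    and k: "n * (kb + cost b + 1) + cost b + 1 \<le> k"
  shows "triple (While b c) R M k (I n)"
proof -
  have *: "m \<le> n \<Longrightarrow> bnd R M \<Longrightarrow> I m R M \<Longrightarrow> \<exists>k' R' M'. k' \<le> (n - m) * (kb + cost b + 1) + cost b + 1 \<and>
     exec w (While b c) (R, M) k' (R', M') \<and> bnd R' M' \<and> I n R' M'" for m R M
  proof (induction "n - m" arbitrary: m R M)
    case 0
    then have "exec w (While b c) (R, M) (cost b + 1) (R, M)"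
      using stop[of R M] eval_ev[of R M b] assms(2) by (intro exec.WhileFalse) auto
    then show ?case using 0 by (intro exI[of _ "cost b + 1"] exI[of _ R] exI[of _ M]) auto
  next
    case (Suc x)
    then have m: "m < n" "x = n - Suc m" by auto
    from step[OF m(1) Suc.prems(2,3)] Suc.prems(2) obtain k1 R1 M1 where 1: "ev R M b \<noteq> 0"
      "k1 \<le> kb" "exec w c (R, M) k1 (R1, M1)" "bnd R1 M1" "I (Suc m) R1 M1"
      unfolding triple_def by blast
    from Suc.hyps(1)[OF m(2) _ 1(4,5)] m obtain k2 R2 M2 where
      2: "k2 \<le> (n - Suc m) * (kb + cost b + 1) + cost b + 1"
        "exec w (While b c) (R1, M1) k2 (R2, M2)" "bnd R2 M2" "I n R2 M2"
      by auto
    have "exec w (While b c) (R, M) (cost b + 1 + k1 + k2) (R2, M2)"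
      using 1 2 eval_ev[of R M b] assms(2) Suc.prems by (intro exec.WhileTrue[where ?s1.0 = "(R1, M1)"]) auto
    moreover have "n - m = Suc (n - Suc m)" using m by simp
    then have "cost b + 1 + k1 + k2 \<le> (n - m) * (kb + cost b + 1) + cost b + 1"
      using 1(2) 2(1) by simp
    ultimately show ?case using 2 by blast
  qed
  from *[of 0 R M] assms(1) k show ?thesis unfolding triple_def by (auto intro: order_trans)
qed

end

definition for_loop :: "nat \<Rightarrow> nat \<Rightarrow> com \<Rightarrow> com" where
  "for_loop i b c = Seq (Assign i (Lit 0))
     (While (Less (Reg i) (Reg b)) (Seq c (Assign i (Plus (Reg i) (Lit 1)))))"

text \<open>Overhead in the bound: each iteration pays 4 for the test and 4 for the increment, and 6
  covers the initialisation and the last test.\<close>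

lemma (in ram) triple_for:
  assumes init: "I 0 (R(i := 0)) M" and q: "2 \<le> q"
    and step: "\<And>m R M. m < n \<Longrightarrow> bnd R M \<Longrightarrow> R i = m \<Longrightarrow> I m R M \<Longrightarrow>
        triple c R M kb (\<lambda>R M. R i = m \<and> I (Suc m) (R(i := Suc m)) M)"
    and b: "\<And>m R M. m \<le> n \<Longrightarrow> R i = m \<Longrightarrow> I m R M \<Longrightarrow> R b = n"
    and n: "n \<le> Z"
    and k: "n * (kb + 8) + 6 \<le> k"
    and Q: "\<And>R M. bnd R M \<Longrightarrow> R i = n \<Longrightarrow> I n R M \<Longrightarrow> Q R M"
  shows "triple (for_loop i b c) R M k Q"
  unfolding for_loop_def
proof (rule triple_Seq[where ?k1.0 = 2 and ?k2.0 = "n * (kb + 8) + 4" and ?Q1.0 = "\<lambda>R M. R i = 0 \<and> I 0 R M"])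
  show "triple (Assign i (Lit 0)) R M 2 (\<lambda>R M. R i = 0 \<and> I 0 R M)"
    by (rule triple_loopfree) (use init q in auto)
next
  fix R M assume 0: "R i = 0 \<and> I 0 R M"
  show "triple (While (Less (Reg i) (Reg b)) (Seq c (Assign i (Plus (Reg i) (Lit 1))))) R M
        (n * (kb + 8) + 4) Q"
  proof (rule triple_conseq[OF triple_While[where n = n and I = "\<lambda>m R M. R i = m \<and> I m R M" and kb = "kb + 4"]])
    fix m R M assume m: "m < n" "bnd R M" "R i = m \<and> I m R M"
    have "triple (Seq c (Assign i (Plus (Reg i) (Lit 1)))) R M (kb + 4) (\<lambda>R M. R i = Suc m \<and> I (Suc m) R M)"
      by (rule triple_Seq[OF step[OF m(1,2)]]; (rule triple_loopfree)?) (use m q n in auto)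
    moreover have "R b = n" by (rule b[of m]) (use m in auto)
    ultimately show "ev R M (Less (Reg i) (Reg b)) \<noteq> 0 \<and> triple (Seq c (Assign i (Plus (Reg i) (Lit 1)))) R M
       (kb + 4) (\<lambda>R M. R i = Suc m \<and> I (Suc m) R M)" using m by simp
  next
    fix R M assume "R i = n \<and> I n R M"
    then show "ev R M (Less (Reg i) (Reg b)) = 0" using b[of n R M] by simp
  qed (use 0 q Q in \<open>auto simp: algebra_simps\<close>)
qed (use k in auto)

section \<open>Tropical values of functions of transcripts\<close>

primrec bits_num :: "bool list \<Rightarrow> nat" where
  "bits_num [] = 0"
| "bits_num (b # x) = of_bool b + 2 * bits_num x"

lemma upt_double: "concat (map (\<lambda>x. [2 * x, Suc (2 * x)]) [0..<m]) = [0..<2 * m]"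
  by (induction m) auto

text \<open>\<open>n_lists\<close> varies the first component fastest, which matches digits with the
  least significant one first. Hence the output encoding of a tensor is the table of its entries in
  numerical order.\<close>

lemma bits_num_n_lists: "map bits_num (List.n_lists t [False, True]) = [0..<2 ^ t]"
proof (induction t)
  case (Suc t)
  have "map bits_num (List.n_lists (Suc t) [False, True])
      = concat (map (\<lambda>x. [2 * x, Suc (2 * x)]) (map bits_num (List.n_lists t [False, True])))"
    by (simp add: map_concat o_def)
  then show ?case using upt_double[of "2 ^ t"] Suc by simp
qed simp

text \<open>Tropical averaging of a function of the number whose binary digits, least significant first,
  are the tensor index.\<close>

definition trop_val :: "nat \<Rightarrow> (nat \<Rightarrow> real) \<Rightarrow> real" where
  "trop_val t g = trop_avg t (\<lambda>x. g (bits_num x))"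

lemma trop_val_0 [simp]: "trop_val 0 g = g 0"
  by (simp add: trop_val_def)

lemma trop_val_Suc_Suc: "trop_val (Suc (Suc t)) g =
   (max (trop_val t (\<lambda>I. g (4 * I))) (trop_val t (\<lambda>I. g (4 * I + 2)))
    + max (trop_val t (\<lambda>I. g (4 * I + 1))) (trop_val t (\<lambda>I. g (4 * I + 3)))) / 2"
  by (simp add: trop_val_def algebra_simps numeral_3_eq_3)

text \<open>Within the first \<open>K\<close> digit pairs of \<open>I\<close>, \<open>block 1\<close> reads the averaged digits and
  \<open>block 2\<close> the maximised ones.\<close>

primrec block :: "nat \<Rightarrow> nat \<Rightarrow> nat \<Rightarrow> nat" where
  "block sel I 0 = 0"
| "block sel I (Suc c) = 2 * block sel I c + (I div 4 ^ c div sel) mod 2"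

lemma block_less: "block sel I K < 2 ^ K"
proof (induction K)
  case (Suc K)
  have "(I div 4 ^ K div sel) mod 2 < 2" by simp
  then show ?case using Suc by simp
qed simp

text \<open>A pair put in at the low end of the index becomes the top bit of the block: the pair
  that is quantified first is the most significant one.\<close>

lemma block_shift:
  assumes "d < 4" and that: "sel = 1 \<or> sel = 2"
  shows "block sel (4 * I + d) (Suc K) = (d div sel) mod 2 * 2 ^ K + block sel I K"
proof (induction K)
  case 0
  have "(4 * I + d) div 2 mod 2 = d div 2 mod 2" "(4 * I + d) mod 2 = d mod 2" by presburger+
  then show ?case using that by auto
next
  case (Suc K)
  have *: "(4 * I + d) div 4 ^ Suc K = I div 4 ^ K"
    using assms by (simp add: div_mult2_eq)
  have "block sel (4 * I + d) (Suc (Suc K))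
     = 2 * block sel (4 * I + d) (Suc K) + ((4 * I + d) div 4 ^ Suc K div sel) mod 2"
    by (rule block.simps)
  also have "\<dots> = (d div sel) mod 2 * 2 ^ Suc K + block sel I (Suc K)"
    unfolding Suc * by simp
  finally show ?case .
qed

lemma div_shift: "d < 4 \<Longrightarrow> (4 * I + d) div 4 ^ Suc K = I div 4 ^ K" for I d K :: nat
  by (simp add: div_mult2_eq)

lemma block_cases:
  "block 1 (4 * I) (Suc K) = block 1 I K" "block 1 (4 * I + 2) (Suc K) = block 1 I K"
  "block 1 (4 * I + 1) (Suc K) = 2 ^ K + block 1 I K" "block 1 (4 * I + 3) (Suc K) = 2 ^ K + block 1 I K"
  "block 2 (4 * I) (Suc K) = block 2 I K" "block 2 (4 * I + 2) (Suc K) = 2 ^ K + block 2 I K"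
  "block 2 (4 * I + 1) (Suc K) = block 2 I K" "block 2 (4 * I + 3) (Suc K) = 2 ^ K + block 2 I K"
  using block_shift[of 0 1 I K] block_shift[of 1 1 I K] block_shift[of 2 1 I K] block_shift[of 3 1 I K]
    block_shift[of 0 2 I K] block_shift[of 1 2 I K] block_shift[of 2 2 I K] block_shift[of 3 2 I K]
  by (simp_all del: block.simps power_Suc)

lemma div_cases:
  "(4 * I) div 4 ^ Suc K = I div 4 ^ K" "(4 * I + 1) div 4 ^ Suc K = I div 4 ^ K"
  "(4 * I + 2) div 4 ^ Suc K = I div 4 ^ K" "(4 * I + 3) div 4 ^ Suc K = I div 4 ^ K" for I :: nat
  using div_shift[of 0 I K] div_shift[of 1 I K] div_shift[of 2 I K] div_shift[of 3 I K] by (simp_all del: power_Suc)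

text \<open>The digit of a pair that the block ignores changes nothing, since it only forms the
  maximum or the mean of two equal numbers. The other digit splits the range of the block into
  halves.\<close>

lemma trop_val_block_Suc:
  "trop_val (2 * Suc K + t) (\<lambda>I. G (block 1 I (Suc K)) (I div 4 ^ Suc K)) =
    (trop_val (2 * K + t) (\<lambda>I. G (block 1 I K) (I div 4 ^ K))
     + trop_val (2 * K + t) (\<lambda>I. G (2 ^ K + block 1 I K) (I div 4 ^ K))) / 2"
  "trop_val (2 * Suc K + t) (\<lambda>I. G (block 2 I (Suc K)) (I div 4 ^ Suc K)) =
    max (trop_val (2 * K + t) (\<lambda>I. G (block 2 I K) (I div 4 ^ K)))
      (trop_val (2 * K + t) (\<lambda>I. G (2 ^ K + block 2 I K) (I div 4 ^ K)))"
proof -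
  have t: "2 * Suc K + t = Suc (Suc (2 * K + t))" by simp
  show "trop_val (2 * Suc K + t) (\<lambda>I. G (block 1 I (Suc K)) (I div 4 ^ Suc K)) =
    (trop_val (2 * K + t) (\<lambda>I. G (block 1 I K) (I div 4 ^ K))
     + trop_val (2 * K + t) (\<lambda>I. G (2 ^ K + block 1 I K) (I div 4 ^ K))) / 2"
    unfolding t trop_val_Suc_Suc block_cases div_cases max.idem ..
  show "trop_val (2 * Suc K + t) (\<lambda>I. G (block 2 I (Suc K)) (I div 4 ^ Suc K)) =
    max (trop_val (2 * K + t) (\<lambda>I. G (block 2 I K) (I div 4 ^ K)))
      (trop_val (2 * K + t) (\<lambda>I. G (2 ^ K + block 2 I K) (I div 4 ^ K)))"
    unfolding t trop_val_Suc_Suc block_cases div_cases by (simp only: mult_2[symmetric] field_sum_of_halves add_divide_distrib)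
qed

lemma trop_val_average:
  "trop_val (2 * K + t) (\<lambda>I. G (block 1 I K) (I div 4 ^ K)) = (\<Sum>x<2 ^ K. trop_val t (G x)) / 2 ^ K"
proof (induction K arbitrary: G)
  case (Suc K)
  have split: "{..<2 ^ Suc K} = {..<2 ^ K} \<union> (\<lambda>x. 2 ^ K + x) ` {..<2 ^ K :: nat}"
  proof (intro equalityI subsetI)
    fix x :: nat assume "x \<in> {..<2 ^ Suc K}"
    then have "x < 2 ^ K \<or> x = 2 ^ K + (x - 2 ^ K) \<and> x - 2 ^ K < 2 ^ K" by auto
    then show "x \<in> {..<2 ^ K} \<union> (\<lambda>x. 2 ^ K + x) ` {..<2 ^ K}" by blast
  qed auto
  have "(\<Sum>x<2 ^ Suc K. trop_val t (G x)) =
     (\<Sum>x<2 ^ K. trop_val t (G x)) + (\<Sum>x<2 ^ K. trop_val t (G (2 ^ K + x)))"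
    unfolding split by (subst sum.union_disjoint) (auto simp: sum.reindex)
  then show ?case
    unfolding trop_val_block_Suc Suc.IH[of G] Suc.IH[of "\<lambda>x. G (2 ^ K + x)"] by (simp add: add_divide_distrib)
qed simp

lemma trop_val_max_le:
  assumes "\<And>x. x < 2 ^ K \<Longrightarrow> trop_val t (G x) \<le> B"
  shows "trop_val (2 * K + t) (\<lambda>I. G (block 2 I K) (I div 4 ^ K)) \<le> B"
  using assms
proof (induction K arbitrary: G)
  case (Suc K)
  have "trop_val (2 * K + t) (\<lambda>I. G (block 2 I K) (I div 4 ^ K)) \<le> B"
    using Suc.prems by (intro Suc.IH) simp
  moreover have "trop_val (2 * K + t) (\<lambda>I. G (2 ^ K + block 2 I K) (I div 4 ^ K)) \<le> B"
    using Suc.prems by (intro Suc.IH[of "\<lambda>x. G (2 ^ K + x)"]) simp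
  ultimately show ?case unfolding trop_val_block_Suc by (rule max.boundedI)
qed simp

lemma trop_val_le_max:
  assumes "x < 2 ^ K" "B \<le> trop_val t (G x)"
  shows "B \<le> trop_val (2 * K + t) (\<lambda>I. G (block 2 I K) (I div 4 ^ K))"
  using assms
proof (induction K arbitrary: G x)
  case (Suc K)
  have "B \<le> max (trop_val (2 * K + t) (\<lambda>I. G (block 2 I K) (I div 4 ^ K)))
     (trop_val (2 * K + t) (\<lambda>I. G (2 ^ K + block 2 I K) (I div 4 ^ K)))"
  proof (cases "x < 2 ^ K")
    case True
    then show ?thesis using Suc.IH[of x G] Suc.prems by simp
  next
    case False
    then have "x - 2 ^ K < 2 ^ K" using Suc.prems by simp
    then show ?thesis using False Suc.IH[of "x - 2 ^ K" "\<lambda>x. G (2 ^ K + x)"] Suc.prems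
      by (simp add: le_max_iff_disj)
  qed
  then show ?case unfolding trop_val_block_Suc .
qed simp

lemma trop_val_le_1: "even t \<Longrightarrow> (\<And>I. g I \<le> 1) \<Longrightarrow> trop_val t g \<le> 1"
proof (induction t arbitrary: g rule: nat_less_induct)
  case (1 t)
  show ?case
  proof (cases "t = 0")
    case False
    with 1(2) obtain s where s: "t = Suc (Suc s)" "even s"
      by (metis even_Suc not0_implies_Suc odd_Suc_minus_one)
    then have "trop_val s (\<lambda>I. g (4 * I)) \<le> 1" "trop_val s (\<lambda>I. g (4 * I + 1)) \<le> 1"
      "trop_val s (\<lambda>I. g (4 * I + 2)) \<le> 1" "trop_val s (\<lambda>I. g (4 * I + 3)) \<le> 1"
      using 1 by simp_all
    then show ?thesis using s by (simp add: trop_val_Suc_Suc)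
  qed (use 1 in auto)
qed

lemma trop_val_zero: "even t \<Longrightarrow> trop_val t (\<lambda>I. 0) = 0"
proof (induction t rule: nat_less_induct)
  case (1 t)
  show ?case
  proof (cases "t = 0")
    case False
    with 1(2) obtain s where s: "t = Suc (Suc s)" "even s"
      by (metis even_Suc not0_implies_Suc odd_Suc_minus_one)
    then show ?thesis using 1 by (simp add: trop_val_Suc_Suc)
  qed simp
qed

section \<open>The interactive proof\<close>

datatype quantifier_op = Exist_op nat | Forall_op nat | Linear_op nat

primrec op_var :: "quantifier_op \<Rightarrow> nat" where
  "op_var (Exist_op j) = j"
| "op_var (Forall_op j) = j"
| "op_var (Linear_op j) = j"

text \<open>Arithmetisation: disjunction is \<open>1 - (1 - x) * (1 - y)\<close>, and
  \<open>Linear_op\<close> interpolates linearly between the values at 0 and 1.\<close>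

primrec combine :: "quantifier_op \<Rightarrow> (nat \<Rightarrow> int) \<Rightarrow> int \<Rightarrow> int \<Rightarrow> int" where
  "combine (Exist_op j) r x y = x + y * (1 - x)"
| "combine (Forall_op j) r x y = x * y"
| "combine (Linear_op j) r x y = x * (1 - r j) + r j * y"

definition apply_op :: "quantifier_op \<Rightarrow> ((nat \<Rightarrow> int) \<Rightarrow> int) \<Rightarrow> (nat \<Rightarrow> int) \<Rightarrow> int" where
  "apply_op p f r = combine p r (f (r(op_var p := 0))) (f (r(op_var p := 1)))"

primrec apply_ops :: "quantifier_op list \<Rightarrow> ((nat \<Rightarrow> int) \<Rightarrow> int) \<Rightarrow> (nat \<Rightarrow> int) \<Rightarrow> int" where
  "apply_ops [] f = f"
| "apply_ops (p # ps) f = apply_op p (apply_ops ps f)"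

definition linear_in :: "nat \<Rightarrow> ((nat \<Rightarrow> int) \<Rightarrow> int) \<Rightarrow> bool" where
  "linear_in j f \<longleftrightarrow> (\<forall>r. \<exists>a b. \<forall>z. f (r(j := z)) = a + b * z)"

definition quadratic_in :: "nat \<Rightarrow> ((nat \<Rightarrow> int) \<Rightarrow> int) \<Rightarrow> bool" where
  "quadratic_in j f \<longleftrightarrow> (\<forall>r. \<exists>a b c. \<forall>z. f (r(j := z)) = a + b * z + c * z\<^sup>2)"

text \<open>Guarantees that three coefficients describe the honest polynomial of every round, in
  which a claim about \<open>p # ps\<close> is reduced to one about \<open>ps\<close> with a new
  value for the variable \<open>op_var p\<close>.\<close>

primrec degree_bounded :: "quantifier_op list \<Rightarrow> ((nat \<Rightarrow> int) \<Rightarrow> int) \<Rightarrow> bool" where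
  "degree_bounded [] f = True"
| "degree_bounded (p # ps) f = (quadratic_in (op_var p) (apply_ops ps f) \<and> degree_bounded ps f)"

text \<open>\<open>p + 1 - x\<close> stands for \<open>1 - x\<close> modulo \<open>p\<close>; for
  \<open>x < p\<close> truncated subtraction does not affect it.\<close>

primrec combine_mod :: "nat \<Rightarrow> quantifier_op \<Rightarrow> (nat \<Rightarrow> nat) \<Rightarrow> nat \<Rightarrow> nat \<Rightarrow> nat" where
  "combine_mod p (Exist_op j) r x y = (x + y * (p + 1 - x)) mod p"
| "combine_mod p (Forall_op j) r x y = (x * y) mod p"
| "combine_mod p (Linear_op j) r x y = (x * (p + 1 - r j) + r j * y) mod p"

text \<open>One round: Merlin sends the coefficients of a quadratic polynomial, the verifier checks its
  values at 0 and 1 against the current claim \<open>v\<close> and continues with its value at Arthur's \<open>z\<close>.\<close>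

primrec transcript_ok :: "nat \<Rightarrow> nat \<Rightarrow> ((nat \<Rightarrow> nat) \<Rightarrow> nat \<Rightarrow> nat \<Rightarrow> bool) \<Rightarrow> quantifier_op list \<Rightarrow>
    (nat \<Rightarrow> nat) \<Rightarrow> nat \<Rightarrow> nat \<Rightarrow> bool" where
  "transcript_ok p K fin [] = fin"
| "transcript_ok p K fin (x # xs) = (\<lambda>r v I.
     let a = block 2 I K mod p; b = block 2 (I div 4 ^ K) K mod p;
       c = block 2 (I div 4 ^ K div 4 ^ K) K mod p;
       z = block 1 (I div 4 ^ K div 4 ^ K div 4 ^ K) K mod p
     in combine_mod p x r a ((a + b + c) mod p) = v
       \<and> transcript_ok p K fin xs (r(op_var x := z)) ((a + z * (b + z * c)) mod p)
          (I div 4 ^ K div 4 ^ K div 4 ^ K div 4 ^ K))"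

text \<open>Polynomials stay over the integers and are only compared modulo \<open>p\<close>, so
  that degrees and Boolean values are proved independently of the field.\<close>

definition claim :: "nat \<Rightarrow> ((nat \<Rightarrow> int) \<Rightarrow> int) \<Rightarrow> (nat \<Rightarrow> nat) \<Rightarrow> nat \<Rightarrow> bool" where
  "claim p f r v \<longleftrightarrow> [f (\<lambda>i. int (r i)) = int v] (mod int p)"

text \<open>Both tensors repeat all checks of the rounds and differ in the final one only. Their
  entrywise product is therefore a single protocol with the conjunction of the final checks.\<close>

lemma transcript_ok_conj:
  "(transcript_ok p K fin1 xs r v I \<and> transcript_ok p K fin2 xs r v I)
    = transcript_ok p K (\<lambda>r v I. fin1 r v I \<and> fin2 r v I) xs r v I"
  by (induction xs arbitrary: r v I) (auto simp: Let_def)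

lemma int_fun_upd: "(\<lambda>i. int ((r(j := z)) i)) = (\<lambda>i. int (r i))(j := int z)"
  by auto

lemma combine_mod_cong:
  assumes "x < p" "\<And>j. r j < p"
  shows "[int (combine_mod p e r x y) = combine e (\<lambda>i. int (r i)) (int x) (int y)] (mod int p)"
proof -
  have 1: "[int (p + 1 - u) = 1 - int u] (mod int p)" if "u < p" for u
  proof -
    have "int (p + 1 - u) = 1 - int u + int p" using that by simp
    then show ?thesis by (simp add: cong_def)
  qed
  show ?thesis
  proof (cases e)
    case (Exist_op j)
    then show ?thesis using cong_add[OF cong_refl cong_mult[OF cong_refl 1[OF assms(1)]], of "int x" "int y"]
      by (simp add: zmod_int cong_def)
  next
    case (Forall_op j)
    then show ?thesis by (simp add: zmod_int cong_def)
  next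
    case (Linear_op j)
    then show ?thesis
      using cong_add[OF cong_mult[OF cong_refl 1[OF assms(2)[of j]]] cong_refl, of "int x" "int (r j) * int y"]
      by (simp add: zmod_int cong_def)
  qed
qed

lemma combine_cong:
  assumes "[x = x'] (mod m)" "[y = y'] (mod m)"
  shows "[combine e r x y = combine e r x' y'] (mod m)"
  using assms by (cases e) (simp_all add: cong_add cong_mult cong_diff)

text \<open>Serves both directions: a Merlin who sends the true coefficients passes the test on a
  true claim, and one who passes it on a false claim must have sent a different polynomial.\<close>

lemma combine_mod_apply_op:
  assumes "\<And>z. g ((\<lambda>i. int (r i))(op_var e := z)) = a' + b' * z + c' * z\<^sup>2"
    and cg: "[int a = a'] (mod int p)" "[int b = b'] (mod int p)" "[int c = c'] (mod int p)"
    and "a < p" "\<And>j. r j < p"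
  shows "[int (combine_mod p e r a ((a + b + c) mod p)) = apply_op e g (\<lambda>i. int (r i))] (mod int p)"
proof -
  have "[int ((a + b + c) mod p) = int a + int b + int c] (mod int p)" by (simp add: zmod_int cong_def)
  also have "[int a + int b + int c = a' + b' + c'] (mod int p)" using cg by (intro cong_add)
  finally have "[int (combine_mod p e r a ((a + b + c) mod p)) = combine e (\<lambda>i. int (r i)) a' (a' + b' + c')] (mod int p)"
    using combine_mod_cong[OF assms(5,6)] combine_cong[OF cg(1)] by (meson cong_trans)
  then show ?thesis using assms(1)[of 0] assms(1)[of 1] by (simp add: apply_op_def)
qed

text \<open>Subtracting the values at two roots \<open>u\<close>, \<open>v\<close> and cancelling
  \<open>u - v\<close> leaves \<open>b + c * (u + v)\<close>. Two pairs among three roots give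
  \<open>p dvd c\<close>, whence \<open>p dvd b\<close> and \<open>p dvd a\<close>.\<close>

lemma card_roots_le_2:
  fixes a b c :: int
  assumes "prime p" "\<not> (int p dvd a \<and> int p dvd b \<and> int p dvd c)"
  shows "card {x. x < p \<and> int p dvd a + b * int x + c * (int x)\<^sup>2} \<le> 2" (is "card ?S \<le> 2")
proof (rule ccontr)
  assume "\<not> card ?S \<le> 2"
  then have "3 \<le> card ?S" by simp
  then obtain T where "T \<subseteq> ?S" "card T = 3" by (rule obtain_subset_with_card_n)
  then obtain x y z where S: "x \<in> ?S" "y \<in> ?S" "z \<in> ?S" and ne: "x \<noteq> y" "x \<noteq> z" "y \<noteq> z"
    by (auto simp: card_3_iff)
  have nd: "\<not> int p dvd int u - int v" if "u < p" "v < p" "u \<noteq> v" for u v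
  proof
    assume "int p dvd int u - int v"
    then have "[u = v] (mod p)" by (simp add: cong_iff_dvd_diff flip: cong_int_iff)
    then show False using that by (simp add: cong_def)
  qed
  have P: "prime (int p)" using assms(1) by simp
  have lin: "int p dvd b + c * (int u + int v)" if "u \<in> ?S" "v \<in> ?S" "u \<noteq> v" for u v
  proof -
    have "int p dvd (a + b * int u + c * (int u)\<^sup>2) - (a + b * int v + c * (int v)\<^sup>2)"
      using that by (intro dvd_diff) auto
    also have "\<dots> = (int u - int v) * (b + c * (int u + int v))"
      by (simp add: algebra_simps power2_eq_square)
    finally show ?thesis using nd[of u v] that P prime_dvd_mult_iff by blast
  qed
  have "int p dvd (b + c * (int x + int y)) - (b + c * (int x + int z))"
    using lin[of x y] lin[of x z] S ne by (intro dvd_diff) auto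
  also have "\<dots> = c * (int y - int z)" by (simp add: algebra_simps)
  finally have c: "int p dvd c" using nd[of y z] S ne P prime_dvd_mult_iff by blast
  have "int p dvd c * (int x + int y)" using c by (rule dvd_mult2)
  from dvd_add_left_iff[OF this] have b: "int p dvd b" using lin[of x y] S ne by blast
  have "int p dvd b * int x + c * (int x)\<^sup>2" using b c by (intro dvd_add dvd_mult2)
  from dvd_add_left_iff[OF this] have "int p dvd a" using S by (simp add: add.assoc)
  then show False using assms b c by blast
qed

section \<open>Frequency of residues among the numbers below a bound\<close>

lemma card_residue_le: "card {z. z < m \<and> z mod p = x} \<le> m div p + 1" for p :: nat
proof -
  have "inj_on (\<lambda>z. z div p) {z. z < m \<and> z mod p = x}"
    by (rule inj_onI) (metis (mono_tags, lifting) div_mult_mod_eq mem_Collect_eq)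
  moreover have "(\<lambda>z. z div p) ` {z. z < m \<and> z mod p = x} \<subseteq> {..m div p}"
    by (auto intro: div_le_mono)
  ultimately have "card {z. z < m \<and> z mod p = x} \<le> card {..m div p}"
    by (intro card_inj_on_le) auto
  then show ?thesis by simp
qed

text \<open>Arthur's point is a \<open>K\<close>-bit number reduced modulo \<open>p\<close>, which
  need not be uniform. A residue occurs at most \<open>m div p + 1\<close> times, hence at most
  \<open>2 * m / p\<close> times as \<open>p \<le> m\<close>, and there are two residues to
  avoid.\<close>

lemma card_residues_le:
  assumes "p \<le> m" "0 < p" "finite X" "card X \<le> 2"
  shows "real (card {z. z < m \<and> z mod p \<in> X}) \<le> 4 * real m / real p"
proof -
  have "{z. z < m \<and> z mod p \<in> X} = (\<Union>x\<in>X. {z. z < m \<and> z mod p = x})" by auto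
  then have "card {z. z < m \<and> z mod p \<in> X} \<le> (\<Sum>x\<in>X. card {z. z < m \<and> z mod p = x})"
    using card_UN_le[OF assms(3), of "\<lambda>x. {z. z < m \<and> z mod p = x}"] by simp
  also have "\<dots> \<le> card X * (m div p + 1)"
    using sum_bounded_above[of X "\<lambda>x. card {z. z < m \<and> z mod p = x}" "m div p + 1", OF card_residue_le]
    by simp
  also have "\<dots> \<le> 2 * (m div p + 1)" using assms(4) by (rule mult_right_mono) simp
  finally have "real (card {z. z < m \<and> z mod p \<in> X}) \<le> 2 * (real (m div p) + 1)"
    by (metis (mono_tags) of_nat_1 of_nat_add of_nat_le_iff of_nat_mult of_nat_numeral)
  also have "\<dots> \<le> 2 * (real m / real p + 1)"
    using of_nat_div_le_of_nat[of m p, where 'a = real] by simp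
  also have "\<dots> \<le> 2 * (real m / real p + real m / real p)"
    using assms(1,2) by (intro mult_left_mono add_left_mono) simp_all
  finally show ?thesis by simp
qed

section \<open>One round as three maxima around an average; soundness and completeness\<close>

abbreviation on_round :: "(nat \<Rightarrow> nat \<Rightarrow> nat \<Rightarrow> nat \<Rightarrow> nat \<Rightarrow> 'a) \<Rightarrow> nat \<Rightarrow> nat \<Rightarrow> 'a" where
  "on_round H K I \<equiv> H (block 2 I K) (block 2 (I div 4 ^ K) K) (block 2 (I div 4 ^ K div 4 ^ K) K)
     (block 1 (I div 4 ^ K div 4 ^ K div 4 ^ K) K) (I div 4 ^ K div 4 ^ K div 4 ^ K div 4 ^ K)"

text \<open>Merlin moves before Arthur, so the average over \<open>z\<close> is innermost and a
  bound for each fixed triple of coefficients is enough.\<close>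

lemma trop_val_round_le:
  assumes "\<And>a b c. (\<Sum>z<2 ^ K. trop_val t (H a b c z)) / 2 ^ K \<le> B"
  shows "trop_val (8 * K + t) (\<lambda>I. on_round H K I) \<le> B"
proof -
  have t: "8 * K + t = 2 * K + (2 * K + (2 * K + (2 * K + t)))" by simp
  show ?thesis unfolding t
    \<comment> \<open>\<open>G\<close> has to be named: each application peels off the first block
      and reindexes those that remain.\<close>
    apply (rule trop_val_max_le[where G = "\<lambda>a I. H a (block 2 I K)
      (block 2 (I div 4 ^ K) K) (block 1 (I div 4 ^ K div 4 ^ K) K)
      (I div 4 ^ K div 4 ^ K div 4 ^ K)"])
    subgoal for a
      apply (rule trop_val_max_le[where G = "\<lambda>b I. H a b (block 2 I K)
        (block 1 (I div 4 ^ K) K) (I div 4 ^ K div 4 ^ K)"])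
      subgoal for b
        apply (rule trop_val_max_le[where G = "\<lambda>c I. H a b c (block 1 I K) (I div 4 ^ K)"])
        subgoal for c
          using assms[of a b c] unfolding trop_val_average[where G = "H a b c"] .
        done
      done
    done
qed

lemma trop_val_le_round:
  assumes "a < 2 ^ K" "b < 2 ^ K" "c < 2 ^ K" "\<And>z. z < 2 ^ K \<Longrightarrow> 1 \<le> trop_val t (H a b c z)"
  shows "1 \<le> trop_val (8 * K + t) (\<lambda>I. on_round H K I)"
proof -
  have t: "8 * K + t = 2 * K + (2 * K + (2 * K + (2 * K + t)))" by simp
  have "(\<Sum>z<(2 :: nat) ^ K. 1) \<le> (\<Sum>z<2 ^ K. trop_val t (H a b c z))"
    using assms(4) by (intro sum_mono) simp
  then have *: "1 \<le> (\<Sum>z<2 ^ K. trop_val t (H a b c z)) / 2 ^ K" by simp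
  show ?thesis unfolding t
    apply (rule trop_val_le_max[where x = a and G = "\<lambda>a I. H a (block 2 I K)
      (block 2 (I div 4 ^ K) K) (block 1 (I div 4 ^ K div 4 ^ K) K)
      (I div 4 ^ K div 4 ^ K div 4 ^ K)"], rule assms)
    apply (rule trop_val_le_max[where x = b and G = "\<lambda>b I. H a b (block 2 I K)
        (block 1 (I div 4 ^ K) K) (I div 4 ^ K div 4 ^ K)"], rule assms)
    apply (rule trop_val_le_max[where x = c and G = "\<lambda>c I. H a b c (block 1 I K) (I div 4 ^ K)"], rule assms)
    using * unfolding trop_val_average[where G = "H a b c"] .
qed

text \<open>Union bound over the rounds. On a false claim Merlin passes the test only with a
  polynomial other than the true one, and then the next claim is false too unless the point falls on
  one of at most two residues. The last \<open>2 * K\<close> factors carry the message read by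
  \<open>fin\<close>.\<close>

lemma protocol_sound:
  assumes p: "prime p" "p \<le> 2 ^ K"
    and fin: "\<And>r v I. (\<forall>i. r i < p) \<Longrightarrow> \<not> claim p f r v \<Longrightarrow> \<not> fin r v I"
  shows "degree_bounded xs f \<Longrightarrow> (\<forall>i. r i < p) \<Longrightarrow> \<not> claim p (apply_ops xs f) r v \<Longrightarrow>
     trop_val (8 * K * length xs + 2 * K) (\<lambda>I. of_bool (transcript_ok p K fin xs r v I))
       \<le> real (length xs) * (4 / real p)"
proof (induction xs arbitrary: r v)
  case Nil
  then have "\<not> fin r v I" for I using fin by simp
  then show ?case by (simp add: trop_val_zero)
next
  case (Cons x xs)
  let ?t = "8 * K * length xs + 2 * K" and ?B = "real (length xs) * (4 / real p)"
  let ?j = "op_var x" and ?r = "\<lambda>i. int (r i)"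
  have p0: "0 < p" using p(1) prime_gt_0_nat by blast
  obtain a' b' c' where abc: "\<And>z. apply_ops xs f (?r(?j := z)) = a' + b' * z + c' * z\<^sup>2"
    using Cons.prems(1) unfolding degree_bounded.simps quadratic_in_def by metis
  \<comment> \<open>One round as a function of the raw blocks, so that \<open>on_round H K\<close>
    unfolds to the transcript check.\<close>
  define H where "H a b c z I = (of_bool (combine_mod p x r (a mod p) ((a mod p + b mod p + c mod p) mod p) = v
     \<and> transcript_ok p K fin xs (r(?j := z mod p))
       ((a mod p + (z mod p) * (b mod p + (z mod p) * (c mod p))) mod p) I) :: real)" for a b c z I :: nat
  have B0: "0 \<le> ?B" by simp
  have H1: "trop_val ?t (H a b c z) \<le> 1" for a b c z
    by (rule trop_val_le_1) (auto simp: H_def)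
  have "(\<Sum>z<2 ^ K. trop_val ?t (H a b c z)) / 2 ^ K \<le> ?B + 4 / real p" for a b c
  proof (cases "combine_mod p x r (a mod p) ((a mod p + b mod p + c mod p) mod p) = v")
    case False
    then have "H a b c z = (\<lambda>I. 0)" for z by (auto simp: H_def)
    then show ?thesis by (simp add: trop_val_zero)
  next
    case True
    define A0 B' C where "A0 = int (a mod p)" and "B' = int (b mod p)" and "C = int (c mod p)"
    \<comment> \<open>Were Merlin's polynomial the true one modulo \<open>p\<close>, the passed test
      would make the current claim true.\<close>
    have "\<not> (int p dvd A0 - a' \<and> int p dvd B' - b' \<and> int p dvd C - c')"
    proof
      assume "int p dvd A0 - a' \<and> int p dvd B' - b' \<and> int p dvd C - c'"
      then have cg: "[A0 = a'] (mod int p)" "[B' = b'] (mod int p)" "[C = c'] (mod int p)"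
        by (auto simp: cong_iff_dvd_diff)
      have "claim p (apply_ops (x # xs) f) r v"
        using combine_mod_apply_op[OF abc cg[unfolded A0_def B'_def C_def]] p0 Cons.prems(2)
        unfolding True by (simp add: claim_def cong_sym_eq)
      then show False using Cons.prems(3) by simp
    qed
    then have card2: "card {y. y < p \<and> int p dvd (A0 - a') + (B' - b') * int y + (C - c') * (int y)\<^sup>2} \<le> 2"
      (is "card ?X \<le> 2") by (rule card_roots_le_2[OF p(1)])
    let ?bad = "{z. z < 2 ^ K \<and> z mod p \<in> ?X}"
    have good: "trop_val ?t (H a b c z) \<le> ?B" if "z < 2 ^ K" "z \<notin> ?bad" for z
    proof -
      let ?z = "z mod p"
      let ?v = "(a mod p + ?z * (b mod p + ?z * (c mod p))) mod p"
      have z: "?z < p" using p0 by simp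
      have nd: "\<not> int p dvd (A0 - a') + (B' - b') * int ?z + (C - c') * (int ?z)\<^sup>2" using that z by blast
      have nc: "\<not> claim p (apply_ops xs f) (r(?j := ?z)) ?v"
      proof
        assume "claim p (apply_ops xs f) (r(?j := ?z)) ?v"
        then have "[a' + b' * int ?z + c' * (int ?z)\<^sup>2 = int ?v] (mod int p)"
          unfolding claim_def int_fun_upd abc .
        moreover have "[int ?v = A0 + int ?z * (B' + int ?z * C)] (mod int p)"
          unfolding A0_def B'_def C_def by (simp add: zmod_int cong_def mod_simps)
        ultimately have "[A0 + int ?z * (B' + int ?z * C) = a' + b' * int ?z + c' * (int ?z)\<^sup>2] (mod int p)"
          by (meson cong_sym cong_trans)
        then have "int p dvd (A0 + int ?z * (B' + int ?z * C)) - (a' + b' * int ?z + c' * (int ?z)\<^sup>2)"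
          by (simp add: cong_iff_dvd_diff)
        also have "(A0 + int ?z * (B' + int ?z * C)) - (a' + b' * int ?z + c' * (int ?z)\<^sup>2)
           = (A0 - a') + (B' - b') * int ?z + (C - c') * (int ?z)\<^sup>2"
          by (simp add: algebra_simps power2_eq_square)
        finally show False using nd by blast
      qed
      then have "trop_val ?t (\<lambda>I. of_bool (transcript_ok p K fin xs (r(?j := ?z)) ?v I)) \<le> ?B"
        using Cons.prems(1,2) z by (intro Cons.IH[OF _ _ nc]) simp_all
      moreover have "H a b c z = (\<lambda>I. of_bool (transcript_ok p K fin xs (r(?j := ?z)) ?v I))"
        using True by (auto simp: H_def)
      ultimately show ?thesis by simp
    qed
    \<comment> \<open>A bad point may contribute as much as 1; the others are covered by the
      induction hypothesis.\<close>
    have "(\<Sum>z<2 ^ K. trop_val ?t (H a b c z)) \<le> (\<Sum>z<2 ^ K. ?B + of_bool (z \<in> ?bad))"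
    proof (rule sum_mono)
      fix z :: nat assume "z \<in> {..<2 ^ K}"
      then show "trop_val ?t (H a b c z) \<le> ?B + of_bool (z \<in> ?bad)"
      proof (cases "z \<in> ?bad")
        case True
        then have "of_bool (z \<in> ?bad) = (1 :: real)" by (simp only: of_bool_eq)
        then show ?thesis using H1[of a b c z] B0 by linarith
      next
        case False
        then have "of_bool (z \<in> ?bad) = (0 :: real)" by (simp only: of_bool_eq)
        then show ?thesis using good[OF _ False] \<open>z \<in> {..<2 ^ K}\<close> by simp
      qed
    qed
    also have "\<dots> = 2 ^ K * ?B + real (card ?bad)"
    proof -
      have "(\<Sum>z<(2::nat) ^ K. of_bool (z \<in> ?bad)) = real (card ({..<2 ^ K} \<inter> ?bad))"
        by (simp add: of_bool_def sum.If_cases Int_def)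
      also have "{..<2 ^ K} \<inter> ?bad = ?bad" by auto
      finally show ?thesis by (simp add: sum.distrib)
    qed
    also have "\<dots> \<le> 2 ^ K * ?B + 4 * real (2 ^ K) / real p"
      using card_residues_le[OF p(2) p0 _ card2] by simp
    finally show ?thesis by (simp add: field_simps)
  qed
  then have "trop_val (8 * K + ?t) (\<lambda>I. on_round H K I) \<le> ?B + 4 / real p"
    by (rule trop_val_round_le)
  moreover have L: "8 * K * length (x # xs) + 2 * K = 8 * K + ?t" by simp
  moreover have eq: "(\<lambda>I. of_bool (transcript_ok p K fin (x # xs) r v I)) = (\<lambda>I. on_round H K I)"
    by (simp only: transcript_ok.simps Let_def H_def)
  moreover have "?B + 4 / real p = real (length (x # xs)) * (4 / real p)"
    by (simp add: distrib_right add_divide_distrib)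
  ultimately show ?case by (simp only:)
qed

lemma protocol_complete:
  assumes p: "0 < p" "p \<le> 2 ^ K"
    and fin: "\<And>r v. (\<forall>i. r i < p) \<Longrightarrow> v < p \<Longrightarrow> claim p f r v \<Longrightarrow>
       1 \<le> trop_val (2 * K) (\<lambda>I. of_bool (fin r v I))"
  shows "degree_bounded xs f \<Longrightarrow> (\<forall>i. r i < p) \<Longrightarrow> v < p \<Longrightarrow> claim p (apply_ops xs f) r v \<Longrightarrow>
     1 \<le> trop_val (8 * K * length xs + 2 * K) (\<lambda>I. of_bool (transcript_ok p K fin xs r v I))"
proof (induction xs arbitrary: r v)
  case Nil
  then show ?case using fin by simp
next
  case (Cons x xs)
  let ?t = "8 * K * length xs + 2 * K"
  let ?j = "op_var x" and ?r = "\<lambda>i. int (r i)"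
  obtain a' b' c' where abc: "\<And>z. apply_ops xs f (?r(?j := z)) = a' + b' * z + c' * z\<^sup>2"
    using Cons.prems(1) unfolding degree_bounded.simps quadratic_in_def by metis
  define H where "H a b c z I = (of_bool (combine_mod p x r (a mod p) ((a mod p + b mod p + c mod p) mod p) = v
     \<and> transcript_ok p K fin xs (r(?j := z mod p))
       ((a mod p + (z mod p) * (b mod p + (z mod p) * (c mod p))) mod p) I) :: real)" for a b c z I :: nat
  \<comment> \<open>The honest message: the true coefficients reduced modulo
    \<open>p\<close>.\<close>
  define a b c where "a = nat (a' mod int p)" and "b = nat (b' mod int p)" and "c = nat (c' mod int p)"
  have lt: "a < p" "b < p" "c < p" using p(1) by (auto simp: a_def b_def c_def nat_less_iff)
  have cg: "[int a = a'] (mod int p)" "[int b = b'] (mod int p)" "[int c = c'] (mod int p)"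
    using p(1) by (auto simp: a_def b_def c_def cong_def)
  have "[int (combine_mod p x r a ((a + b + c) mod p)) = int v] (mod int p)"
    using combine_mod_apply_op[OF abc cg lt(1)] Cons.prems(2,4) unfolding claim_def by (simp add: cong_trans)
  \<comment> \<open>Both sides are residues below \<open>p\<close>, so the congruence is an
    equality; this is where \<open>v < p\<close> enters.\<close>
  then have test: "combine_mod p x r a ((a + b + c) mod p) = v"
    using Cons.prems(3) p(1) by (cases x) (auto simp: cong_int_iff cong_def)
  have "1 \<le> trop_val ?t (H a b c z)" for z
  proof -
    let ?z = "z mod p"
    let ?v = "(a + ?z * (b + ?z * c)) mod p"
    have z: "?z < p" using p(1) by simp
    have "[int ?v = int a + int ?z * (int b + int ?z * int c)] (mod int p)"
      by (simp add: zmod_int cong_def mod_simps)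
    also have "[int a + int ?z * (int b + int ?z * int c) = a' + int ?z * (b' + int ?z * c')] (mod int p)"
      using cg by (intro cong_add cong_mult cong_refl)
    also have "a' + int ?z * (b' + int ?z * c') = apply_ops xs f (?r(?j := int ?z))"
      unfolding abc by (simp add: algebra_simps power2_eq_square)
    finally have nc: "claim p (apply_ops xs f) (r(?j := ?z)) ?v"
      unfolding claim_def int_fun_upd by (rule cong_sym)
    then have "1 \<le> trop_val ?t (\<lambda>I. of_bool (transcript_ok p K fin xs (r(?j := ?z)) ?v I))"
      using Cons.prems(1,2) z p(1) by (intro Cons.IH[OF _ _ _ nc]) simp_all
    moreover have "H a b c z = (\<lambda>I. of_bool (transcript_ok p K fin xs (r(?j := ?z)) ?v I))"
      using test lt by (auto simp: H_def)
    ultimately show ?thesis by simp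
  qed
  then have "1 \<le> trop_val (8 * K + ?t) (\<lambda>I. on_round H K I)"
    using lt p(2) by (intro trop_val_le_round[of a K b c]) auto
  moreover have L: "8 * K * length (x # xs) + 2 * K = 8 * K + ?t" by simp
  moreover have eq: "(\<lambda>I. of_bool (transcript_ok p K fin (x # xs) r v I)) = (\<lambda>I. on_round H K I)"
    by (simp only: transcript_ok.simps Let_def H_def)
  ultimately show ?case by (simp only:)
qed

section \<open>Degrees under the operators\<close>

lemma linear_imp_quadratic: "linear_in j f \<Longrightarrow> quadratic_in j f"
  unfolding linear_in_def quadratic_in_def by (metis add.right_neutral mult_zero_left)

lemma linear_const: "(\<And>r z. f (r(j := z)) = f r) \<Longrightarrow> linear_in j f"
  unfolding linear_in_def by (metis add.right_neutral mult_zero_left)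

lemma linear_upd: "linear_in j f \<Longrightarrow> linear_in j (\<lambda>r. f (r(i := c)))"
proof (cases "i = j")
  case False
  assume "linear_in j f"
  then show ?thesis unfolding linear_in_def using False by (metis fun_upd_twist)
qed (rule linear_const, simp)

lemma linear_mult_quadratic:
  assumes "linear_in j f" "linear_in j g"
  shows "quadratic_in j (\<lambda>r. f r * g r)" "quadratic_in j (\<lambda>r. f r + g r * (1 - f r))"
  unfolding quadratic_in_def
proof (safe)
  fix r
  obtain a b where f: "\<And>z. f (r(j := z)) = a + b * z" using assms(1) unfolding linear_in_def by metis
  obtain c d where g: "\<And>z. g (r(j := z)) = c + d * z" using assms(2) unfolding linear_in_def by metis
  show "\<exists>x y w. \<forall>z. f (r(j := z)) * g (r(j := z)) = x + y * z + w * z\<^sup>2"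
    unfolding f g by (rule exI[of _ "a * c"], rule exI[of _ "a * d + b * c"], rule exI[of _ "b * d"])
      (simp add: algebra_simps power2_eq_square)
  show "\<exists>x y w. \<forall>z. f (r(j := z)) + g (r(j := z)) * (1 - f (r(j := z))) = x + y * z + w * z\<^sup>2"
    unfolding f g by (rule exI[of _ "a + c * (1 - a)"], rule exI[of _ "b + d * (1 - a) - c * b"], rule exI[of _ "- b * d"])
      (simp add: algebra_simps power2_eq_square)
qed

text \<open>Two restrictions of degree 1 in \<open>j\<close> are multiplied, which gives degree 2.
  The linearisations restore degree 1 before the next quantifier outwards, so the degree never grows
  further.\<close>

lemma quadratic_quantifier:
  assumes "linear_in j f"
  shows "quadratic_in j (apply_op (Exist_op i) f)" "quadratic_in j (apply_op (Forall_op i) f)"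
  using linear_mult_quadratic[OF linear_upd[OF assms, of i 0] linear_upd[OF assms, of i 1]]
  by (simp_all add: apply_op_def[abs_def])

text \<open>The weights \<open>1 - r i\<close> and \<open>r i\<close> do not involve the other
  variables, so linearising in \<open>i\<close> does not raise the degree in them.\<close>

lemma quadratic_Linear_op:
  assumes "quadratic_in j f"
  shows "quadratic_in j (apply_op (Linear_op i) f)"
proof (cases "i = j")
  case True
  show ?thesis unfolding quadratic_in_def apply_op_def True
  proof (simp, intro allI)
    fix r
    show "\<exists>a b c. \<forall>z. f (r(j := 0)) * (1 - z) + z * f (r(j := 1)) = a + b * z + c * z\<^sup>2"
      by (rule exI[of _ "f (r(j := 0))"], rule exI[of _ "f (r(j := 1)) - f (r(j := 0))"], rule exI[of _ 0])
        (simp add: algebra_simps)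
  qed
next
  case False
  show ?thesis unfolding quadratic_in_def
  proof
    fix r
    obtain a b c where f: "\<And>z. f ((r(i := 0))(j := z)) = a + b * z + c * z\<^sup>2"
      using assms unfolding quadratic_in_def by metis
    obtain a' b' c' where g: "\<And>z. f ((r(i := 1))(j := z)) = a' + b' * z + c' * z\<^sup>2"
      using assms unfolding quadratic_in_def by metis
    have "apply_op (Linear_op i) f (r(j := z))
        = (a * (1 - r i) + r i * a') + (b * (1 - r i) + r i * b') * z + (c * (1 - r i) + r i * c') * z\<^sup>2" for z
      using f[of z] g[of z] False by (simp add: apply_op_def fun_upd_twist algebra_simps)
    then show "\<exists>a b c. \<forall>z. apply_op (Linear_op i) f (r(j := z)) = a + b * z + c * z\<^sup>2" by blast
  qed
qed

lemma linear_Linear_op_same: "linear_in j (apply_op (Linear_op j) f)"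
  unfolding linear_in_def apply_op_def
proof (simp, intro allI)
  fix r
  show "\<exists>a b. \<forall>z. f (r(j := 0)) * (1 - z) + z * f (r(j := 1)) = a + b * z"
    by (rule exI[of _ "f (r(j := 0))"], rule exI[of _ "f (r(j := 1)) - f (r(j := 0))"])
      (simp add: algebra_simps)
qed

lemma linear_Linear_op:
  assumes "linear_in j f"
  shows "linear_in j (apply_op (Linear_op i) f)"
proof (cases "i = j")
  case False
  show ?thesis unfolding linear_in_def
  proof
    fix r
    obtain a b where f: "\<And>z. f ((r(i := 0))(j := z)) = a + b * z"
      using assms unfolding linear_in_def by metis
    obtain a' b' where g: "\<And>z. f ((r(i := 1))(j := z)) = a' + b' * z"
      using assms unfolding linear_in_def by metis
    have "apply_op (Linear_op i) f (r(j := z))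
        = (a * (1 - r i) + r i * a') + (b * (1 - r i) + r i * b') * z" for z
      using f[of z] g[of z] False by (simp add: apply_op_def fun_upd_twist algebra_simps)
    then show "\<exists>a b. \<forall>z. apply_op (Linear_op i) f (r(j := z)) = a + b * z" by blast
  qed
qed (simp add: linear_Linear_op_same)

lemma Linear_ops_degree:
  assumes "\<forall>j<n. quadratic_in j f" "\<forall>i\<in>set is. i < n"
  shows "degree_bounded (map Linear_op is) f"
    and "\<forall>j<n. quadratic_in j (apply_ops (map Linear_op is) f)"
    and "\<forall>j\<in>set is. linear_in j (apply_ops (map Linear_op is) f)"
  using assms(2) by (induction "is") (auto simp: assms(1) quadratic_Linear_op linear_Linear_op linear_Linear_op_same)

section \<open>The operators of a quantified Boolean formula\<close>

text \<open>Variables come in groups of \<open>w + 1\<close>, one group per squaring level: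
  \<open>w\<close> existential bits for the midpoint and then a universal bit for the half.\<close>

definition quantifier :: "nat \<Rightarrow> nat \<Rightarrow> quantifier_op" where
  "quantifier w i = (if i mod (w + 1) < w then Exist_op i else Forall_op i)"

text \<open>Linearising all \<open>n\<close> variables after each quantifier gives the list the
  regular period \<open>n + 1\<close>, from which the program finds the operator of a round by
  division (\<open>qbf_ops_nth\<close>).\<close>

definition qbf_ops :: "nat \<Rightarrow> nat \<Rightarrow> nat \<Rightarrow> quantifier_op list" where
  "qbf_ops w n i = concat (map (\<lambda>i. quantifier w i # map Linear_op [0..<n]) [i..<n])"

lemma apply_ops_append: "apply_ops (xs @ ys) f = apply_ops xs (apply_ops ys f)"
  by (induction xs) auto

lemma degree_bounded_append:
  "degree_bounded (xs @ ys) f = (degree_bounded xs (apply_ops ys f) \<and> degree_bounded ys f)"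
  by (induction xs) (auto simp: apply_ops_append)

lemma qbf_ops_step: "i < n \<Longrightarrow> qbf_ops w n i = quantifier w i # map Linear_op [0..<n] @ qbf_ops w n (Suc i)"
  by (simp add: qbf_ops_def upt_conv_Cons)

lemma qbf_ops_end: "qbf_ops w n n = []"
  by (simp add: qbf_ops_def)

lemma length_qbf_ops: "length (qbf_ops w n 0) = n * (n + 1)"
  by (simp add: qbf_ops_def length_concat o_def sum_list_triv)

lemma qbf_ops_nth:
  assumes "\<tau> < n * (n + 1)"
  shows "qbf_ops w n 0 ! \<tau> = (if \<tau> mod (n + 1) = 0 then quantifier w (\<tau> div (n + 1)) else Linear_op (\<tau> mod (n + 1) - 1))"
proof -
  have *: "length (concat (map (\<lambda>i. quantifier w i # map Linear_op [0..<n]) [0..<m])) = m * (n + 1)" for m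
    by (simp add: length_concat o_def sum_list_triv)
  have "\<tau> < m * (n + 1) \<Longrightarrow> concat (map (\<lambda>i. quantifier w i # map Linear_op [0..<n]) [0..<m]) ! \<tau>
    = (if \<tau> mod (n + 1) = 0 then quantifier w (\<tau> div (n + 1)) else Linear_op (\<tau> mod (n + 1) - 1))" for m
  proof (induction m)
    case (Suc m)
    show ?case
    proof (cases "\<tau> < m * (n + 1)")
      case True
      then show ?thesis using Suc.IH *[of m] by (simp add: nth_append)
    next
      case False
      define d where "d = \<tau> - m * (n + 1)"
      have d: "\<tau> = m * (n + 1) + d" "d < n + 1" using False Suc.prems by (auto simp: d_def)
      have "\<tau> mod (n + 1) = d" "\<tau> div (n + 1) = m"
        unfolding d(1) using d(2) by (simp_all only: mod_mult_self3 div_mult_self3 mod_less div_less)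
      moreover have "concat (map (\<lambda>i. quantifier w i # map Linear_op [0..<n]) [0..<Suc m]) ! \<tau>
         = (quantifier w m # map Linear_op [0..<n]) ! d"
        unfolding d(1) using *[of m] by (simp only: upt_Suc_append[OF le0] map_append concat_append nth_append_length_plus)
          (simp add: nth_append del: upt_Suc mult_Suc_right add_Suc_right)
      ultimately show ?thesis using d(2) by (cases d) (auto simp del: upt_Suc)
    qed
  qed simp
  then show ?thesis using assms by (simp add: qbf_ops_def)
qed

lemma qbf_ops_degree:
  assumes "\<forall>j<n. linear_in j f" "i \<le> n"
  shows "degree_bounded (qbf_ops w n i) f \<and> (\<forall>j<n. quadratic_in j (apply_ops (qbf_ops w n i) f))"
  using assms(2)
proof (induction rule: inc_induct)
  case base
  show ?case using assms by (simp add: qbf_ops_end linear_imp_quadratic)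
next
  case (step i)
  let ?h = "apply_ops (qbf_ops w n (Suc i)) f" and ?L = "map Linear_op [0..<n]"
  have q: "\<forall>j<n. quadratic_in j ?h" using step.IH by blast
  note L = Linear_ops_degree[OF q, of "[0..<n]"]
  have lin: "\<forall>j<n. linear_in j (apply_ops ?L ?h)" using L(3) by simp
  then have "\<forall>j<n. quadratic_in j (apply_op (quantifier w i) (apply_ops ?L ?h))"
    by (auto simp: quantifier_def quadratic_quantifier)
  moreover have "quadratic_in (op_var (quantifier w i)) (apply_ops ?L ?h)"
    using lin step.hyps by (auto simp: quantifier_def linear_imp_quadratic)
  ultimately show ?case using step.IH step.hyps L(1)
    by (simp add: qbf_ops_step apply_ops_append degree_bounded_append)
qed

text \<open>Interpolation between 0 and 1 returns the given value at 0 and at 1, so linearising does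
  not disturb the meaning of the formula.\<close>

lemma apply_Linear_ops_bool:
  assumes "\<forall>i. r i \<in> {0, 1}"
  shows "apply_ops (map Linear_op is) f r = f r"
proof -
  have "apply_op (Linear_op i) g r = g r" for i g
  proof -
    have "r i = 0 \<or> r i = 1" using assms by auto
    then show ?thesis
    proof
      assume "r i = 0"
      then show ?thesis by (simp add: apply_op_def fun_upd_idem)
    next
      assume "r i = 1"
      then show ?thesis by (simp add: apply_op_def fun_upd_idem)
    qed
  qed
  then show ?thesis by (induction "is") auto
qed

text \<open>The value of the formula with the first \<open>i\<close> variables set to the binary digits of \<open>a\<close> and
  \<open>m\<close> variables remaining.\<close>

primrec qbf_val :: "nat \<Rightarrow> (nat \<Rightarrow> bool) \<Rightarrow> nat \<Rightarrow> nat \<Rightarrow> nat \<Rightarrow> bool" where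
  "qbf_val w F 0 i a = F a"
| "qbf_val w F (Suc m) i a =
    (if i mod (w + 1) < w then qbf_val w F m (Suc i) a \<or> qbf_val w F m (Suc i) (a + 2 ^ i)
     else qbf_val w F m (Suc i) a \<and> qbf_val w F m (Suc i) (a + 2 ^ i))"

definition point_num :: "nat \<Rightarrow> (nat \<Rightarrow> int) \<Rightarrow> nat" where
  "point_num n r = horner_sum of_bool 2 (map (\<lambda>l. r l = 1) [0..<n])"

lemma point_num_0 [simp]: "point_num 0 r = 0"
  by (simp add: point_num_def)

lemma point_num_Suc: "point_num (Suc n) r = point_num n r + of_bool (r n = 1) * 2 ^ n"
  by (simp add: point_num_def horner_sum_append)

lemma point_num_upd: "n \<le> i \<Longrightarrow> point_num n (r(i := c)) = point_num n r"
  by (induction n) (auto simp: point_num_Suc)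

lemma bit_point_num: "bit (point_num n r) i \<longleftrightarrow> i < n \<and> r i = 1"
  by (auto simp: point_num_def bit_horner_sum_bit_iff)

lemma point_num_less: "point_num n r < 2 ^ n"
  by (induction n) (auto simp: point_num_Suc)

lemma apply_qbf_ops:
  assumes f: "\<And>r. \<forall>i. r i \<in> {0, 1} \<Longrightarrow> f r = of_bool (F (point_num n r))"
    and "i \<le> n" "\<forall>i. r i \<in> {0, 1}"
  shows "apply_ops (qbf_ops w n i) f r = of_bool (qbf_val w F (n - i) i (point_num i r))"
  using assms(2,3)
proof (induction arbitrary: r rule: inc_induct)
  case base
  then show ?case by (simp add: qbf_ops_end f)
next
  case (step i)
  let ?h = "apply_ops (qbf_ops w n (Suc i)) f"
  have *: "apply_ops (map Linear_op [0..<n]) ?h (r(i := c))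
      = of_bool (qbf_val w F (n - Suc i) (Suc i) (point_num i r + of_bool (c = 1) * 2 ^ i))"
    if "c = 0 \<or> c = 1" for c
  proof -
    have b: "\<forall>l. (r(i := c)) l \<in> {0, 1}" using step.prems that by auto
    show ?thesis
      unfolding apply_Linear_ops_bool[OF b] step.IH[OF b] by (simp add: point_num_Suc point_num_upd)
  qed
  have n: "n - i = Suc (n - Suc i)" using step.hyps by simp
  show ?case using *[of 0] *[of 1] step.hyps
    by (simp add: qbf_ops_step apply_ops_append apply_op_def quantifier_def n)
qed

section \<open>Multilinear extension\<close>

text \<open>A sum over all assignments rather than an arithmetised circuit: it has degree at most 1
  in each variable whatever \<open>F\<close> is, and it is additive in \<open>F\<close>, on which
  the split between the two tensors relies.\<close>

definition multilinear :: "nat \<Rightarrow> (nat \<Rightarrow> int) \<Rightarrow> (nat \<Rightarrow> int) \<Rightarrow> int" where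
  "multilinear n F r = (\<Sum>A<2 ^ n. F A * (\<Prod>i<n. if bit A i then r i else 1 - r i))"

lemma multilinear_bool:
  assumes "\<forall>i. r i \<in> {0, 1}"
  shows "multilinear n F r = F (point_num n r)"
proof -
  have "(\<Prod>i<n. if bit A i then r i else 1 - r i) = of_bool (A = point_num n r)" if "A < 2 ^ n" for A
  proof (cases "A = point_num n r")
    case True
    have "(if bit A i then r i else 1 - r i) = 1" if "i < n" for i
      using assms that unfolding True bit_point_num by (metis diff_zero empty_iff insertE)
    then show ?thesis using True by simp
  next
    case False
    then obtain i where i: "bit A i \<noteq> bit (point_num n r) i" by (auto simp: bit_eq_iff)
    have "i < n"
    proof (rule ccontr)
      assume "\<not> i < n"
      then have "\<not> bit A i" using that by (metis bit_take_bit_iff take_bit_nat_eq_self_iff)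
      then show False using i \<open>\<not> i < n\<close> by (simp add: bit_point_num)
    qed
    then have "(if bit A i then r i else 1 - r i) = 0"
      using i assms by (auto simp: bit_point_num)
    then have "(\<Prod>i<n. if bit A i then r i else 1 - r i) = 0" using \<open>i < n\<close>
      by (intro prod_zero finite_lessThan bexI[of _ i]) simp_all
    then show ?thesis using False by simp
  qed
  then have "multilinear n F r = (\<Sum>A<2 ^ n. F A * of_bool (A = point_num n r))"
    unfolding multilinear_def by (intro sum.cong) auto
  also have "\<dots> = (\<Sum>A<2 ^ n. if A = point_num n r then F A else 0)"
    by (intro sum.cong) auto
  finally show ?thesis using point_num_less[of n r] by simp
qed

lemma linear_multilinear: "linear_in j (multilinear n F)"
proof (cases "j < n")
  case False
  show ?thesis
  proof (rule linear_const)
    fix r :: "nat \<Rightarrow> int" and z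
    show "multilinear n F (r(j := z)) = multilinear n F r"
      unfolding multilinear_def using False
      by (intro sum.cong refl arg_cong2[of _ _ _ _ "(*)"] prod.cong) auto
  qed
next
  case True
  show ?thesis unfolding linear_in_def
  proof
    fix r :: "nat \<Rightarrow> int"
    define g where "g A = F A * (\<Prod>i\<in>{..<n} - {j}. if bit A i then r i else 1 - r i)" for A
    define a where "a A = (if bit A j then 0 else g A)" for A
    define b where "b A = (if bit A j then g A else - g A)" for A
    have "F A * (\<Prod>i<n. if bit A i then (r(j := z)) i else 1 - (r(j := z)) i) = a A + b A * z" for A z
    proof -
      have "(\<Prod>i<n. if bit A i then (r(j := z)) i else 1 - (r(j := z)) i)
        = (if bit A j then z else 1 - z)
          * (\<Prod>i\<in>{..<n} - {j}. if bit A i then (r(j := z)) i else 1 - (r(j := z)) i)"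
        using True by (subst prod.remove[of _ j]) auto
      also have "(\<Prod>i\<in>{..<n} - {j}. if bit A i then (r(j := z)) i else 1 - (r(j := z)) i)
         = (\<Prod>i\<in>{..<n} - {j}. if bit A i then r i else 1 - r i)"
        by (intro prod.cong) auto
      finally show ?thesis by (simp add: a_def b_def g_def algebra_simps)
    qed
    then have "multilinear n F (r(j := z)) = (\<Sum>A<2 ^ n. a A) + (\<Sum>A<2 ^ n. b A) * z" for z
      by (simp add: multilinear_def sum.distrib sum_distrib_right)
    then show "\<exists>a b. \<forall>z. multilinear n F (r(j := z)) = a + b * z" by blast
  qed
qed

lemma multilinear_add: "multilinear n (\<lambda>A. F A + G A) r = multilinear n F r + multilinear n G r"
  by (simp add: multilinear_def sum.distrib distrib_right)

section \<open>Reachability by repeated squaring\<close>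

text \<open>Savitch's recursion on dyadic intervals. The relation \<open>e\<close> depends on time,
  so the interval is tracked as well: \<open>s\<close> at level \<open>l\<close> stands for the
  steps from \<open>s * 2 ^ l\<close> up to \<open>(s + 1) * 2 ^ l\<close>.\<close>

primrec reach :: "(nat \<Rightarrow> nat \<Rightarrow> nat \<Rightarrow> bool) \<Rightarrow> nat \<Rightarrow> nat \<Rightarrow> nat \<Rightarrow> nat \<Rightarrow> nat \<Rightarrow> bool" where
  "reach e w 0 s j k = e s j k"
| "reach e w (Suc l) s j k = (\<exists>m<2 ^ w. reach e w l (2 * s) j m \<and> reach e w l (2 * s + 1) m k)"

text \<open>Walks are total functions with all values below \<open>2 ^ w\<close>, so that gluing and
  restricting them needs no domains.\<close>

lemma reach_iff_path:
  assumes "j < 2 ^ w" "k < 2 ^ w"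
  shows "reach e w l s j k \<longleftrightarrow> (\<exists>f. f (s * 2 ^ l) = j \<and> f ((s + 1) * 2 ^ l) = k \<and> (\<forall>i. f i < 2 ^ w)
     \<and> (\<forall>i. s * 2 ^ l \<le> i \<and> i < (s + 1) * 2 ^ l \<longrightarrow> e i (f i) (f (Suc i))))"
  using assms
proof (induction l arbitrary: s j k)
  case 0
  show ?case
  proof
    assume "reach e w 0 s j k"
    then show "\<exists>f. f (s * 2 ^ 0) = j \<and> f ((s + 1) * 2 ^ 0) = k \<and> (\<forall>i. f i < 2 ^ w)
     \<and> (\<forall>i. s * 2 ^ 0 \<le> i \<and> i < (s + 1) * 2 ^ 0 \<longrightarrow> e i (f i) (f (Suc i)))"
      using 0 by (intro exI[of _ "\<lambda>i. if i = s then j else k"]) (auto simp: less_Suc_eq)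
  qed auto
next
  case (Suc l)
  let ?a = "2 * s * 2 ^ l" and ?b = "(2 * s + 1) * 2 ^ l" and ?c = "(2 * s + 2) * 2 ^ l"
  have e1: "s * 2 ^ Suc l = ?a" "(s + 1) * 2 ^ Suc l = ?c" "(2 * s + 1 + 1) * 2 ^ l = ?c" by simp_all
  have le: "?a \<le> ?b" "?b \<le> ?c" by simp_all
  show ?case
  proof
    assume "reach e w (Suc l) s j k"
    then obtain m where m: "m < 2 ^ w" "reach e w l (2 * s) j m" "reach e w l (2 * s + 1) m k" by auto
    obtain f where f: "f ?a = j" "f ?b = m" "\<And>i. f i < 2 ^ w"
      "\<And>i. ?a \<le> i \<Longrightarrow> i < ?b \<Longrightarrow> e i (f i) (f (Suc i))"
      using Suc.IH[of j m "2 * s"] m Suc.prems by blast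
    obtain g where g: "g ?b = m" "g ?c = k" "\<And>i. g i < 2 ^ w"
      "\<And>i. ?b \<le> i \<Longrightarrow> i < ?c \<Longrightarrow> e i (g i) (g (Suc i))"
      using Suc.IH[of m k "2 * s + 1", unfolded e1] m Suc.prems by blast
    define h where "h i = (if i \<le> ?b then f i else g i)" for i
    have "e i (h i) (h (Suc i))" if "?a \<le> i" "i < ?c" for i
    proof (cases "i < ?b")
      case True
      then show ?thesis using f(4)[of i] that by (simp add: h_def)
    next
      case False
      have "h i = g i" using False f(2) g(1) by (cases "i = ?b") (auto simp: h_def)
      then show ?thesis using g(4)[of i] that False by (simp add: h_def)
    qed
    moreover have "h ?a = j" using f(1) le by (simp add: h_def)
    moreover have "h ?c = k" using g(2) by (simp add: h_def)
    moreover have "h i < 2 ^ w" for i using f(3) g(3) by (simp add: h_def)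
    ultimately show "\<exists>f. f (s * 2 ^ Suc l) = j \<and> f ((s + 1) * 2 ^ Suc l) = k \<and> (\<forall>i. f i < 2 ^ w)
     \<and> (\<forall>i. s * 2 ^ Suc l \<le> i \<and> i < (s + 1) * 2 ^ Suc l \<longrightarrow> e i (f i) (f (Suc i)))"
      unfolding e1 by blast
  next
    assume "\<exists>f. f (s * 2 ^ Suc l) = j \<and> f ((s + 1) * 2 ^ Suc l) = k \<and> (\<forall>i. f i < 2 ^ w)
     \<and> (\<forall>i. s * 2 ^ Suc l \<le> i \<and> i < (s + 1) * 2 ^ Suc l \<longrightarrow> e i (f i) (f (Suc i)))"
    then obtain f where f: "f ?a = j" "f ?c = k" "\<And>i. f i < 2 ^ w"
       "\<And>i. ?a \<le> i \<Longrightarrow> i < ?c \<Longrightarrow> e i (f i) (f (Suc i))" unfolding e1 by blast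
    have "reach e w l (2 * s) j (f ?b)"
      unfolding Suc.IH[OF Suc.prems(1) f(3)] using f le by (intro exI[of _ f]) auto
    moreover have "reach e w l (2 * s + 1) (f ?b) k"
      unfolding Suc.IH[OF f(3) Suc.prems(2)] e1 using f le by (intro exI[of _ f]) auto
    ultimately show "reach e w (Suc l) s j k" using f(3) by auto
  qed
qed

text \<open>The digits of \<open>A\<close> in base \<open>2 ^ (w + 1)\<close> are the choices made at the levels of the recursion: a
  midpoint in the low \<open>w\<close> bits and the half to descend to in the top bit.\<close>

primrec decode :: "nat \<Rightarrow> nat \<Rightarrow> nat \<Rightarrow> nat \<times> nat \<times> nat" where
  "decode w A 0 = (0, 0, 0)"
| "decode w A (Suc c) = (case decode w A c of (s, j, k) \<Rightarrow>
     let d = A div 2 ^ (c * (w + 1)) in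
     if odd (d div 2 ^ w) then (2 * s + 1, d mod 2 ^ w, k) else (2 * s, j, d mod 2 ^ w))"

text \<open>The first \<open>c\<close> levels read only the bits below position
  \<open>c * (w + 1)\<close>, so later choices do not disturb what the earlier ones decode
  to.\<close>

lemma decode_low: "c' \<le> c \<Longrightarrow> decode w (a + X * 2 ^ (c * (w + 1))) c' = decode w a c'"
proof (induction c')
  case (Suc c')
  obtain x where c: "c = Suc c' + x" using Suc.prems le_Suc_ex by blast
  have "c * (w + 1) = c' * (w + 1) + (w + 1 + x * (w + 1))" unfolding c by (simp add: algebra_simps)
  then have "X * 2 ^ (c * (w + 1)) = 2 ^ (c' * (w + 1)) * (2 ^ w * (2 * (X * 2 ^ (x * (w + 1)))))"
    by (simp only: power_add power_one_right mult_ac)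
  then obtain Y where "X * 2 ^ (c * (w + 1)) = 2 ^ (c' * (w + 1)) * (2 ^ w * (2 * Y))" by blast
  then have d: "(a + X * 2 ^ (c * (w + 1))) div 2 ^ (c' * (w + 1)) = a div 2 ^ (c' * (w + 1)) + 2 ^ w * (2 * Y)"
    by (simp only: div_mult_self2 power_not_zero) simp
  have "decode w (a + X * 2 ^ (c * (w + 1))) c' = decode w a c'" using Suc by simp
  then show ?case unfolding decode.simps d Let_def by (simp add: split: prod.split)
qed simp

lemma exists_less_double: "(\<exists>y<2 * m. P y) \<longleftrightarrow> (\<exists>y<m. P (2 * y) \<or> P (1 + 2 * y))" for m :: nat
proof
  assume "\<exists>y<2 * m. P y"
  then obtain y where y: "y < 2 * m" "P y" by blast
  then have "y = 2 * (y div 2) \<or> y = 1 + 2 * (y div 2)" "y div 2 < m" by presburger+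
  then show "\<exists>y<m. P (2 * y) \<or> P (1 + 2 * y)" using y(2) by metis
next
  assume "\<exists>y<m. P (2 * y) \<or> P (1 + 2 * y)"
  then obtain y where y: "y < m" "P (2 * y) \<or> P (1 + 2 * y)" by blast
  from y(1) have "2 * y < 2 * m" "1 + 2 * y < 2 * m" by linarith+
  then show "\<exists>y<2 * m. P y" using y(2) by blast
qed

text \<open>The \<open>d\<close> existential bits left in group \<open>c\<close> act as one number
  \<open>y\<close>. The first of them is its lowest bit, so the induction splits \<open>y\<close> by
  parity.\<close>

lemma qbf_val_exists:
  "d \<le> w \<Longrightarrow> qbf_val w F (d + m) (c * (w + 1) + (w - d)) a
    \<longleftrightarrow> (\<exists>y<2 ^ d. qbf_val w F m (c * (w + 1) + w) (a + y * 2 ^ (c * (w + 1) + (w - d))))"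
proof (induction d arbitrary: a)
  case (Suc d)
  let ?i = "c * (w + 1) + (w - Suc d)"
  have i: "c * (w + 1) + (w - d) = Suc ?i" using Suc.prems by simp
  have "(w - Suc d + c * (w + 1)) mod (w + 1) = w - Suc d"
    unfolding mod_mult_self1 using Suc.prems by simp
  then have "?i mod (w + 1) < w" using Suc.prems by (simp add: add.commute)
  then have "qbf_val w F (Suc d + m) ?i a
     \<longleftrightarrow> qbf_val w F (d + m) (Suc ?i) a \<or> qbf_val w F (d + m) (Suc ?i) (a + 2 ^ ?i)" by simp
  also have "\<dots> \<longleftrightarrow> (\<exists>y<2 ^ d. qbf_val w F m (c * (w + 1) + w) (a + y * 2 ^ Suc ?i))
     \<or> (\<exists>y<2 ^ d. qbf_val w F m (c * (w + 1) + w) (a + 2 ^ ?i + y * 2 ^ Suc ?i))"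
    using Suc.IH Suc.prems unfolding i by simp
  also have "\<dots> \<longleftrightarrow> (\<exists>y<2 ^ d. qbf_val w F m (c * (w + 1) + w) (a + (2 * y) * 2 ^ ?i)
     \<or> qbf_val w F m (c * (w + 1) + w) (a + (1 + 2 * y) * 2 ^ ?i))"
  proof -
    have "a + y * 2 ^ Suc ?i = a + (2 * y) * 2 ^ ?i" "a + 2 ^ ?i + y * 2 ^ Suc ?i = a + (1 + 2 * y) * 2 ^ ?i" for y
      by (simp_all add: algebra_simps)
    then show ?thesis by (metis (no_types))
  qed
  also have "\<dots> \<longleftrightarrow> (\<exists>y<2 * 2 ^ d. qbf_val w F m (c * (w + 1) + w) (a + y * 2 ^ ?i))"
    by (subst exists_less_double) (rule refl)
  finally show ?case by simp
qed simp

text \<open>After \<open>c\<close> levels the decoded state is an interval with the nodes at its two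
  ends. The next group guesses the midpoint, and its universal bit demands both halves from one and
  the same remaining formula, which keeps the formula from doubling.\<close>

lemma qbf_val_reach:
  assumes "c \<le> L" "a < 2 ^ (c * (w + 1))"
  shows "qbf_val w (\<lambda>A. case decode w A L of (s, j, k) \<Rightarrow> e s j k) ((L - c) * (w + 1)) (c * (w + 1)) a
    \<longleftrightarrow> (case decode w a c of (s, j, k) \<Rightarrow> reach e w (L - c) s j k)"
  using assms
proof (induction arbitrary: a rule: inc_induct)
  case base
  then show ?case by simp
next
  case (step c)
  let ?F = "\<lambda>A. case decode w A L of (s, j, k) \<Rightarrow> e s j k" and ?B = "w + 1"
  obtain s j k where dec: "decode w a c = (s, j, k)" by (cases "decode w a c")
  have m: "(L - c) * ?B = w + Suc ((L - Suc c) * ?B)"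
  proof -
    have "L - c = Suc (L - Suc c)" using step.hyps by simp
    then show ?thesis by simp
  qed
  \<comment> \<open>\<open>y + b * 2 ^ w\<close> is the digit of this level; the universal bit
    \<open>b\<close> decides which end of the interval the midpoint \<open>y\<close>
    replaces.\<close>
  have R: "qbf_val w ?F ((L - Suc c) * ?B) (Suc c * ?B) (a + y * 2 ^ (c * ?B) + b * 2 ^ (c * ?B + w))
     \<longleftrightarrow> (if b = 0 then reach e w (L - Suc c) (2 * s) j y else reach e w (L - Suc c) (2 * s + 1) y k)"
    if y: "y < 2 ^ w" and b: "b = 0 \<or> b = 1" for y b
  proof -
    let ?A = "a + y * 2 ^ (c * ?B) + b * 2 ^ (c * ?B + w)"
    have A: "?A = a + (y + b * 2 ^ w) * 2 ^ (c * ?B)" by (simp add: algebra_simps power_add)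
    have yb: "y + b * 2 ^ w < 2 ^ ?B" using y b by auto
    have "?A < 2 ^ (c * ?B) * 2 ^ ?B"
    proof -
      have "?A < 2 ^ (c * ?B) + (y + b * 2 ^ w) * 2 ^ (c * ?B)" unfolding A using step.prems by simp
      also have "\<dots> = Suc (y + b * 2 ^ w) * 2 ^ (c * ?B)" by simp
      also have "\<dots> \<le> 2 ^ ?B * 2 ^ (c * ?B)" using yb by (intro mult_right_mono) auto
      finally show ?thesis by (simp only: mult.commute)
    qed
    moreover have "2 ^ (Suc c * ?B) = 2 ^ (c * ?B) * (2 :: nat) ^ ?B"
      by (simp only: mult_Suc power_add mult.commute)
    ultimately have lt: "?A < 2 ^ (Suc c * ?B)" by (simp only:)
    have d: "?A div 2 ^ (c * ?B) = y + b * 2 ^ w" unfolding A using step.prems by simp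
    have "decode w ?A c = (s, j, k)" unfolding A using decode_low[of c c w a] dec by simp
    moreover have "(y + b * 2 ^ w) div 2 ^ w = b" "(y + b * 2 ^ w) mod 2 ^ w = y" using y by simp_all
    ultimately have "decode w ?A (Suc c) = (if b = 0 then (2 * s, j, y) else (2 * s + 1, y, k))"
      unfolding decode.simps d Let_def using b by auto
    then show ?thesis using step.IH[OF lt] by simp
  qed
  have md: "(c * ?B + w) mod ?B = w" by (simp only: mod_mult_self3) simp
  have "qbf_val w ?F ((L - c) * ?B) (c * ?B) a
     \<longleftrightarrow> (\<exists>y<2 ^ w. qbf_val w ?F (Suc ((L - Suc c) * ?B)) (c * ?B + w) (a + y * 2 ^ (c * ?B)))"
    using qbf_val_exists[OF order_refl, of w ?F "Suc ((L - Suc c) * ?B)" c a]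
    unfolding m diff_self_eq_0 add_0_right .
  also have "\<dots> \<longleftrightarrow> (\<exists>y<2 ^ w. reach e w (L - Suc c) (2 * s) j y \<and> reach e w (L - Suc c) (2 * s + 1) y k)"
  proof (intro ex_cong1 conj_cong refl)
    fix y :: nat assume y: "y < 2 ^ w"
    have "Suc (c * ?B + w) = Suc c * ?B" by simp
    then show "qbf_val w ?F (Suc ((L - Suc c) * ?B)) (c * ?B + w) (a + y * 2 ^ (c * ?B))
      \<longleftrightarrow> reach e w (L - Suc c) (2 * s) j y \<and> reach e w (L - Suc c) (2 * s + 1) y k"
      unfolding qbf_val.simps md using R[OF y, of 0] R[OF y, of 1] by (simp only:) simp
  qed
  also have "\<dots> \<longleftrightarrow> reach e w (Suc (L - Suc c)) s j k" by simp
  also have "Suc (L - Suc c) = L - c" using step.hyps by simp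
  finally show ?case using dec by simp
qed

section \<open>Primes in a polynomial range\<close>

lemma multiplicity_eq_sum:
  fixes p n :: nat
  assumes "prime p" "0 < n" "multiplicity p n \<le> N"
  shows "multiplicity p n = (\<Sum>i=1..N. of_bool (p ^ i dvd n))"
proof -
  have "p ^ i dvd n \<longleftrightarrow> i \<le> multiplicity p n" for i
    using assms by (subst power_dvd_iff_le_multiplicity) (auto simp: prime_nat_iff)
  then have "(\<Sum>i=1..N. of_bool (p ^ i dvd n)) = card ({1..N} \<inter> {i. i \<le> multiplicity p n})"
    by (simp add: of_bool_def sum.If_cases)
  also have "{1..N} \<inter> {i. i \<le> multiplicity p n} = {1..multiplicity p n}" using assms(3) by auto
  finally show ?thesis by simp
qed

lemma multiplicity_le_self: "prime p \<Longrightarrow> 0 < n \<Longrightarrow> multiplicity p n \<le> n" for p n :: nat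
proof -
  assume p: "prime p" "0 < n"
  have "multiplicity p n < p ^ multiplicity p n"
    using prime_gt_1_nat[OF p(1)] by (intro power_gt_expt) auto
  also have "\<dots> \<le> n" using p multiplicity_dvd dvd_imp_le by blast
  finally show ?thesis by simp
qed

text \<open>Legendre's formula. The sum may run up to any \<open>N\<close> from \<open>n\<close> on,
  so that \<open>fact n\<close> and \<open>fact (2 * n)\<close> can share one range.\<close>

lemma multiplicity_fact:
  fixes p :: nat
  assumes "prime p" "n \<le> N"
  shows "multiplicity p (fact n) = (\<Sum>i=1..N. n div p ^ i)"
  using assms(2)
proof (induction n)
  case (Suc n)
  have div: "Suc n div p ^ i = n div p ^ i + of_bool (p ^ i dvd Suc n)" if "i \<in> {1..N}" for i
    by (simp add: div_Suc dvd_eq_mod_eq_0)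
  have "multiplicity p (fact (Suc n)) = multiplicity p (Suc n) + multiplicity p (fact n)"
    using assms(1) unfolding fact_Suc of_nat_id
    by (intro prime_elem_multiplicity_mult_distrib) auto
  also have "multiplicity p (Suc n) = (\<Sum>i=1..N. of_bool (p ^ i dvd Suc n))"
    using multiplicity_le_self[OF assms(1), of "Suc n"] Suc.prems
    by (intro multiplicity_eq_sum assms) auto
  finally show ?case using Suc div by (simp add: sum.distrib)
qed simp

text \<open>In Legendre's formula every exponent \<open>i\<close> with \<open>p ^ i \<le> 2n\<close> contributes at most 1.\<close>

lemma power_multiplicity_central_binomial:
  fixes p n :: nat
  assumes p: "prime p" and n: "0 < n"
  shows "p ^ multiplicity p ((2 * n) choose n) \<le> 2 * n"
proof -
  let ?C = "(2 * n) choose n" and ?N = "2 * n"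
  let ?S = "{i. 1 \<le> i \<and> p ^ i \<le> 2 * n}"
  have i_less: "i < p ^ i" for i using prime_gt_1_nat[OF p] by (intro power_gt_expt) auto
  then have S: "?S \<subseteq> {1..?N}" 
  proof (intro subsetI)
    fix i assume "i \<in> ?S"
    then show "i \<in> {1..?N}" using i_less[of i] by auto
  qed
  have "fact n * fact (2 * n - n) * ?C = fact (2 * n)" by (rule binomial_fact_lemma) simp
  then have "multiplicity p (fact (2 * n)) = multiplicity p (fact n * fact n * ?C)" by (simp add: mult_2)
  also have "\<dots> = multiplicity p (fact n) + multiplicity p (fact n) + multiplicity p ?C"
    using p by (simp add: prime_elem_multiplicity_mult_distrib)
  finally have "(\<Sum>i=1..?N. 2 * n div p ^ i) = (\<Sum>i=1..?N. n div p ^ i) + (\<Sum>i=1..?N. n div p ^ i) + multiplicity p ?C"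
    using multiplicity_fact[OF p, of "2 * n" ?N] multiplicity_fact[OF p, of n ?N] by simp
  moreover have "(\<Sum>i=1..?N. 2 * n div p ^ i) \<le> (\<Sum>i=1..?N. 2 * (n div p ^ i) + of_bool (i \<in> ?S))"
  proof (rule sum_mono)
    fix i assume i: "i \<in> {1..?N}"
    show "2 * n div p ^ i \<le> 2 * (n div p ^ i) + of_bool (i \<in> ?S)"
    proof (cases "p ^ i \<le> 2 * n")
      case True
      let ?q = "p ^ i"
      have "?q > 0" using p prime_gt_0_nat by simp
      then have "n < (n div ?q + 1) * ?q" by (metis dividend_less_div_times mult.commute mult_Suc_right Suc_eq_plus1)
      then have "2 * n < (2 * (n div ?q) + 2) * ?q" by (simp add: algebra_simps)
      then have "2 * n div ?q < 2 * (n div ?q) + 2" using \<open>?q > 0\<close> by (simp add: div_less_iff_less_mult)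
      then show ?thesis using True i by simp
    qed simp
  qed
  ultimately have "multiplicity p ?C \<le> (\<Sum>i=1..?N. of_bool (i \<in> ?S))"
    by (simp add: sum.distrib sum_distrib_left[symmetric])
  also have "\<dots> = card ({1..?N} \<inter> ?S)" by (simp add: of_bool_def sum.If_cases Int_def cong: conj_cong)
  also have "{1..?N} \<inter> ?S = ?S" using S by blast
  finally have m: "multiplicity p ?C \<le> card ?S" .
  show ?thesis
  proof (cases "multiplicity p ?C = 0")
    case False
    have fin: "finite ?S" using S finite_subset by blast
    have "?S \<noteq> {}" using False m by (metis card.empty le_zero_eq)
    have Max: "Max ?S \<in> ?S" by (rule Max_in) fact+
    have "?S \<subseteq> {1..Max ?S}" using fin by auto
    then have "card ?S \<le> card {1..Max ?S}" by (intro card_mono) auto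
    then have "multiplicity p ?C \<le> Max ?S" using m by simp
    then have "p ^ multiplicity p ?C \<le> p ^ Max ?S" using prime_gt_0_nat[OF p] by (intro power_increasing) auto
    then show ?thesis using Max by auto
  qed (use n in simp)
qed

lemma two_squares_le_power: "7 \<le> x \<Longrightarrow> 2 * x\<^sup>2 \<le> 2 ^ x" for x :: nat
proof (induction rule: dec_induct)
  case (step x)
  have "2 * (Suc x)\<^sup>2 = 2 * x\<^sup>2 + (4 * x + 2)" by (simp add: power2_eq_square algebra_simps)
  also have "4 * x + 2 \<le> 2 * x\<^sup>2"
  proof -
    have "7 * x \<le> x * x" using step.hyps(1) by (rule mult_right_mono) simp
    then show ?thesis using step.hyps(1) unfolding power2_eq_square by linarith
  qed
  finally show ?case using step.IH by simp
qed simp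

text \<open>Erdos' argument with \<open>n = x ^ 2\<close>. Every prime power in
  \<open>(2 * n) choose n\<close> is at most \<open>2 * n\<close>. Without primes from
  \<open>x\<close> to \<open>2 * n\<close> at most \<open>x\<close> primes occur, so the coefficient
  is at most \<open>(2 * n) ^ x\<close>. It is also at least \<open>4 ^ n / (2 * n)\<close>, and
  with \<open>2 * n \<le> 2 ^ x\<close> this gives
  \<open>4 ^ n \<le> 2 ^ (x * (x + 1)) < 4 ^ n\<close>.\<close>

lemma prime_in_range:
  fixes x :: nat
  assumes "7 \<le> x"
  shows "\<exists>p. prime p \<and> x \<le> p \<and> p \<le> 2 * x\<^sup>2"
proof (rule ccontr)
  assume *: "\<nexists>p. prime p \<and> x \<le> p \<and> p \<le> 2 * x\<^sup>2"
  define n where "n = x\<^sup>2"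
  have n: "0 < n" using assms by (simp add: n_def)
  let ?C = "(2 * n) choose n"
  have C: "0 < ?C" by simp
  have sub: "prime_factors ?C \<subseteq> {..<x}"
  proof
    fix p assume p: "p \<in> prime_factors ?C"
    then have pp: "prime p" by auto
    have "0 < multiplicity p ?C" using p by (simp add: prime_factors_multiplicity)
    then have "p ^ 1 \<le> p ^ multiplicity p ?C" using prime_gt_0_nat[OF pp] by (intro power_increasing) auto
    also have "\<dots> \<le> 2 * n" by (rule power_multiplicity_central_binomial[OF pp n])
    finally have "p \<le> 2 * x\<^sup>2" unfolding n_def power_one_right .
    then have "\<not> x \<le> p" using * pp by blast
    then show "p \<in> {..<x}" by simp
  qed
  have "?C = (\<Prod>p\<in>prime_factors ?C. p ^ multiplicity p ?C)"
    using prod_prime_factors[of ?C] C by simp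
  also have "\<dots> \<le> (\<Prod>p\<in>prime_factors ?C. 2 * n)"
    by (intro prod_mono) (auto intro!: power_multiplicity_central_binomial n)
  also have "\<dots> = (2 * n) ^ card (prime_factors ?C)" by simp
  also have "\<dots> \<le> (2 * n) ^ x"
    using card_mono[OF _ sub] n by (intro power_increasing) auto
  finally have "?C \<le> (2 * n) ^ x" .
  then have "real ?C \<le> real ((2 * n) ^ x)" by (rule of_nat_mono)
  with central_binomial_lower_bound[OF n] have "4 ^ n / (2 * real n) \<le> real ((2 * n) ^ x)" by (rule order_trans)
  then have "4 ^ n \<le> real ((2 * n) ^ x) * (2 * real n)" using n by (simp only: divide_le_eq)
  also have "\<dots> = real ((2 * n) ^ Suc x)" by (simp only: power_Suc2 of_nat_mult of_nat_numeral)
  finally have "real (4 ^ n) \<le> real ((2 * n) ^ Suc x)" by (simp only: of_nat_power of_nat_numeral)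
  then have "4 ^ n \<le> (2 * n) ^ Suc x" by (simp only: of_nat_le_iff)
  also have "\<dots> \<le> (2 ^ x) ^ Suc x" using two_squares_le_power[OF assms] unfolding n_def by (rule power_mono) simp
  also have "\<dots> = 2 ^ (x * Suc x)" by (rule power_mult[symmetric])
  also have "x * Suc x < 2 * n" using assms by (simp add: n_def power2_eq_square)
  then have "(2 :: nat) ^ (x * Suc x) < 2 ^ (2 * n)" by (intro power_strict_increasing) auto
  also have "(2 :: nat) ^ (2 * n) = 4 ^ n" by (simp add: power_mult)
  finally show False by simp
qed

section \<open>Parameters of the reduction\<close>

definition clog :: "nat \<Rightarrow> nat" where
  "clog x = (LEAST l. x \<le> 2 ^ l)"

lemma le_pow_clog: "x \<le> 2 ^ clog x"
  unfolding clog_def by (rule LeastI[of _ x]) (simp add: less_imp_le)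

lemma pow_less_of_less_clog: "l < clog x \<Longrightarrow> 2 ^ l < x"
  unfolding clog_def using not_less_Least by fastforce

lemma pow_clog_le: "1 \<le> x \<Longrightarrow> 2 ^ clog x \<le> 2 * x"
  using pow_less_of_less_clog[of "clog x - 1" x] by (cases "clog x") auto

lemma clog_le: "1 \<le> x \<Longrightarrow> real (clog x) \<le> 1 + log 2 (real x)"
proof -
  assume x: "1 \<le> x"
  have "real (2 ^ clog x) \<le> real (2 * x)" using pow_clog_le[OF x] of_nat_le_iff by blast
  then have "log 2 (2 ^ clog x) \<le> log 2 (2 * real x)" using x by (subst log_le_cancel_iff) auto
  then show ?thesis using x by (simp add: log_mult)
qed

text \<open>\<open>Suc T\<close> makes the number of levels positive even for \<open>T = 1\<close>,
  so that there is always a variable; \<open>tensor_dim_bounds\<close> depends on this.\<close>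

definition num_vars :: "nat \<Rightarrow> nat \<Rightarrow> nat" where
  "num_vars W T = clog (Suc T) * (clog W + 1)"

text \<open>A prime of at least this size makes the total error \<open>4 * n * (n + 1) / p\<close>
  smaller than \<open>1 / E\<close>. The summand 8 gives strictness and brings the bound into the
  range of \<open>prime_in_range\<close>.\<close>

definition field_bound :: "nat \<Rightarrow> nat \<Rightarrow> nat" where
  "field_bound n E = 4 * (n * (n + 1)) * E + 8"

text \<open>The least such prime, so that an upward search by the program ends at the same
  number.\<close>

definition field_size :: "nat \<Rightarrow> nat" where
  "field_size x = (LEAST p. prime p \<and> x \<le> p)"

text \<open>Four blocks for each of the \<open>n * (n + 1)\<close> rounds, three coefficients and a
  point, and one more for the final split. A block of \<open>K\<close> bits takes
  \<open>2 * K\<close> factors.\<close>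

definition tensor_dim :: "nat \<Rightarrow> nat \<Rightarrow> nat \<Rightarrow> nat" where
  "tensor_dim W T E = (let n = num_vars W T in
     2 * clog (field_size (field_bound n E)) * (4 * (n * (n + 1)) + 1))"

lemma field_size:
  assumes "7 \<le> x"
  shows "prime (field_size x)" "x \<le> field_size x" "field_size x \<le> 2 * x\<^sup>2"
proof -
  obtain p where p: "prime p" "x \<le> p" "p \<le> 2 * x\<^sup>2" using prime_in_range[OF assms] by blast
  have "prime (field_size x) \<and> x \<le> field_size x"
    unfolding field_size_def by (rule LeastI[of _ p]) (use p in simp)
  then show "prime (field_size x)" "x \<le> field_size x" by auto
  have "field_size x \<le> p" unfolding field_size_def by (rule Least_le) (use p in simp)
  then show "field_size x \<le> 2 * x\<^sup>2" using p by simp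
qed

lemma not_prime_below_field_size: "x \<le> m \<Longrightarrow> m < field_size x \<Longrightarrow> \<not> prime m"
  unfolding field_size_def using not_less_Least by blast

lemma even_tensor_dim: "even (tensor_dim W T E)"
  by (simp add: tensor_dim_def Let_def)

lemma one_le_lg: "1 \<le> lg x"
  by (simp add: lg_def)

lemma log_le_lg: "log 2 x \<le> lg x"
  by (simp add: lg_def)

text \<open>With \<open>a\<close>, \<open>b\<close> for the logarithms of \<open>W\<close>,
  \<open>T\<close> and \<open>S\<close> for the sum in \<open>dim_bound\<close>: both factors of
  \<open>n\<close> are at most 3 times a logarithm, so \<open>n \<le> 9 * (a * b)\<close> and
  \<open>n * (n + 1) \<le> 90 * (a * b) ^ 2\<close>. Then \<open>log 2 x \<le> 12 * S\<close>, and
  \<open>K \<le> 26 * S\<close> as the prime is at most \<open>2 * x ^ 2\<close>. Finally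
  \<open>2 * 26 * (4 * 90 + 1) = 18772\<close>.\<close>

lemma tensor_dim_le:
  assumes "1 \<le> W" "1 \<le> T" "0 < \<epsilon>" "\<epsilon> \<le> 1"
  shows "real (tensor_dim W T (nat \<lceil>1 / \<epsilon>\<rceil>)) \<le> 18772 * dim_bound W T \<epsilon>"
proof -
  define a b where "a = lg (real W)" and "b = lg (real T)"
  define S where "S = lg a + lg b + lg (1 / \<epsilon>)"
  define n where "n = num_vars W T"
  define E where "E = nat \<lceil>1 / \<epsilon>\<rceil>"
  define x where "x = field_bound n E"
  define K where "K = clog (field_size x)"
  have ab: "1 \<le> a" "1 \<le> b" by (simp_all add: a_def b_def one_le_lg)
  then have ab1: "1 \<le> a * b" using mult_mono[of 1 a 1 b] by simp
  have "log 2 (real (Suc T)) \<le> log 2 (2 * real T)" using assms by (intro log_mono) auto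
  then have "log 2 (real (Suc T)) \<le> 1 + log 2 (real T)" using assms by (simp add: log_mult)
  then have "real (clog (Suc T)) \<le> 3 * b" "real (clog W) + 1 \<le> 3 * a"
    using clog_le[of "Suc T"] clog_le[of W] assms ab log_le_lg[of "real T"] log_le_lg[of "real W"]
    by (auto simp: a_def b_def)
  then have "real (clog (Suc T)) * (real (clog W) + 1) \<le> (3 * b) * (3 * a)"
    using ab by (intro mult_mono) auto
  then have n9: "real n \<le> 9 * (a * b)" by (simp add: n_def num_vars_def algebra_simps)
  have n90: "real n * (real n + 1) \<le> 90 * (a * b)\<^sup>2"
  proof -
    have "real n * (real n + 1) \<le> (9 * (a * b)) * (10 * (a * b))"
      using n9 ab1 by (intro mult_mono) auto
    then show ?thesis by (simp add: power2_eq_square)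
  qed
  have sq1: "1 \<le> (a * b)\<^sup>2" using ab1 by (simp add: one_le_power)
  have e1: "1 \<le> 1 / \<epsilon>" using assms by simp
  have "real E \<le> 1 / \<epsilon> + 1" unfolding E_def using assms by (simp add: of_nat_ceiling)
  then have E: "real E \<le> 2 * (1 / \<epsilon>)" using e1 by linarith
  have x8: "8 \<le> x" by (simp add: x_def field_bound_def)
  have "real x = 4 * (real n * (real n + 1)) * real E + 8"
    by (simp add: x_def field_bound_def algebra_simps)
  also have "\<dots> \<le> 4 * (90 * (a * b)\<^sup>2) * (2 * (1 / \<epsilon>)) + 8 * ((a * b)\<^sup>2 * (1 / \<epsilon>))"
  proof (rule add_mono)
    have "4 * (real n * (real n + 1)) \<le> 4 * (90 * (a * b)\<^sup>2)" using n90 by (rule mult_left_mono) simp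
    then show "4 * (real n * (real n + 1)) * real E \<le> 4 * (90 * (a * b)\<^sup>2) * (2 * (1 / \<epsilon>))"
      using E by (rule mult_mono) auto
    show "8 \<le> 8 * ((a * b)\<^sup>2 * (1 / \<epsilon>))" using mult_mono[OF sq1 e1] by simp
  qed
  \<comment> \<open>The coefficient \<open>4 * 90 * 2 + 8 = 728\<close> is raised to a power of 2
    for the sake of the logarithm.\<close>
  also have "\<dots> \<le> 1024 * ((a * b)\<^sup>2 * (1 / \<epsilon>))"
    using mult_mono[OF sq1 e1] by simp
  finally have "log 2 (real x) \<le> log 2 (1024 * ((a * b)\<^sup>2 * (1 / \<epsilon>)))"
    using x8 by (intro log_mono) auto
  also have "\<dots> = 10 + 2 * log 2 a + 2 * log 2 b + log 2 (1 / \<epsilon>)"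
  proof -
    have "log 2 (1024 :: real) = 10" using log_nat_power[of 2 2 10] by simp
    then show ?thesis using ab assms by (simp add: log_mult log_nat_power power_mult_distrib log_divide)
  qed
  also have "\<dots> \<le> 10 + 2 * lg a + 2 * lg b + lg (1 / \<epsilon>)"
    using log_le_lg[of a] log_le_lg[of b] log_le_lg[of "1 / \<epsilon>"] by linarith
  also have "\<dots> \<le> 12 * S"
    unfolding S_def using one_le_lg[of a] one_le_lg[of b] one_le_lg[of "1 / \<epsilon>"] by simp
  finally have lx: "log 2 (real x) \<le> 12 * S" .
  have S1: "1 \<le> S" unfolding S_def using one_le_lg[of a] one_le_lg[of b] one_le_lg[of "1 / \<epsilon>"] by simp
  have p1: "1 \<le> field_size x" using field_size(2)[of x] x8 by simp
  have "real K \<le> 1 + log 2 (real (field_size x))" unfolding K_def by (rule clog_le[OF p1])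
  also have "log 2 (real (field_size x)) \<le> log 2 (real (2 * x\<^sup>2))"
    using field_size(3)[of x] x8 p1 by (intro log_mono) (auto simp del: of_nat_mult of_nat_power)
  also have "log 2 (real (2 * x\<^sup>2)) = 1 + 2 * log 2 (real x)"
    using x8 by (simp add: log_mult log_nat_power)
  finally have K: "real K \<le> 26 * S" using lx S1 by simp
  have "real (tensor_dim W T E) = 2 * real K * (4 * (real n * (real n + 1)) + 1)"
    by (simp add: tensor_dim_def Let_def n_def K_def x_def algebra_simps)
  also have "\<dots> \<le> (2 * (26 * S)) * (361 * (a * b)\<^sup>2)"
    using K n90 sq1 S1 by (intro mult_mono) auto
  also have "\<dots> = 18772 * dim_bound W T \<epsilon>"
    by (simp add: dim_bound_def a_def b_def S_def power_mult_distrib)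
  finally show ?thesis by (simp add: E_def)
qed

section \<open>The program\<close>

abbreviation seq_com (infixr ";;" 60) where "c1 ;; c2 \<equiv> Seq c1 c2"

text \<open>Registers 0 to 19 hold the constants listed in \<open>env\<close> below, 20 and 21 the numbers of the current tensor
  and of its current entry; the rest is scratch space.  Register 1 is left unused: the simplifier rewrites 1
  to \<open>Suc 0\<close>, which would hide it.\<close>

abbreviation differ :: "exp \<Rightarrow> exp \<Rightarrow> exp" where
  "differ a b \<equiv> Plus (Minus a b) (Minus b a)"

text \<open>Register 24 holds the unread part of the tensor index; each pass drops one of its base 4
  digits.\<close>

definition read_com :: "nat \<Rightarrow> nat \<Rightarrow> com" where
  "read_com sel dst = Assign dst (Lit 0) ;;
     for_loop 50 11 (Assign dst (Plus (Times (Lit 2) (Reg dst)) (Mod (Div (Reg 24) (Lit sel)) (Lit 2))) ;;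
       Assign 24 (Div (Reg 24) (Lit 4))) ;;
     Assign dst (Mod (Reg dst) (Reg 10))"

text \<open>Registers 26 to 28 hold Merlin's coefficients, 29 Arthur's point, 23 the current claim
  and 22 the verdict so far, which is only ever cleared. The round number 25 modulo
  \<open>n + 1\<close> tells a quantifier (remainder 0) from a linearisation, and 31 ends up as the
  variable concerned.\<close>

definition round_com :: com where
  "round_com = read_com 2 26 ;; read_com 2 27 ;; read_com 2 28 ;; read_com 1 29 ;;
     Assign 30 (Mod (Plus (Plus (Reg 26) (Reg 27)) (Reg 28)) (Reg 10)) ;;
     Assign 31 (Mod (Reg 25) (Plus (Reg 9) (Lit 1))) ;;
     If (Reg 31)
       (Assign 31 (Minus (Reg 31) (Lit 1)) ;;
        Assign 32 (Load (Plus (Reg 17) (Reg 31))) ;;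
        Assign 30 (Mod (Plus (Times (Reg 26) (Minus (Plus (Reg 10) (Lit 1)) (Reg 32)))
          (Times (Reg 32) (Reg 30))) (Reg 10)))
       (Assign 31 (Div (Reg 25) (Plus (Reg 9) (Lit 1))) ;;
        If (Less (Mod (Reg 31) (Plus (Reg 7) (Lit 1))) (Reg 7))
          (Assign 30 (Mod (Plus (Reg 26) (Times (Reg 30) (Minus (Plus (Reg 10) (Lit 1)) (Reg 26)))) (Reg 10)))
          (Assign 30 (Mod (Times (Reg 26) (Reg 30)) (Reg 10)))) ;;
     If (differ (Reg 30) (Reg 23)) (Assign 22 (Lit 0)) Skip ;;
     Store (Plus (Reg 17) (Reg 31)) (Reg 29) ;;
     Assign 23 (Mod (Plus (Reg 26) (Times (Reg 29) (Plus (Reg 27) (Times (Reg 29) (Reg 28))))) (Reg 10))"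

definition decode_com :: com where
  "decode_com = Assign 36 (Reg 33) ;; Assign 37 (Lit 0) ;; Assign 38 (Lit 0) ;; Assign 39 (Lit 0) ;;
     for_loop 51 6 (Assign 40 (Mod (Reg 36) (Reg 8)) ;; Assign 36 (Div (Reg 36) (Reg 8)) ;;
       Assign 37 (Plus (Times (Lit 2) (Reg 37)) (Mod (Reg 36) (Lit 2))) ;;
       If (Mod (Reg 36) (Lit 2)) (Assign 38 (Reg 40)) (Assign 39 (Reg 40)) ;;
       Assign 36 (Div (Reg 36) (Lit 2)))"

text \<open>For a row of the second set, a label in the first half is sent to position
  \<open>h\<close>, which the range test rejects; truncated subtraction would have made it the valid
  position 0. For the first set the same test rejects labels of the second half.\<close>

definition leaf_com :: com where
  "leaf_com = Assign 35 (Lit 0) ;;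
     If (Less (Reg 37) (Reg 2))
       (Assign 40 (Load (Plus (Lit 5) (Reg 37))) ;;
        If (Less (Reg 20) (Reg 4)) Skip
          (If (Less (Reg 40) (Reg 5)) (Assign 40 (Reg 5)) (Assign 40 (Minus (Reg 40) (Reg 5)))) ;;
        If (Times (Less (Reg 40) (Reg 5)) (Times (Less (Reg 38) (Reg 3)) (Less (Reg 39) (Reg 3))))
          (Assign 40 (Load (Plus (Reg 16) (Plus (Times (Reg 20) (Reg 5)) (Reg 40)))) ;;
           Assign 35 (Load (Plus (Reg 15) (Plus (Times (Plus (Times (Plus (Times (Reg 37) (Reg 3)) (Reg 38)) (Lit 2)) (Reg 40)) (Reg 3)) (Reg 39)))))
          Skip)
       (If (Less (Reg 20) (Reg 4))
          (If (differ (Reg 38) (Reg 39)) Skip (Assign 35 (Lit 1))) Skip)"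

definition factors_com :: com where
  "factors_com = for_loop 51 9 (
       Assign 40 (Load (Plus (Reg 17) (Reg 51))) ;;
       If (Mod (Reg 36) (Lit 2))
         (Assign 35 (Mod (Times (Reg 35) (Reg 40)) (Reg 10)))
         (Assign 35 (Mod (Times (Reg 35) (Minus (Plus (Reg 10) (Lit 1)) (Reg 40))) (Reg 10))) ;;
       Assign 36 (Div (Reg 36) (Lit 2)))"

definition multilinear_com :: com where
  "multilinear_com = Assign 34 (Lit 0) ;;
     for_loop 33 14 (decode_com ;; leaf_com ;; Assign 36 (Reg 33) ;;
       factors_com ;;
       Assign 34 (Mod (Plus (Reg 34) (Reg 35)) (Reg 10)))"

definition entry_com :: com where
  "entry_com = Assign 22 (Lit 1) ;; Assign 23 (Lit 0) ;; Assign 24 (Reg 21) ;;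
     for_loop 25 9 (Store (Plus (Reg 17) (Reg 25)) (Lit 0)) ;;
     for_loop 25 19 round_com ;;
     read_com 2 26 ;;
     multilinear_com ;;
     If (Less (Reg 20) (Reg 4)) (Assign 30 (differ (Reg 34) (Reg 26)))
       (Assign 30 (differ (Mod (Plus (Reg 34) (Reg 26)) (Reg 10)) (Reg 23))) ;;
     If (Reg 30) (Assign 22 (Lit 0)) Skip ;;
     Store (Plus (Plus (Reg 0) (Lit 2)) (Plus (Times (Reg 20) (Reg 13)) (Reg 21))) (Reg 22)"

definition tensors_com :: com where
  "tensors_com = Store (Reg 0) (Reg 12) ;; Store (Plus (Reg 0) (Lit 1)) (Reg 4) ;;
     for_loop 20 18 (for_loop 21 13 entry_com)"

text \<open>The final check of a tensor: Merlin splits the value of the multilinear extension between the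
  two tensors, one of which verifies its part \<open>\<alpha>\<close> and the other the complementary part.\<close>

definition row_check :: "nat \<Rightarrow> nat \<Rightarrow> nat \<Rightarrow> bool \<Rightarrow> (nat \<Rightarrow> bool) \<Rightarrow> (nat \<Rightarrow> nat) \<Rightarrow> nat \<Rightarrow> nat \<Rightarrow> bool" where
  "row_check p K n side F r v I =
    (let x = multilinear n (\<lambda>A. of_bool (F A)) (\<lambda>i. int (r i)) mod int p; \<alpha> = int (block 2 I K mod p)
     in if side then (x + \<alpha>) mod int p = int v else x = \<alpha>)"

section \<open>Correctness of the loops that write the tensors\<close>

locale machine = ram ws Z q for ws Z q +
  fixes h S W N L wb n p K t D eb sb rb :: nat
    and lab :: "nat \<Rightarrow> nat" and edge :: "nat \<Rightarrow> nat \<Rightarrow> bool \<Rightarrow> nat \<Rightarrow> bool" and row :: "nat \<Rightarrow> nat \<Rightarrow> bool"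
  assumes q: "12 \<le> q"
    and p: "1 < p" "p \<le> 2 ^ K"
    and n: "n = L * (wb + 1)"
    and Z: "2 ^ K \<le> Z" "2 ^ n \<le> Z" "n * (n + 1) \<le> Z" "2 * N \<le> Z" "D \<le> Z" "2 ^ L \<le> Z" "t \<le> Z" "K \<le> Z" "n \<le> Z" "L \<le> Z" "h \<le> Z"
    and D: "0 < D"
    and addr: "\<And>s. s < S \<Longrightarrow> 5 + s < rb"
      "\<And>s j k \<beta>. s < S \<Longrightarrow> j < W \<Longrightarrow> k < W \<Longrightarrow> eb + (((s * W + j) * 2 + of_bool \<beta>) * W + k) < rb"
      "\<And>i l. i < 2 * N \<Longrightarrow> l < h \<Longrightarrow> sb + (i * h + l) < rb"
begin

text \<open>The share of the step relation that one row can see. Steps beyond the last layer are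
  idle and credited to the first set alone, so that the shares of two rows never add up to more than
  1.\<close>

definition leaf :: "nat \<Rightarrow> nat \<Rightarrow> nat \<Rightarrow> nat \<Rightarrow> bool" where
  "leaf idx s j k =
     (if s < S then
        (let l = (if idx < N then lab s else if lab s < h then h else lab s - h)
         in l < h \<and> j < W \<and> k < W \<and> edge s j (row idx l) k)
      else idx < N \<and> j = k)"

definition leaf_num :: "nat \<Rightarrow> nat \<Rightarrow> bool" where
  "leaf_num idx A = (case decode wb A L of (s, j, k) \<Rightarrow> leaf idx s j k)"

definition env :: "(nat \<Rightarrow> nat) \<Rightarrow> bool" where
  "env R \<longleftrightarrow> R 0 = rb + n \<and> R 5 = h \<and> R 2 = S \<and> R 3 = W \<and> R 4 = N \<and> R 6 = L \<and> R 7 = wb \<and> R 8 = 2 ^ wb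
     \<and> R 9 = n \<and> R 10 = p \<and> R 11 = K \<and> R 12 = t \<and> R 13 = D \<and> R 14 = 2 ^ n \<and> R 15 = eb \<and> R 16 = sb \<and> R 17 = rb
     \<and> R 18 = 2 * N \<and> R 19 = n * (n + 1)"

text \<open>The input lies below \<open>rb\<close>, the evaluation point in the \<open>n\<close>
  cells from \<open>rb\<close> on, and the output starts at \<open>rb + n\<close>, so the input
  stays intact for all entries.\<close>

definition input_mem :: "(nat \<Rightarrow> nat) \<Rightarrow> bool" where
  "input_mem M \<longleftrightarrow> (\<forall>s<S. M (5 + s) = lab s)
     \<and> (\<forall>s<S. \<forall>j<W. \<forall>k<W. \<forall>\<beta>. M (eb + (((s * W + j) * 2 + of_bool \<beta>) * W + k)) = of_bool (edge s j \<beta> k))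
     \<and> (\<forall>i<2 * N. \<forall>l<h. M (sb + (i * h + l)) = of_bool (row i l))"

lemma mod_p_le: "x mod p \<le> Z"
  using p Z(1) mod_less_divisor[of p x] by linarith

lemma env_frame: "env R \<Longrightarrow> (\<And>i. i < 20 \<Longrightarrow> R' i = R i) \<Longrightarrow> env R'"
  by (simp add: env_def)

lemma triple_read:
  assumes R: "env R" and dst: "dst \<in> {26, 27, 28, 29}" and sel: "sel = 1 \<or> sel = 2"
  shows "triple (read_com sel dst) R M (K * 22 + 20) (\<lambda>R' M'. M' = M \<and> R' dst = block sel (R 24) K mod p
    \<and> R' 24 = R 24 div 4 ^ K \<and> same_except {dst, 24, 50} R' R)" (is "triple _ _ _ _ ?post")
  unfolding read_com_def
proof (rule triple_Assign_Seq[where k = "K * 22 + 18"])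
  let ?I = "\<lambda>m R1 M1. M1 = M \<and> R1 50 = m \<and> R1 dst = block sel (R 24) m \<and> R1 24 = R 24 div 4 ^ m
    \<and> same_except {dst, 24, 50} R1 R"
  let ?body = "Assign dst (Plus (Times (Lit 2) (Reg dst)) (Mod (Div (Reg 24) (Lit sel)) (Lit 2))) ;;
     Assign 24 (Div (Reg 24) (Lit 4))"
  fix R0 assume 0: "R0 = R(dst := ev R M (Lit 0))"
  show "triple (for_loop 50 11 ?body ;; Assign dst (Mod (Reg dst) (Reg 10))) R0 M (K * 22 + 18) ?post"
  proof (rule triple_Seq[OF triple_for[where I = ?I and n = K and kb = 14 and Q = "?I K"]])
    fix m R1 M1 assume m: "m < K" "bnd R1 M1" "R1 50 = m" "?I m R1 M1"
    have "block sel (R 24) (Suc m) \<le> Z"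
    proof -
      have "(2 :: nat) ^ Suc m \<le> 2 ^ K" using m by (intro power_increasing) auto
      then show ?thesis using block_less[of sel "R 24" "Suc m"] Z by linarith
    qed
    moreover have "R1 24 div 4 \<le> Z" using m(2) by (metis bnd_def div_le_dividend order_trans)
    moreover have "R 24 div 4 ^ m div 4 = R 24 div 4 ^ Suc m" by (simp add: div_mult2_eq[symmetric] mult.commute)
    ultimately show "triple ?body R1 M1 14 (\<lambda>R1 M1. R1 50 = m \<and> ?I (Suc m) (R1(50 := Suc m)) M1)"
      by (intro triple_loopfree) (use m q sel dst in auto)
  next
    show "K * (14 + 8) + 6 \<le> K * 22 + 6" by simp
  next
    fix R1 M1 assume 1: "bnd R1 M1" "?I K R1 M1"
    have "R1 dst mod p \<le> Z" using 1(1) by (metis bnd_def mod_less_eq_dividend order_trans)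
    then show "triple (Assign dst (Mod (Reg dst) (Reg 10))) R1 M1 10 ?post"
      by (intro triple_loopfree) (use 1 q dst R in \<open>auto simp: env_def\<close>)
  qed (use 0 R dst q Z in \<open>auto simp: env_def\<close>)
qed (use q in simp_all)

text \<open>Stated with a continuation because the four reads are a prefix of the right-nested
  sequence \<open>round_com\<close>.\<close>

lemma triple_read4:
  assumes R: "env R"
    and c: "\<And>R' M'. bnd R' M' \<Longrightarrow> M' = M \<Longrightarrow> R' 26 = block 2 (R 24) K mod p
      \<Longrightarrow> R' 27 = block 2 (R 24 div 4 ^ K) K mod p \<Longrightarrow> R' 28 = block 2 (R 24 div 4 ^ K div 4 ^ K) K mod p
      \<Longrightarrow> R' 29 = block 1 (R 24 div 4 ^ K div 4 ^ K div 4 ^ K) K mod p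
      \<Longrightarrow> R' 24 = R 24 div 4 ^ K div 4 ^ K div 4 ^ K div 4 ^ K
      \<Longrightarrow> (\<And>i. i \<notin> {26, 27, 28, 29, 24, 50} \<Longrightarrow> R' i = R i)
      \<Longrightarrow> triple c R' M' k Q"
    and k: "K * 88 + 80 + k \<le> k'"
  shows "triple (read_com 2 26 ;; read_com 2 27 ;; read_com 2 28 ;; read_com 1 29 ;; c) R M k' Q"
  apply (rule triple_Seq[OF triple_read[OF R], where ?k2.0 = "K * 66 + 60 + k"])
     apply simp
    apply simp
  subgoal for R1 M1
    apply (rule triple_Seq[OF triple_read, where ?k2.0 = "K * 44 + 40 + k"])
       apply (rule env_frame[OF R], simp)
      apply simp
     apply simp
    subgoal for R2 M2
      apply (rule triple_Seq[OF triple_read, where ?k2.0 = "K * 22 + 20 + k"])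
         apply (rule env_frame[OF R], simp)
        apply simp
       apply simp
      subgoal for R3 M3
        apply (rule triple_Seq[OF triple_read, where ?k2.0 = k])
           apply (rule env_frame[OF R], simp)
          apply simp
         apply simp
        subgoal for R4 M4
          by (rule c) auto
        apply simp
        done
      apply simp
      done
    apply simp
    done
  using k apply simp
  done

text \<open>Zero outside the \<open>n\<close> cells, so that clearing them yields exactly the
  valuation \<open>\<lambda>_. 0\<close> from which the protocol starts.\<close>

definition point :: "(nat \<Rightarrow> nat) \<Rightarrow> nat \<Rightarrow> nat" where
  "point M = (\<lambda>i. if i < n then M (rb + i) else 0)"

lemma triple_round:
  assumes R: "env R" and r: "\<forall>i. point M i < p" and \<tau>: "R 25 < n * (n + 1)"
  defines "op \<equiv> qbf_ops wb n 0 ! R 25" and "J \<equiv> R 24"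
  defines "a \<equiv> block 2 J K mod p" and "b \<equiv> block 2 (J div 4 ^ K) K mod p"
    and "c \<equiv> block 2 (J div 4 ^ K div 4 ^ K) K mod p" and "z \<equiv> block 1 (J div 4 ^ K div 4 ^ K div 4 ^ K) K mod p"
  shows "triple round_com R M (K * 88 + 200) (\<lambda>R' M'. op_var op < n \<and> M' = M(rb + op_var op := z)
    \<and> (R' 22 \<noteq> 0 \<longleftrightarrow> R 22 \<noteq> 0 \<and> combine_mod p op (point M) a ((a + b + c) mod p) = R 23)
    \<and> (R' 22 = R 22 \<or> R' 22 = 0)
    \<and> R' 23 = (a + z * (b + z * c)) mod p \<and> R' 24 = J div 4 ^ K div 4 ^ K div 4 ^ K div 4 ^ K
    \<and> same_except {22, 23, 24, 26, 27, 28, 29, 30, 31, 32, 50} R' R)"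
  unfolding round_com_def
  apply (rule triple_read4[OF R, where k = 120])
    apply (rule triple_loopfree)
  subgoal using q by simp
  subgoal for R1 M1
  proof -
    assume R1: "bnd R1 M1" "M1 = M" "R1 26 = block 2 (R 24) K mod p" "R1 27 = block 2 (R 24 div 4 ^ K) K mod p"
       "R1 28 = block 2 (R 24 div 4 ^ K div 4 ^ K) K mod p"
       "R1 29 = block 1 (R 24 div 4 ^ K div 4 ^ K div 4 ^ K) K mod p"
       "R1 24 = R 24 div 4 ^ K div 4 ^ K div 4 ^ K div 4 ^ K"
      "\<And>i. i \<notin> {26, 27, 28, 29, 24, 50} \<Longrightarrow> R1 i = R i"
    have abcz: "R1 26 = a" "R1 27 = b" "R1 28 = c" "R1 29 = z" 
      using R1 by (simp_all add: a_def b_def c_def z_def J_def)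
    have MZ: "M i \<le> Z" for i using R1 by (simp add: bnd_def)
    have zZ: "z \<le> Z" unfolding z_def by (rule mod_p_le)
    have e: "R1 9 = n" "R1 10 = p" "R1 17 = rb" "R1 7 = wb" "R1 25 = R 25" "R1 23 = R 23" "R1 22 = R 22"
      using R R1(8) by (simp_all add: env_def)
    have d: "R 25 div (n + 1) < n" using \<tau> by (simp add: div_less_iff_less_mult)
    have m: "R 25 mod (n + 1) < n + 1" by simp
    have op: "op = (if R 25 mod (n + 1) = 0 then quantifier wb (R 25 div (n + 1)) else Linear_op (R 25 mod (n + 1) - 1))"
      unfolding op_def using qbf_ops_nth[OF \<tau>] .
    have nZ: "x < n + 1 \<Longrightarrow> x \<le> Z" for x using Z by linarith
    have fr: "R1 i = R i" if "i \<notin> {22, 23, 24, 26, 27, 28, 29, 30, 31, 32, 50}" for i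
      using R1(8) that by simp
    show ?thesis
    proof (cases "R 25 mod (n + 1) = 0")
      case True
      then have op: "op = quantifier wb (R 25 div (n + 1))" using op by simp
      show ?thesis
      proof (cases "R 25 div (n + 1) mod (wb + 1) < wb")
        case True': True
        then have "op = Exist_op (R 25 div (n + 1))" unfolding op quantifier_def by simp
        then show ?thesis
          using True True' d nZ[of "R 25 div (n + 1)"] R1(2,7) by (auto simp: abcz e mod_p_le zZ J_def fr)
      next
        case False
        then have "op = Forall_op (R 25 div (n + 1))" unfolding op quantifier_def by simp
        then show ?thesis
          using True False d nZ[of "R 25 div (n + 1)"] R1(2,7) by (auto simp: abcz e mod_p_le zZ J_def fr)
      qed
    next
      case False
      then have op: "op = Linear_op (R 25 mod (n + 1) - 1)" using op by simp
      have lt: "R 25 mod (n + 1) - 1 < n" using m False by linarith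
      have pt: "M (rb + (R 25 mod (n + 1) - 1)) = point M (R 25 mod (n + 1) - 1)"
        using lt by (simp add: point_def)
      have "point M (R 25 mod (n + 1) - 1) \<le> Z" using MZ unfolding pt[symmetric] .
      then show ?thesis using False lt nZ[of "R 25 mod (n + 1)"] nZ[of "R 25 mod (n + 1) - 1"] m pt MZ R1(2,7)
        by (auto simp: op abcz e mod_p_le zZ J_def fr)
    qed
  qed
   apply simp
  apply simp
  done

text \<open>Keeps the interval number within \<open>2 ^ L\<close>, hence within \<open>Z\<close>,
  while it is built up in a register.\<close>

lemma decode_less: "decode w A c = (s, j, k) \<Longrightarrow> s < 2 ^ c"
proof (induction c arbitrary: s j k)
  case (Suc c)
  obtain s' j' k' where d: "decode w A c = (s', j', k')" by (cases "decode w A c")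
  show ?case using Suc.IH[OF d] Suc.prems by (auto simp: d Let_def split: if_splits)
qed simp

lemma triple_decode:
  assumes R: "env R"
  shows "triple decode_com R M (L * 40 + 20) (\<lambda>R' M'. M' = M \<and> (R' 37, R' 38, R' 39) = decode wb (R 33) L
    \<and> same_except {36, 37, 38, 39, 40, 51} R' R)" (is ?thesis)
proof (rule triple_bnd)
  assume bnd: "bnd R M"
  let ?body = "Assign 40 (Mod (Reg 36) (Reg 8)) ;; Assign 36 (Div (Reg 36) (Reg 8)) ;;
       Assign 37 (Plus (Times (Lit 2) (Reg 37)) (Mod (Reg 36) (Lit 2))) ;;
       If (Mod (Reg 36) (Lit 2)) (Assign 38 (Reg 40)) (Assign 39 (Reg 40)) ;;
       Assign 36 (Div (Reg 36) (Lit 2))"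
  let ?A = "R 33"
  let ?I = "\<lambda>m R1 M1. M1 = M \<and> R1 51 = m \<and> R1 36 = ?A div 2 ^ (m * (wb + 1))
    \<and> (R1 37, R1 38, R1 39) = decode wb ?A m \<and> same_except {36, 37, 38, 39, 40, 51} R1 R"
  have loop: "triple (for_loop 51 6 ?body) R1 M (L * 40 + 6) (?I L)"
    if R1: "R1 36 = ?A" "R1 37 = 0" "R1 38 = 0" "R1 39 = 0" "same_except {36, 37, 38, 39, 40, 51} R1 R" for R1
  proof (rule triple_for[where I = ?I and n = L and kb = 30])
    fix m R1 M1 assume m: "m < L" "bnd R1 M1" "R1 51 = m" "?I m R1 M1"
    have b: "R1 i \<le> Z" for i using m(2) by (simp add: bnd_def)
    have b2: "R1 36 mod x \<le> Z" "R1 36 div x \<le> Z" "R1 36 div x div y \<le> Z" for x y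
      using b[of 36] by (meson div_le_dividend mod_less_eq_dividend order_trans)+
    obtain s j k where dec: "decode wb ?A m = (s, j, k)" by (cases "decode wb ?A m")
    have jk: "R1 37 = s" "R1 38 = j" "R1 39 = k" using m(4) dec by auto
    have R8: "R1 8 = 2 ^ wb" using m(4) R by (simp add: env_def)
    have "s < 2 ^ m" using decode_less[OF dec] .
    then have "2 * s + x mod 2 < 2 ^ Suc m" for x
      using mod_less_divisor[of 2 x] unfolding power_Suc by linarith
    moreover have "(2 :: nat) ^ Suc m \<le> 2 ^ L" using m(1) by (intro power_increasing) auto
    ultimately have b3: "2 * s + x mod 2 \<le> Z" for x using Z(6) by (meson less_imp_le order_trans)
    have *: "?A div 2 ^ (m * (wb + 1)) div 2 ^ wb div 2 = ?A div 2 ^ (Suc m * (wb + 1))"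
    proof -
      have "2 ^ (Suc m * (wb + 1)) = 2 ^ (m * (wb + 1)) * 2 ^ wb * (2 :: nat)" by (simp add: power_add)
      then show ?thesis by (simp only: div_mult2_eq)
    qed
    have 36: "R1 36 = ?A div 2 ^ (m * (wb + 1))" using m(4) by blast
    have b4: "?A div x \<le> Z" for x using bnd by (metis bnd_def div_le_dividend order_trans)
    show "triple ?body R1 M1 30 (\<lambda>R1 M1. R1 51 = m \<and> ?I (Suc m) (R1(51 := Suc m)) M1)"
    proof (rule triple_loopfree)
      have d: "decode wb ?A (Suc m) = (if odd (R1 36 div 2 ^ wb) then (2 * s + 1, R1 36 mod 2 ^ wb, k)
          else (2 * s, j, R1 36 mod 2 ^ wb))"
        by (simp add: dec 36 Let_def)
      show "wp Z ?body (\<lambda>R1 M1. R1 51 = m \<and> ?I (Suc m) (R1(51 := Suc m)) M1) R1 M1"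
        using m(3,4) b2 b3 b4 *
        by (simp add: jk R8 d 36[symmetric] del: decode.simps mult_Suc) (auto simp: odd_iff_mod_2_eq_one)
    qed (use q in auto)
  qed (use R1 R q Z in \<open>auto simp: env_def\<close>)
  have "triple decode_com R M (L * 40 + 20) (?I L)"
    unfolding decode_com_def
    apply (rule triple_Assign_Seq[where k = "L * 40 + 12"]; (use q bnd in \<open>simp add: bnd_def; fail\<close>)?)
    apply (rule triple_Assign_Seq[where k = "L * 40 + 10"]; (use q in \<open>simp; fail\<close>)?)
    apply (rule triple_Assign_Seq[where k = "L * 40 + 8"]; (use q in \<open>simp; fail\<close>)?)
    apply (rule triple_Assign_Seq[where k = "L * 40 + 6"]; (use q in \<open>simp; fail\<close>)?)
    apply (rule loop, simp_all)
    done
  then show ?thesis by (rule triple_conseq) simp_all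
qed

lemma triple_leaf:
  assumes R: "env R" and M: "input_mem M" and idx: "R 20 < 2 * N"
  shows "triple leaf_com R M 100 (\<lambda>R' M'. M' = M \<and> R' 35 = of_bool (leaf (R 20) (R 37) (R 38) (R 39))
    \<and> same_except {35, 40} R' R)"
proof (rule triple_bnd)
  assume bnd: "bnd R M"
  have b: "M a \<le> Z" "R i \<le> Z" "R i - x \<le> Z" "M a - x \<le> Z" for a i x
    using bnd by (auto simp: bnd_def intro: order_trans[OF diff_le_self])
  have e: "R 5 = h" "R 2 = S" "R 3 = W" "R 4 = N" "R 15 = eb" "R 16 = sb" using R by (auto simp: env_def)
  have m1: "s < S \<Longrightarrow> M (5 + s) = lab s" for s using M by (simp add: input_mem_def)
  have m2: "s < S \<Longrightarrow> j < W \<Longrightarrow> k < W \<Longrightarrow>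
     M (eb + (((s * W + j) * 2 + of_bool \<beta>) * W + k)) = of_bool (edge s j \<beta> k)" for s j k \<beta>
    using M by (simp add: input_mem_def)
  have m3: "l < h \<Longrightarrow> M (sb + (R 20 * h + l)) = of_bool (row (R 20) l)" for l
    using M idx by (simp add: input_mem_def)
  have lZ: "s < S \<Longrightarrow> lab s \<le> Z" "s < S \<Longrightarrow> lab s - x \<le> Z" for s x
    using m1[of s] b(1)[of "5 + s"] b(4)[of "5 + s" x] by simp_all
  have ob: "of_bool \<beta> \<le> Z" for \<beta> using Z2 by simp
  let ?Q = "\<lambda>R' M'. M' = M \<and> R' 35 = of_bool (leaf (R 20) (R 37) (R 38) (R 39))
    \<and> same_except {35, 40} R' R"
  have "wp Z leaf_com ?Q R M"
  proof (cases "R 37 < S")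
    case False
    then show ?thesis using Z2 by (auto simp: leaf_com_def e leaf_def)
  next
    case s: True
    note simps = leaf_com_def e m1 m2 m3 leaf_def Let_def lZ ob b
    show ?thesis
    proof (cases "R 20 < N")
      case True
      then show ?thesis using s by (simp add: simps del: distrib_right_numeral) blast
    next
      case idx: False
      show ?thesis
      proof (cases "lab (R 37) < h")
        case True
        then show ?thesis using s idx Z by (simp add: simps del: distrib_right_numeral)
      next
        case False
        obtain l where l: "lab (R 37) - h = l" by blast
        then have "l \<le> Z" using lZ s by blast
        then show ?thesis using s idx False by (simp add: simps l del: distrib_right_numeral) blast
      qed
    qed
  qed
  then show "triple leaf_com R M 100 ?Q"
    by (rule triple_loopfree[rotated]) (use q in \<open>simp_all add: leaf_com_def\<close>)
qed

text \<open>A congruence only, because register 35 is reduced after every factor while the product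
  runs over the integers. In use it starts out as the leaf bit.\<close>

lemma triple_factors:
  assumes R: "env R" and r: "\<forall>i. point M i < p" and A: "R 36 = A"
  shows "triple factors_com R M (n * 40 + 6)
    (\<lambda>R' M'. M' = M \<and> [int (R' 35) = int (R 35) * (\<Prod>i<n. if bit A i then int (point M i) else 1 - int (point M i))] (mod int p)
      \<and> same_except {35, 36, 40, 51} R' R)"
  unfolding factors_com_def
proof (rule triple_for[where n = n and kb = 32 and I = "\<lambda>m R1 M1. M1 = M \<and> R1 36 = A div 2 ^ m
    \<and> [int (R1 35) = int (R 35) * (\<Prod>i<m. if bit A i then int (point M i) else 1 - int (point M i))] (mod int p)
      \<and> same_except {35, 36, 40, 51} R1 R"])
  fix m R1 M1
  let ?body = "Assign 40 (Load (Plus (Reg 17) (Reg 51))) ;;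
     If (Mod (Reg 36) (Lit 2))
       (Assign 35 (Mod (Times (Reg 35) (Reg 40)) (Reg 10)))
       (Assign 35 (Mod (Times (Reg 35) (Minus (Plus (Reg 10) (Lit 1)) (Reg 40))) (Reg 10))) ;;
     Assign 36 (Div (Reg 36) (Lit 2))"
  let ?P = "\<lambda>m. int (R 35) * (\<Prod>i<m. if bit A i then int (point M i) else 1 - int (point M i))"
  assume m: "m < n" "bnd R1 M1" "R1 51 = m" and "M1 = M \<and> R1 36 = A div 2 ^ m \<and> [int (R1 35) = ?P m] (mod int p)
      \<and> same_except {35, 36, 40, 51} R1 R"
  then have I: "M1 = M" "R1 36 = A div 2 ^ m" "[int (R1 35) = ?P m] (mod int p)"
     "same_except {35, 36, 40, 51} R1 R" by auto
  have e: "R1 10 = p" "R1 17 = rb" using I(4) R by (auto simp: env_def)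
  have pt: "M (rb + m) = point M m" using m(1) by (simp add: point_def)
  have "A div 2 ^ m \<le> Z" using m(2) unfolding I(2)[symmetric] by (simp add: bnd_def)
  then have b: "A div 2 ^ m div 2 \<le> Z" "point M m \<le> Z"
    using m(2) I(1) unfolding pt[symmetric] by (auto simp: bnd_def intro: order_trans[OF div_le_dividend])
  have d: "A div 2 ^ m div 2 = A div (2 * 2 ^ m)" by (simp add: div_mult2_eq[symmetric] mult.commute)
  have bit: "bit A m \<longleftrightarrow> (A div 2 ^ m) mod 2 \<noteq> 0" by (simp add: bit_iff_odd even_iff_mod_2_eq_zero)
  have c1: "[int (R1 35 * point M m mod p) = ?P (Suc m)] (mod int p)" if "bit A m"
  proof -
    have "[int (R1 35 * point M m mod p) = int (R1 35) * int (point M m)] (mod int p)"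
      by (simp add: zmod_int cong_def)
    also have "[int (R1 35) * int (point M m) = ?P m * int (point M m)] (mod int p)"
      using I(3) by (rule cong_mult[OF _ cong_refl])
    finally show ?thesis using that by (simp add: mult.assoc)
  qed
  have c2: "[int (R1 35 * (p + 1 - point M m) mod p) = ?P (Suc m)] (mod int p)" if "\<not> bit A m"
  proof -
    have "point M m < p" using r by blast
    then have "int (p + 1 - point M m) = (1 - int (point M m)) + int p" by simp
    then have "[int (R1 35 * (p + 1 - point M m) mod p) = int (R1 35) * (1 - int (point M m) + int p)] (mod int p)"
      by (simp add: zmod_int cong_def del: of_nat_diff)
    also have "[int (R1 35) * (1 - int (point M m) + int p) = int (R1 35) * (1 - int (point M m))] (mod int p)"
      by (intro cong_mult cong_refl) (simp add: cong_def)
    also have "[int (R1 35) * (1 - int (point M m)) = ?P m * (1 - int (point M m))] (mod int p)"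
      using I(3) by (rule cong_mult[OF _ cong_refl])
    finally show ?thesis using that by (simp add: mult.assoc)
  qed
  show "triple ?body R1 M1 32 (\<lambda>R1 M1. R1 51 = m \<and> M1 = M \<and> (R1(51 := Suc m)) 36 = A div 2 ^ Suc m
    \<and> [int ((R1(51 := Suc m)) 35) = ?P (Suc m)] (mod int p)
      \<and> same_except {35, 36, 40, 51} (R1(51 := Suc m)) R)" (is "triple _ _ _ _ ?Q")
  proof (rule triple_loopfree)
    show "wp Z ?body ?Q R1 M1"
    proof (cases "bit A m")
      case True
      then show ?thesis using c1 b m(3) I(4) bit
        by (simp add: e I(1,2) pt mod_p_le d del: prod.lessThan_Suc)
    next
      case False
      then show ?thesis using c2 b m(3) I(4) bit
        by (simp add: e I(1,2) pt mod_p_le d del: prod.lessThan_Suc)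
    qed
  qed (use q in simp_all)
qed (use R q Z A in \<open>auto simp: env_def\<close>)

lemma triple_multilinear:
  assumes R: "env R" and M: "input_mem M" and idx: "R 20 < 2 * N" and r: "\<forall>i. point M i < p"
  shows "triple multilinear_com R M (2 ^ n * (L * 40 + n * 40 + 200) + 20)
    (\<lambda>R' M'. M' = M \<and> int (R' 34) = multilinear n (\<lambda>A. of_bool (leaf_num (R 20) A)) (\<lambda>i. int (point M i)) mod int p
      \<and> same_except {33, 34, 35, 36, 37, 38, 39, 40, 51} R' R)" (is "triple _ _ _ _ ?post")
proof -
  let ?T = "\<lambda>A. of_bool (leaf_num (R 20) A) * (\<Prod>i<n. if bit A i then int (point M i) else 1 - int (point M i))"
  let ?fr = "\<lambda>R1. same_except {33, 34, 35, 36, 37, 38, 39, 40, 51} R1 R"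
  let ?last = "Assign 34 (Mod (Plus (Reg 34) (Reg 35)) (Reg 10))"
  let ?I = "\<lambda>m R1 M1. M1 = M \<and> int (R1 34) = (\<Sum>A<m. ?T A) mod int p \<and> ?fr R1"
  let ?Q = "\<lambda>m R1 M1. R1 33 = m \<and> ?I (Suc m) (R1(33 := Suc m)) M1"
  show ?thesis unfolding multilinear_com_def
  proof (rule triple_Assign_Seq[where k = "2 ^ n * (L * 40 + n * 40 + 200) + 6"])
    fix R0 assume 0: "R0 = R(34 := ev R M (Lit 0))"
    show "triple (for_loop 33 14 (decode_com ;; leaf_com ;; Assign 36 (Reg 33) ;; factors_com ;; ?last)) R0 M
       (2 ^ n * (L * 40 + n * 40 + 200) + 6) ?post"
    proof (rule triple_for[where n = "2 ^ n" and I = ?I and kb = "L * 40 + n * 40 + 192"])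
      fix m R1 M1 assume m: "m < 2 ^ n" "bnd R1 M1" "R1 33 = m" "?I m R1 M1"
      have e1: "env R1" by (rule env_frame[OF R]) (use m in simp)
      show "triple (decode_com ;; leaf_com ;; Assign 36 (Reg 33) ;; factors_com ;; ?last) R1 M1 (L * 40 + n * 40 + 192) (?Q m)"
      proof (rule triple_Seq[OF triple_decode[OF e1], where ?k2.0 = "n * 40 + 172"])
        fix R2 M2 assume "bnd R2 M2" and 2: "M2 = M1 \<and> (R2 37, R2 38, R2 39) = decode wb (R1 33) L \<and>
            same_except {36, 37, 38, 39, 40, 51} R2 R1"
        have e2: "env R2" by (rule env_frame[OF R]) (use m 2 in simp)
        have m2: "input_mem M2" "R2 20 < 2 * N" "R2 20 = R 20" using M idx m 2 by auto
        have lf: "leaf (R2 20) (R2 37) (R2 38) (R2 39) = leaf_num (R 20) m"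
          using 2 m(3) m2 by (cases "decode wb m L") (auto simp: leaf_num_def)
        show "triple (leaf_com ;; Assign 36 (Reg 33) ;; factors_com ;; ?last) R2 M2 (n * 40 + 172) (?Q m)"
        proof (rule triple_Seq[OF triple_leaf[OF e2 m2(1,2)], where ?k2.0 = "n * 40 + 72"])
          fix R3 M3 assume b3: "bnd R3 M3" and 3: "M3 = M2 \<and> R3 35 = of_bool (leaf (R2 20) (R2 37) (R2 38) (R2 39)) \<and>
            same_except {35, 40} R3 R2"
          show "triple (Assign 36 (Reg 33) ;; factors_com ;; ?last) R3 M3 (n * 40 + 72) (?Q m)"
          proof (rule triple_Assign_Seq[where k = "n * 40 + 70"])
            have 33: "R3 33 = m" using 2 3 m(3) by simp
            show "ev R3 M3 (Reg 33) \<le> Z" using b3 by (simp add: bnd_def)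
            fix R4 assume "R4 = R3(36 := ev R3 M3 (Reg 33))"
            then have 4: "R4 = R3(36 := m)" using 33 by simp
            have M3: "M3 = M" using m(4) 2 3 by simp
            have e4: "env R4" by (rule env_frame[OF R]) (use m 2 3 4 in simp)
            show "triple (factors_com ;; ?last) R4 M3 (n * 40 + 70) (?Q m)"
            proof (rule triple_Seq[OF triple_factors[OF e4 _, of _ m], where ?k2.0 = 20])
              fix R5 M5 assume 5: "M5 = M3 \<and> [int (R5 35) = int (R4 35) * (\<Prod>i<n. if bit m i then int (point M3 i) else 1 - int (point M3 i))] (mod int p)
                 \<and> same_except {35, 36, 40, 51} R5 R4"
              have R4: "R4 35 = of_bool (leaf_num (R 20) m)" using 3 4 lf by simp
              have T: "[int (R5 35) = ?T m] (mod int p)" using 5 unfolding R4 M3 by simp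
              have "R5 34 = R1 34" "R5 10 = p" "R5 33 = m" using 2 3 4 5 e4 m(3) by (auto simp: env_def)
              moreover have "int ((R1 34 + R5 35) mod p) = (\<Sum>A<Suc m. ?T A) mod int p"
              proof -
                have "[int (R1 34) = (\<Sum>A<m. ?T A)] (mod int p)" using m(4) by (simp add: cong_def)
                then have "[int (R1 34) + int (R5 35) = (\<Sum>A<m. ?T A) + ?T m] (mod int p)"
                  using T by (rule cong_add)
                then show ?thesis by (simp add: cong_def zmod_int)
              qed
              moreover have "?fr R5" using 2 3 4 5 m(4) by simp
              ultimately show "triple (?last) R5 M5 20 (?Q m)"
                by (intro triple_loopfree) (use q 5 M3 mod_p_le in \<open>simp_all del: sum.lessThan_Suc\<close>)
            qed (use 4 M3 r in simp_all)
          qed (use q in simp_all)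
        qed simp
      qed simp
    qed (use 0 R q Z p in \<open>auto simp: env_def multilinear_def algebra_simps\<close>)
  qed (use q in simp_all)
qed

definition entry :: "nat \<Rightarrow> nat \<Rightarrow> bool" where
  "entry idx I = transcript_ok p K (row_check p K n (\<not> idx < N) (leaf_num idx)) (qbf_ops wb n 0) (\<lambda>_. 0) 0 I"

definition entry_time :: nat where
  "entry_time = n * 20 + n * (n + 1) * (K * 88 + 220) + K * 22 + 2 ^ n * (L * 40 + n * 40 + 200) + 200"

lemma input_mem_frame:
  assumes "input_mem M" "\<And>a. a < rb \<Longrightarrow> M' a = M a"
  shows "input_mem M'"
  using assms addr unfolding input_mem_def by simp

lemma point_upd: "i < n \<Longrightarrow> point (M(rb + i := x)) = (point M)(i := x)"
  by (auto simp: point_def)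

abbreviation outside_point :: "(nat \<Rightarrow> nat) \<Rightarrow> (nat \<Rightarrow> nat) \<Rightarrow> bool" where
  "outside_point M' M \<equiv> \<forall>a. a < rb \<or> rb + n \<le> a \<longrightarrow> M' a = M a"

lemma triple_zero_point:
  assumes R: "env R"
  shows "triple (for_loop 25 9 (Store (Plus (Reg 17) (Reg 25)) (Lit 0))) R M (n * 20 + 6)
    (\<lambda>R' M'. point M' = (\<lambda>_. 0) \<and> outside_point M' M \<and> (\<forall>i. i \<noteq> 25 \<longrightarrow> R' i = R i))"
proof (rule triple_for[where n = n and kb = 12 and I = "\<lambda>m R1 M1. (\<forall>i<m. M1 (rb + i) = 0)
    \<and> outside_point M1 M \<and> (\<forall>i. i \<noteq> 25 \<longrightarrow> R1 i = R i)"])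
  fix m R1 M1 assume m: "m < n" "R1 25 = m" and I: "(\<forall>i<m. M1 (rb + i) = 0)
    \<and> outside_point M1 M \<and> (\<forall>i. i \<noteq> 25 \<longrightarrow> R1 i = R i)"
  have "R1 17 = rb" using I R by (simp add: env_def)
  then show "triple (Store (Plus (Reg 17) (Reg 25)) (Lit 0)) R1 M1 12 (\<lambda>R1 M1. R1 25 = m \<and> (\<forall>i<Suc m. M1 (rb + i) = 0)
    \<and> outside_point M1 M \<and> (\<forall>i. i \<noteq> 25 \<longrightarrow> (R1(25 := Suc m)) i = R i))"
    by (intro triple_loopfree) (use m I q in \<open>auto simp: less_Suc_eq\<close>)
qed (use R q Z in \<open>auto simp: env_def point_def\<close>)

text \<open>Quantified over \<open>fin\<close> because the final check is executed afterwards, on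
  the state that the rounds leave behind. The invariant splits acceptance into the flag so far and
  the rounds still to come.\<close>

lemma triple_rounds:
  assumes R: "env R" and M: "point M = (\<lambda>_. 0)" and init: "R 22 = 1" "R 23 = 0"
  shows "triple (for_loop 25 19 round_com) R M (n * (n + 1) * (K * 88 + 220) + 6)
    (\<lambda>R' M'. (\<forall>fin. transcript_ok p K fin (qbf_ops wb n 0) (\<lambda>_. 0) 0 (R 24) \<longleftrightarrow>
         R' 22 \<noteq> 0 \<and> fin (point M') (R' 23) (R' 24))
       \<and> R' 22 \<le> 1 \<and> (\<forall>i. point M' i < p)
       \<and> outside_point M' M \<and> (\<forall>i<22. R' i = R i))" (is "triple _ _ _ _ ?post")
proof -
  let ?ops = "qbf_ops wb n 0"
  let ?I = "\<lambda>m R' M'. (\<forall>fin. transcript_ok p K fin ?ops (\<lambda>_. 0) 0 (R 24) \<longleftrightarrow>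
         R' 22 \<noteq> 0 \<and> transcript_ok p K fin (drop m ?ops) (point M') (R' 23) (R' 24))
       \<and> R' 22 \<le> 1 \<and> (\<forall>i. point M' i < p)
       \<and> outside_point M' M \<and> (\<forall>i<22. R' i = R i)"
  have round: "triple round_com R1 M1 (K * 88 + 200) (\<lambda>R' M'. R' 25 = m \<and> ?I (Suc m) (R'(25 := Suc m)) M')"
    if m: "m < n * (n + 1)" "R1 25 = m" and I: "?I m R1 M1" for m R1 M1
  proof -
    have e1: "env R1" by (rule env_frame[OF R]) (use I in simp)
    have drop: "drop m ?ops = ?ops ! m # drop (Suc m) ?ops"
      using m(1) by (simp add: Cons_nth_drop_Suc length_qbf_ops)
    have r: "\<forall>i. point M1 i < p" and \<tau>: "R1 25 < n * (n + 1)" using I m by auto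
    have z: "x mod p < p" for x using p by simp
    show ?thesis
    proof (rule triple_conseq[OF triple_round[OF e1 r \<tau>] order_refl], elim conjE, intro conjI allI impI)
      fix R' M' fin
      assume 2: "op_var (?ops ! R1 25) < n"
        "M' = M1(rb + op_var (?ops ! R1 25) := block 1 (R1 24 div 4 ^ K div 4 ^ K div 4 ^ K) K mod p)"
        "(R' 22 \<noteq> 0) = (R1 22 \<noteq> 0 \<and> combine_mod p (?ops ! R1 25) (point M1) (block 2 (R1 24) K mod p)
            ((block 2 (R1 24) K mod p + block 2 (R1 24 div 4 ^ K) K mod p + block 2 (R1 24 div 4 ^ K div 4 ^ K) K mod p) mod p) = R1 23)"
        "R' 22 = R1 22 \<or> R' 22 = 0"
        "R' 23 = (block 2 (R1 24) K mod p + (block 1 (R1 24 div 4 ^ K div 4 ^ K div 4 ^ K) K mod p) *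
           (block 2 (R1 24 div 4 ^ K) K mod p + (block 1 (R1 24 div 4 ^ K div 4 ^ K div 4 ^ K) K mod p) * (block 2 (R1 24 div 4 ^ K div 4 ^ K) K mod p))) mod p"
        "R' 24 = R1 24 div 4 ^ K div 4 ^ K div 4 ^ K div 4 ^ K"
        "same_except {22, 23, 24, 26, 27, 28, 29, 30, 31, 32, 50} R' R1"
      show "R' 25 = m" using 2(7) m by simp
      have pt: "point M' = (point M1)(op_var (?ops ! m) := block 1 (R1 24 div 4 ^ K div 4 ^ K div 4 ^ K) K mod p)"
        using 2(1,2) m by (simp add: point_upd)
      show "transcript_ok p K fin ?ops (\<lambda>_. 0) 0 (R 24) \<longleftrightarrow>
           (R'(25 := Suc m)) 22 \<noteq> 0 \<and> transcript_ok p K fin (drop (Suc m) ?ops) (point M') ((R'(25 := Suc m)) 23) ((R'(25 := Suc m)) 24)"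
      proof -
        have "transcript_ok p K fin ?ops (\<lambda>_. 0) 0 (R 24) \<longleftrightarrow>
           R1 22 \<noteq> 0 \<and> transcript_ok p K fin (drop m ?ops) (point M1) (R1 23) (R1 24)" using I by blast
        also have "\<dots> \<longleftrightarrow> R' 22 \<noteq> 0 \<and> transcript_ok p K fin (drop (Suc m) ?ops) (point M') (R' 23) (R' 24)"
          unfolding drop transcript_ok.simps Let_def pt 2(3,5,6) m(2) by blast
        finally show ?thesis by simp
      qed
      show "(R'(25 := Suc m)) 22 \<le> 1" using 2(4) I by auto
      show "point M' i < p" for i using pt I z by simp
      show "M' a = M a" if "a < rb \<or> rb + n \<le> a" for a using that 2(1,2) I by auto
      show "(R'(25 := Suc m)) i = R i" if "i < 22" for i using that 2(7) I by simp
    qed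
  qed
  show ?thesis
  proof (rule triple_for[where n = "n * (n + 1)" and kb = "K * 88 + 200" and I = ?I])
    show "?post R1 M1" if "?I (n * (n + 1)) R1 M1" for R1 M1
      using that length_qbf_ops[of wb n] by simp
    show "R' 19 = n * (n + 1)" if "?I m R' M'" for m R' M'
      using that R by (simp add: env_def)
  qed (use round R q Z p M init in \<open>auto simp: env_def\<close>)
qed

lemma triple_entry:
  assumes R: "env R" and M: "input_mem M" and idx: "R 20 < 2 * N"
  shows "triple entry_com R M entry_time
    (\<lambda>R' M'. M' (rb + n + 2 + (R 20 * D + R 21)) = of_bool (entry (R 20) (R 21))
       \<and> (\<forall>a. a < rb \<or> rb + n \<le> a \<and> a \<noteq> rb + n + 2 + (R 20 * D + R 21) \<longrightarrow> M' a = M a)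
       \<and> (\<forall>i<22. R' i = R i))"
proof (rule triple_bnd)
  assume bnd: "bnd R M"
  let ?a = "rb + n + 2 + (R 20 * D + R 21)"
  let ?Q = "\<lambda>R' M'. M' ?a = of_bool (entry (R 20) (R 21))
       \<and> (\<forall>a. a < rb \<or> rb + n \<le> a \<and> a \<noteq> ?a \<longrightarrow> M' a = M a) \<and> (\<forall>i<22. R' i = R i)"
  let ?fin = "row_check p K n (\<not> R 20 < N) (leaf_num (R 20))"
  note env_low = env_frame[OF R]
  let ?k = "n * 20 + n * (n + 1) * (K * 88 + 220) + K * 22 + 2 ^ n * (L * 40 + n * 40 + 200)"
  show "triple entry_com R M entry_time ?Q"
    unfolding entry_com_def entry_time_def
    apply (rule triple_Assign_Seq[where k = "?k + 190"]; (use q Z2 in \<open>simp; fail\<close>)?)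
    apply (rule triple_Assign_Seq[where k = "?k + 180"]; (use q in \<open>simp; fail\<close>)?)
    apply (rule triple_Assign_Seq[where k = "?k + 170"]; (use q bnd in \<open>simp add: bnd_def; fail\<close>)?)
    subgoal for R0 R1 R2
      apply (rule triple_Seq[OF triple_zero_point, where
            ?k2.0 = "n * (n + 1) * (K * 88 + 220) + K * 22 + 2 ^ n * (L * 40 + n * 40 + 200) + 160"])
        apply (rule env_low, simp)
      subgoal for R3 M3
        apply (rule triple_Seq[OF triple_rounds, where
              ?k2.0 = "K * 22 + 2 ^ n * (L * 40 + n * 40 + 200) + 150"])
             apply (rule env_low, simp)
            apply simp
           apply simp
          apply simp
        subgoal for R4 M4
          apply (rule triple_Seq[OF triple_read, where ?k2.0 = "2 ^ n * (L * 40 + n * 40 + 200) + 130"])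
             apply (rule env_low, simp)
            apply simp
           apply simp
          subgoal for R5 M5
            apply (rule triple_Seq[OF triple_multilinear, where ?k2.0 = 100])
                 apply (rule env_low, simp)
                apply (rule input_mem_frame[OF M], simp)
            using idx apply simp
              apply simp
            subgoal premises prems for R6 M6
            proof -
              have e: "env R6" by (rule env_low) (use prems in simp)
              have c: "R6 0 = rb + n" "R6 4 = N" "R6 10 = p" "R6 13 = D" using e by (auto simp: env_def)
              have fr: "R6 i = R i" if "i < 22" for i using prems that by simp
              have fr2: "R6 20 = R 20" "R6 21 = R 21" using fr by simp_all
              have mem: "outside_point M6 M" using prems by simp
              have r22: "R6 22 = R4 22" "R4 22 \<le> 1" "R6 23 = R4 23" "R6 26 = block 2 (R4 24) K mod p"
                using prems by simp_all
              have pt: "M6 = M4" using prems by simp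
              have x: "int (R6 34) = multilinear n (\<lambda>A. of_bool (leaf_num (R 20) A)) (\<lambda>i. int (point M4 i)) mod int p"
                using prems by simp
              have en: "entry (R 20) (R 21) \<longleftrightarrow> R4 22 \<noteq> 0 \<and> ?fin (point M4) (R4 23) (R4 24)"
                unfolding entry_def using prems by simp
              have f1: "?fin (point M4) (R4 23) (R4 24) \<longleftrightarrow> R6 34 = R6 26" if "R 20 < N"
                unfolding row_check_def Let_def x[symmetric] r22(4) using that by (simp only: of_nat_eq_iff) simp
              have f2: "?fin (point M4) (R4 23) (R4 24) \<longleftrightarrow> (R6 34 + R6 26) mod p = R6 23" if "\<not> R 20 < N"
                unfolding row_check_def Let_def x[symmetric] r22(3) r22(4)[symmetric] using that
                by (metis (mono_tags, lifting) of_nat_add of_nat_eq_iff zmod_int)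
              have bn: "bnd R6 M6" using prems by blast
              have b: "R6 i \<le> Z" for i using bn by (simp add: bnd_def)
              have df: "u - v + (v - u) \<le> Z" if "u \<le> Z" "v \<le> Z" for u v using that by linarith
              have ob: "of_bool (R4 22 \<noteq> 0) = R4 22" using r22(2) by (cases "R4 22") auto
              have mem': "M6 a = M a" if "a < rb \<or> rb + n \<le> a" for a using mem that by blast
              have e': "of_bool (entry (R 20) (R 21)) = (if (if R 20 < N then R6 34 = R6 26 else (R6 34 + R6 26) mod p = R6 23) then R4 22 else 0)"
                unfolding en using f1 f2 ob by auto
              show ?thesis
              proof (rule triple_loopfree)
                show "wp Z (If (Less (Reg 20) (Reg 4)) (Assign 30 (differ (Reg 34) (Reg 26)))
                   (Assign 30 (differ (Mod (Plus (Reg 34) (Reg 26)) (Reg 10)) (Reg 23))) ;;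
                  If (Reg 30) (Assign 22 (Lit 0)) Skip ;;
                  Store (Plus (Plus (Reg 0) (Lit 2)) (Plus (Times (Reg 20) (Reg 13)) (Reg 21))) (Reg 22)) ?Q R6 M6"
                proof (cases "R 20 < N")
                  case True
                  then show ?thesis
                    using df[OF b[of 34] b[of 26]] b[of 22] fr by (auto simp: c fr2 e' r22(1) mem')
                next
                  case False
                  then show ?thesis
                    using df[OF mod_p_le[of "R6 34 + R6 26"] b[of 23]] b[of 22] fr by (auto simp: c fr2 e' r22(1) mem')
                qed
              qed (use q in simp_all)
            qed
            apply simp
            done
          apply simp
          done
        apply simp
        done
      apply simp
      done
    done
qed

lemma triple_tensors:
  assumes R: "env R" and M: "input_mem M"
  shows "triple tensors_com R M (2 * N * (D * (entry_time + 8) + 14) + 20)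
    (\<lambda>R' M'. R' 0 = rb + n \<and> M' (rb + n) = t \<and> M' (rb + n + 1) = N
      \<and> (\<forall>x<2 * N * D. M' (rb + n + 2 + x) = of_bool (entry (x div D) (x mod D))))"
proof -
  let ?O = "rb + n"
  define J where "J m M' \<longleftrightarrow> M' ?O = t \<and> M' (?O + 1) = N \<and> (\<forall>a<rb. M' a = M a)
    \<and> (\<forall>x<m. M' (?O + 2 + x) = of_bool (entry (x div D) (x mod D)))" for m and M' :: "nat \<Rightarrow> nat"
  have e: "R 0 = ?O" "R 12 = t" "R 4 = N" using R by (auto simp: env_def)
  have inner: "triple (for_loop 21 13 entry_com) R1 M1 (D * (entry_time + 8) + 6)
     (\<lambda>R2 M2. R2 20 = i \<and> J (Suc i * D) M2 \<and> (\<forall>l<20. R2 l = R l))"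
    if i: "i < 2 * N" "R1 20 = i" "J (i * D) M1" "\<forall>l<20. R1 l = R l" for i R1 M1
  proof (rule triple_for[where n = D and kb = entry_time and
        I = "\<lambda>m R2 M2. R2 20 = i \<and> J (i * D + m) M2 \<and> (\<forall>l<20. R2 l = R l)"])
    fix m R2 M2 assume m: "m < D" "R2 21 = m" and I: "R2 20 = i \<and> J (i * D + m) M2 \<and> (\<forall>l<20. R2 l = R l)"
    have e2: "env R2" by (rule env_frame[OF R]) (use I in simp)
    have m2: "input_mem M2" by (rule input_mem_frame[OF M]) (use I in \<open>simp add: J_def\<close>)
    have i2: "R2 20 < 2 * N" using I i by simp
    have dm: "(i * D + m) div D = i" "(i * D + m) mod D = m" using m(1) by simp_all
    show "triple entry_com R2 M2 entry_time (\<lambda>R2 M2. R2 21 = m \<and> (R2(21 := Suc m)) 20 = i \<and> J (i * D + Suc m) M2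
       \<and> (\<forall>l<20. (R2(21 := Suc m)) l = R l))"
    proof (rule triple_conseq[OF triple_entry[OF e2 m2 i2] order_refl])
      fix R3 M3 assume 3: "M3 (rb + n + 2 + (R2 20 * D + R2 21)) = of_bool (entry (R2 20) (R2 21))
       \<and> (\<forall>a. a < rb \<or> rb + n \<le> a \<and> a \<noteq> rb + n + 2 + (R2 20 * D + R2 21) \<longrightarrow> M3 a = M2 a)
       \<and> (\<forall>i<22. R3 i = R2 i)"
      have c: "R2 20 = i" "R2 21 = m" using I m by auto
      have "M3 (?O + 2 + x) = of_bool (entry (x div D) (x mod D))" if "x < i * D + Suc m" for x
      proof (cases "x = i * D + m")
        case True
        then show ?thesis using 3 dm c by simp
      next
        case False
        then have "x < i * D + m" using that by simp
        then have "M2 (?O + 2 + x) = of_bool (entry (x div D) (x mod D))" using I by (simp add: J_def)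
        moreover have "M3 (?O + 2 + x) = M2 (?O + 2 + x)" using 3 False c by simp
        ultimately show ?thesis by simp
      qed
      then have "J (i * D + Suc m) M3" using 3 I by (simp add: J_def)
      then show "R3 21 = m \<and> (R3(21 := Suc m)) 20 = i \<and> J (i * D + Suc m) M3
       \<and> (\<forall>l<20. (R3(21 := Suc m)) l = R l)" using 3 c I by simp
    qed
  qed (use i R q Z in \<open>auto simp: env_def add.commute\<close>)
  have outer: "triple (for_loop 20 18 (for_loop 21 13 entry_com)) R1 M1 (2 * N * (D * (entry_time + 8) + 14) + 6)
     (\<lambda>R2 M2. J (2 * N * D) M2 \<and> (\<forall>l<20. R2 l = R l))"
    if "J 0 M1" "\<forall>l<20. R1 l = R l" for R1 M1
  proof (rule triple_for[where n = "2 * N" and kb = "D * (entry_time + 8) + 6" and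
        I = "\<lambda>m R2 M2. J (m * D) M2 \<and> (\<forall>l<20. R2 l = R l)"])
    fix m R2 M2 assume m: "m < 2 * N" "R2 20 = m" "J (m * D) M2 \<and> (\<forall>l<20. R2 l = R l)"
    show "triple (for_loop 21 13 entry_com) R2 M2 (D * (entry_time + 8) + 6)
       (\<lambda>R2 M2. R2 20 = m \<and> J (Suc m * D) M2 \<and> (\<forall>l<20. (R2(20 := Suc m)) l = R l))"
      by (rule triple_conseq[OF inner[of m]]) (use m in simp_all)
  qed (use that R q Z in \<open>auto simp: env_def\<close>)
  have "triple tensors_com R M (2 * N * (D * (entry_time + 8) + 14) + 20)
     (\<lambda>R2 M2. J (2 * N * D) M2 \<and> (\<forall>l<20. R2 l = R l))"
    unfolding tensors_com_def
    apply (rule triple_Seq[where ?k1.0 = 3 and ?Q1.0 = "\<lambda>R1 M1. R1 = R \<and> M1 = M(?O := t)"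
        and ?k2.0 = "2 * N * (D * (entry_time + 8) + 14) + 12"])
      apply (rule triple_loopfree; use q Z e in simp)
     apply (rule triple_Seq[where ?k1.0 = 6 and ?Q1.0 = "\<lambda>R1 M1. R1 = R \<and> M1 = M(?O := t, ?O + 1 := N)"
        and ?k2.0 = "2 * N * (D * (entry_time + 8) + 14) + 6"])
       apply (rule triple_loopfree; use q Z e in simp)
    subgoal for R1 M1 R2 M2 by (rule outer) (auto simp: J_def)
     apply simp_all
    done
  then show ?thesis by (rule triple_conseq) (auto simp: J_def e)
qed

end

section \<open>Computing the logarithms, the prime and the addresses\<close>

definition clog_com :: "nat \<Rightarrow> nat \<Rightarrow> nat \<Rightarrow> com" where
  "clog_com src pw cnt = Assign pw (Lit 1) ;; Assign cnt (Lit 0) ;;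
     While (Less (Reg pw) (Reg src)) (Assign pw (Times (Reg pw) (Lit 2)) ;; Assign cnt (Plus (Reg cnt) (Lit 1)))"

definition power_com :: "nat \<Rightarrow> nat \<Rightarrow> com" where
  "power_com dst src = Assign dst (Lit 1) ;; for_loop 45 src (Assign dst (Times (Reg dst) (Lit 2)))"

text \<open>The loop increments before it tests, so register 10 starts one below the bound; hence
  the literal 7 in \<open>size_com\<close> against the 8 in \<open>field_bound\<close>.\<close>

definition prime_com :: com where
  "prime_com = Assign 46 (Lit 0) ;;
     While (Minus (Lit 1) (Reg 46))
       (Assign 10 (Plus (Reg 10) (Lit 1)) ;; Assign 46 (Lit 1) ;; Assign 47 (Lit 2) ;;
        While (Less (Reg 47) (Reg 10))
          (If (Mod (Reg 10) (Reg 47)) Skip (Assign 46 (Lit 0)) ;; Assign 47 (Plus (Reg 47) (Lit 1))))"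

definition header_com :: com where
  "header_com = Assign 5 (Div (Load (Lit 0)) (Lit 2)) ;;
     Assign 43 (Plus (Load (Lit 1)) (Lit 1)) ;;
     Assign 2 (Minus (Reg 43) (Lit 2)) ;;
     Assign 3 (Load (Lit 2)) ;; Assign 4 (Load (Lit 3)) ;; Assign 42 (Load (Lit 4))"

definition size_com :: com where
  "size_com = Assign 9 (Times (Reg 6) (Plus (Reg 7) (Lit 1))) ;;
     Assign 19 (Times (Reg 9) (Plus (Reg 9) (Lit 1))) ;;
     Assign 10 (Plus (Times (Times (Lit 4) (Reg 19)) (Reg 42)) (Lit 7))"

definition address_com :: com where
  "address_com = Assign 15 (Plus (Reg 2) (Lit 5)) ;;
     Assign 16 (Plus (Reg 15) (Times (Times (Lit 2) (Reg 2)) (Times (Reg 3) (Reg 3)))) ;;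
     Assign 17 (Plus (Reg 16) (Times (Times (Lit 2) (Reg 4)) (Reg 5))) ;;
     Assign 0 (Plus (Reg 17) (Reg 9)) ;; Assign 18 (Times (Lit 2) (Reg 4))"

definition setup_com :: com where
  "setup_com = header_com ;; clog_com 43 44 6 ;; clog_com 3 8 7 ;; size_com ;; prime_com ;;
     clog_com 10 44 11 ;;
     Assign 12 (Times (Times (Lit 2) (Reg 11)) (Plus (Times (Lit 4) (Reg 19)) (Lit 1))) ;;
     power_com 13 12 ;; power_com 14 9 ;; address_com"

context ram begin

lemma triple_clog:
  assumes q: "2 < q" and d: "distinct [src, pw, cnt]" and x: "R src = x" "1 \<le> x" "2 * x \<le> Z"
  shows "triple (clog_com src pw cnt) R M (clog x * 20 + 20)
    (\<lambda>R' M'. M' = M \<and> R' pw = 2 ^ clog x \<and> R' cnt = clog x \<and> same_except {pw, cnt} R' R)"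
  unfolding clog_com_def
proof (rule triple_Assign_Seq[where k = "clog x * 20 + 10"])
  fix R1 assume 1: "R1 = R(pw := ev R M (Lit 1))"
  let ?body = "Assign pw (Times (Reg pw) (Lit 2)) ;; Assign cnt (Plus (Reg cnt) (Lit 1))"
  let ?I = "\<lambda>m R' M'. M' = M \<and> R' pw = 2 ^ m \<and> R' cnt = m \<and> same_except {pw, cnt} R' R"
  show "triple (Assign cnt (Lit 0) ;; While (Less (Reg pw) (Reg src)) ?body) R1 M (clog x * 20 + 10) (?I (clog x))"
  proof (rule triple_Assign_Seq[where k = "clog x * 20 + 4"])
    fix R2 assume 2: "R2 = R1(cnt := ev R1 M (Lit 0))"
    show "triple (While (Less (Reg pw) (Reg src)) ?body) R2 M (clog x * 20 + 4) (?I (clog x))"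
    proof (rule triple_While[where I = ?I and n = "clog x" and kb = 10])
      show "?I 0 R2 M" using 1 2 d by auto
    next
      fix m R' M' assume m: "m < clog x" and I: "?I m R' M'"
      have lt: "2 ^ m < x" using pow_less_of_less_clog[OF m] .
      have "m < 2 ^ m" by (rule less_exp)
      then have "Suc m \<le> Z" "2 * 2 ^ m \<le> Z" using lt x(3) by linarith+
      then have "triple ?body R' M' 10 (?I (Suc m))"
        by (intro triple_loopfree) (use q I d in auto)
      moreover have "R' src = x" using I d x(1) by auto
      ultimately show "ev R' M' (Less (Reg pw) (Reg src)) \<noteq> 0 \<and> triple ?body R' M' 10 (?I (Suc m))"
        using I lt by simp
    next
      fix R' M' assume I: "?I (clog x) R' M'"
      then have "R' src = x" using d x(1) by auto
      then show "ev R' M' (Less (Reg pw) (Reg src)) = 0" using I le_pow_clog[of x] by simp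
    qed (use q in simp_all)
  qed (use q in simp_all)
qed (use q Z2 in simp_all)

lemma triple_power:
  assumes q: "2 < q" and d: "distinct [dst, src, 45]" and x: "R src = x" "2 ^ x \<le> Z"
  shows "triple (power_com dst src) R M (x * 20 + 20)
    (\<lambda>R' M'. M' = M \<and> R' dst = 2 ^ x \<and> same_except {dst, 45} R' R)"
  unfolding power_com_def
proof (rule triple_Assign_Seq[where k = "x * 20 + 10"])
  fix R1 assume 1: "R1 = R(dst := ev R M (Lit 1))"
  show "triple (for_loop 45 src (Assign dst (Times (Reg dst) (Lit 2)))) R1 M (x * 20 + 10)
     (\<lambda>R' M'. M' = M \<and> R' dst = 2 ^ x \<and> same_except {dst, 45} R' R)"
  proof (rule triple_for[where n = x and kb = 4 and
        I = "\<lambda>m R' M'. M' = M \<and> R' dst = 2 ^ m \<and> same_except {dst, 45} R' R"])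
    fix m R' M' assume m: "m < x" "R' 45 = m" and I: "M' = M \<and> R' dst = 2 ^ m \<and> same_except {dst, 45} R' R"
    have "(2 :: nat) ^ Suc m \<le> 2 ^ x" using m(1) by (intro power_increasing) auto
    then have "2 * 2 ^ m \<le> Z" using x(2) by simp
    then show "triple (Assign dst (Times (Reg dst) (Lit 2))) R' M' 4 (\<lambda>R' M'. R' 45 = m \<and> M' = M \<and> (R'(45 := Suc m)) dst = 2 ^ Suc m
       \<and> same_except {dst, 45} (R'(45 := Suc m)) R)"
      by (intro triple_loopfree) (use q I d m in auto)
  next
    show "x \<le> Z" using x(2) less_exp[of x] by linarith
  qed (use 1 d q x in auto)
qed (use q Z2 in simp_all)

lemma triple_trial_division:
  assumes q: "2 < q" and R: "R 10 = y" "R 46 = 1" "R 47 = 2" "2 \<le> y" "y \<le> Z"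
  shows "triple (While (Less (Reg 47) (Reg 10))
          (If (Mod (Reg 10) (Reg 47)) Skip (Assign 46 (Lit 0)) ;; Assign 47 (Plus (Reg 47) (Lit 1)))) R M (y * 20 + 10)
    (\<lambda>R' M'. M' = M \<and> R' 46 = of_bool (prime y) \<and> same_except {46, 47} R' R)"
  (is "triple (While ?b ?body) R M _ _")
proof -
  let ?I = "\<lambda>m R' M'. M' = M \<and> R' 47 = m + 2 \<and> R' 46 = of_bool (\<forall>e\<in>{2..<m + 2}. \<not> e dvd y)
    \<and> same_except {46, 47} R' R"
  show ?thesis
  proof (rule triple_conseq[OF triple_While[where n = "y - 2" and kb = 14 and I = ?I]])
    fix m R1 M1 assume m: "m < y - 2" "bnd R1 M1" and I: "?I m R1 M1"
    have 10: "R1 10 = y" using I R by simp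
    have "{2..<Suc m + 2} = insert (m + 2) {2..<m + 2}" by auto
    then have S: "(\<forall>e\<in>{2..<Suc m + 2}. \<not> e dvd y) \<longleftrightarrow> (\<forall>e\<in>{2..<m + 2}. \<not> e dvd y) \<and> \<not> m + 2 dvd y"
      by auto
    have "triple ?body R1 M1 14 (?I (Suc m))"
      unfolding S by (rule triple_loopfree) (use q I 10 m R in \<open>auto simp: dvd_eq_mod_eq_0\<close>)
    then show "ev R1 M1 ?b \<noteq> 0 \<and> triple ?body R1 M1 14 (?I (Suc m))"
      using m I 10 by simp
  next
    fix R' M' assume I: "?I (y - 2) R' M'"
    have "y - 2 + 2 = y" using R by simp
    then have "prime y \<longleftrightarrow> (\<forall>e\<in>{2..<y - 2 + 2}. \<not> e dvd y)"
      using R(4) unfolding prime_nat_iff' by simp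
    then show "M' = M \<and> R' 46 = of_bool (prime y) \<and> same_except {46, 47} R' R" using I by simp
  qed (use R q in auto)
qed

text \<open>Since no prime lies between \<open>x\<close> and \<open>field_size x\<close>, the
  primality flag says exactly that the target is reached, and the number of iterations is known in
  advance.\<close>

lemma triple_prime:
  assumes q: "2 < q" and x: "R 10 = x - 1" "7 \<le> x" and Z: "2 * field_size x \<le> Z"
  shows "triple prime_com R M (field_size x * (field_size x * 20 + 40) + 20)
    (\<lambda>R' M'. M' = M \<and> R' 10 = field_size x \<and> same_except {10, 46, 47} R' R)"
  unfolding prime_com_def
proof (rule triple_Assign_Seq[where k = "field_size x * (field_size x * 20 + 40) + 10"])
  let ?p = "field_size x"
  let ?I = "\<lambda>m R' M'. M' = M \<and> R' 10 = x - 1 + m \<and> R' 46 = of_bool (x - 1 + m = ?p) \<and> same_except {10, 46, 47} R' R"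
  let ?inner = "While (Less (Reg 47) (Reg 10))
          (If (Mod (Reg 10) (Reg 47)) Skip (Assign 46 (Lit 0)) ;; Assign 47 (Plus (Reg 47) (Lit 1)))"
  let ?body = "Assign 10 (Plus (Reg 10) (Lit 1)) ;; Assign 46 (Lit 1) ;; Assign 47 (Lit 2) ;; ?inner"
  note p = field_size[OF x(2)]
  fix R1 assume 1: "R1 = R(46 := ev R M (Lit 0))"
  show "triple (While (Minus (Lit 1) (Reg 46)) ?body) R1 M (?p * (?p * 20 + 40) + 10)
    (\<lambda>R' M'. M' = M \<and> R' 10 = ?p \<and> same_except {10, 46, 47} R' R)"
  proof (rule triple_conseq[OF triple_While[where I = ?I and n = "?p - (x - 1)" and kb = "?p * 20 + 30"]])
    show "?I 0 R1 M" using 1 x p by auto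
  next
    fix m R2 M2 assume m: "m < ?p - (x - 1)" "bnd R2 M2" and I: "?I m R2 M2"
    let ?y = "x - 1 + Suc m"
    have y: "?y \<le> ?p" "x \<le> ?y" "2 \<le> ?y" "?y \<le> Z" using m x Z by linarith+
    have pr: "prime ?y \<longleftrightarrow> ?y = ?p"
      using not_prime_below_field_size[OF y(2)] p(1) y(1) by (metis le_neq_implies_less)
    have "triple ?body R2 M2 (?p * 20 + 30) (?I (Suc m))"
      apply (rule triple_Assign_Seq[where k = "?p * 20 + 20"]; (use q I y in \<open>simp; fail\<close>)?)
      apply (rule triple_Assign_Seq[where k = "?p * 20 + 15"]; (use q Z2 in \<open>simp; fail\<close>)?)
      apply (rule triple_Assign_Seq[where k = "?p * 20 + 10"]; (use q Z2 in \<open>simp; fail\<close>)?)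
      subgoal for R3 R4 R5
        apply (rule triple_conseq[OF triple_trial_division[where y = ?y]])
        using q y I pr by auto
      done
    moreover have "ev R2 M2 (Minus (Lit 1) (Reg 46)) \<noteq> 0" using I m by simp
    ultimately show "ev R2 M2 (Minus (Lit 1) (Reg 46)) \<noteq> 0 \<and> triple ?body R2 M2 (?p * 20 + 30) (?I (Suc m))" by blast
  next
    show "(?p - (x - 1)) * (?p * 20 + 30 + cost (Minus (Lit 1) (Reg 46)) + 1) + cost (Minus (Lit 1) (Reg 46)) + 1
      \<le> ?p * (?p * 20 + 40) + 10"
    proof -
      have "(?p - (x - 1)) * (34 + ?p * 20) \<le> ?p * (?p * 20 + 40)" by (intro mult_mono) auto
      then show ?thesis by simp
    qed
  qed (use q p in auto)
qed (use q in simp_all)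

end

definition program :: com where
  "program = setup_com ;; tensors_com"

locale reduction_machine = machine +
  fixes T E :: nat
  assumes parameters: "S = T - 1" "1 \<le> T" "1 \<le> W" "L = clog (Suc T)" "wb = clog W"
      "p = field_size (field_bound n E)" "K = clog p" "t = 2 * K * (4 * (n * (n + 1)) + 1)" "D = 2 ^ t"
      "eb = S + 5" "sb = eb + 2 * S * (W * W)" "rb = sb + 2 * N * h"
    and large: "2 * (T + 1) \<le> Z" "2 * W \<le> Z" "2 * p \<le> Z" "rb + n \<le> Z"
begin

lemma triple_setup:
  assumes M: "M 0 div 2 = h" "M (Suc 0) = T" "M 2 = W" "M 3 = N" "M 4 = E"
  shows "triple setup_com R M ((L + wb + K + t + n) * 20 + p * (p * 20 + 40) + 300) (\<lambda>R' M'. M' = M \<and> env R')"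
proof (rule triple_bnd)
  assume bnd: "bnd R M"
  then have b: "M a \<le> Z" for a by (simp add: bnd_def)
  have q2: "2 < q" using q by simp
  have xp: "field_bound n E - 1 = 4 * (n * (n + 1)) * E + 7" "7 \<le> field_bound n E" by (simp_all add: field_bound_def)
  have xZ: "4 * (n * (n + 1)) * E + 7 \<le> Z"
    using field_size(2)[OF xp(2)] large(3) parameters(6) xp(1) by linarith
  have sizes: "h \<le> Z" "Suc T \<le> Z" "T - Suc 0 \<le> Z" "W \<le> Z" "N \<le> Z" "E \<le> Z" "n \<le> Z" "n * Suc n \<le> Z" "n * (n + 1) \<le> Z" "t \<le> Z"
     "eb \<le> Z" "sb \<le> Z" "rb \<le> Z" "rb + n \<le> Z" "2 * N \<le> Z"
    using Z large b[of 4] M(5) parameters(10,11,12) by auto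
  let ?h = "\<lambda>R1 M1. M1 = M \<and> R1 5 = h \<and> R1 43 = Suc T \<and> R1 2 = S \<and> R1 3 = W \<and> R1 4 = N \<and> R1 42 = E"
  let ?s = "\<lambda>R0 R1 M1. M1 = M \<and> R1 9 = n \<and> R1 19 = n * (n + 1) \<and> R1 10 = field_bound n E - 1 \<and> same_except {9, 19, 10} R1 R0"
  show "triple setup_com R M ((L + wb + K + t + n) * 20 + p * (p * 20 + 40) + 300) (\<lambda>R' M'. M' = M \<and> env R')"
    unfolding setup_com_def
    apply (rule triple_Seq[where ?k1.0 = 40 and ?Q1.0 = ?h and ?k2.0 = "(L + wb + K + t + n) * 20 + p * (p * 20 + 40) + 250"])
      apply (rule triple_loopfree)
    subgoal using q by (simp add: header_com_def)
    subgoal using M b sizes parameters by (simp add: header_com_def)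
      apply (simp add: header_com_def)
    subgoal for R1 M1
      apply (rule triple_Seq[OF triple_clog[OF q2], where ?k2.0 = "(wb + K + t + n) * 20 + p * (p * 20 + 40) + 220"])
          apply simp
         apply (erule conjE)+ apply assumption
        apply simp
      subgoal using large by simp
      subgoal for R2 M2
        apply (rule triple_Seq[OF triple_clog[OF q2, of _ _ _ _ W], where ?k2.0 = "(K + t + n) * 20 + p * (p * 20 + 40) + 200"])
            apply simp
           apply simp
        subgoal using parameters by simp
        subgoal using large by simp
        subgoal for R3 M3
          apply (rule triple_Seq[where ?k1.0 = 30 and ?Q1.0 = "?s R3" and ?k2.0 = "(K + t + n) * 20 + p * (p * 20 + 40) + 160"])
            apply (rule triple_loopfree)
          subgoal using q by (simp add: size_com_def)
          subgoal using sizes n parameters xp xZ by (simp add: size_com_def)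
            apply (simp add: size_com_def)
          subgoal for R4 M4
            apply (rule triple_Seq[OF triple_prime[OF q2 _ xp(2)], where ?k2.0 = "(K + t + n) * 20 + 140"])
               apply simp
            subgoal using large parameters by simp
            subgoal for R5 M5
              apply (rule triple_Seq[OF triple_clog[OF q2, of _ _ _ _ p], where ?k2.0 = "(t + n) * 20 + 120"])
                  apply simp
              subgoal using parameters by simp
              subgoal using p by simp
              subgoal using large by simp
              subgoal for R6 M6
                apply (rule triple_Seq[where ?k1.0 = 20 and ?Q1.0 = "\<lambda>R7 M7. M7 = M \<and> R7 = R6(12 := t)" and ?k2.0 = "(t + n) * 20 + 100"])
                  apply (rule triple_loopfree)
                subgoal using q by simp
                subgoal using sizes parameters by simp
                  apply simp
                subgoal for R7 M7
                  apply (rule triple_Seq[OF triple_power[OF q2, of _ _ _ t], where ?k2.0 = "n * 20 + 80"])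
                     apply simp
                    apply simp
                  subgoal using Z parameters by simp
                  subgoal for R8 M8
                    apply (rule triple_Seq[OF triple_power[OF q2, of _ _ _ n], where ?k2.0 = "60"])
                       apply simp
                      apply simp
                    subgoal using Z parameters by simp
                    subgoal premises prems for R9 M9
                    proof -
                      have r: "R9 2 = S" "R9 3 = W" "R9 4 = N" "R9 5 = h" "R9 6 = L" "R9 7 = wb" "R9 8 = 2 ^ wb" "R9 9 = n"
                        "R9 10 = p" "R9 11 = K" "R9 12 = t" "R9 13 = D" "R9 14 = 2 ^ n" "R9 19 = n * (n + 1)" "M9 = M"
                        using prems parameters by simp_all
                      have a: "S + 5 = eb" "eb + 2 * S * (W * W) = sb" "sb + 2 * N * h = rb" using parameters by simp_all
                      show ?thesis
                        by (rule triple_loopfree) (use q sizes in \<open>simp_all add: address_com_def env_def r a\<close>)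
                    qed
                    apply simp
                    done
                  apply simp
                  done
                apply simp
                done
              using parameters apply simp
              done
            using parameters apply simp
            done
          apply simp
          done
        using parameters apply simp
        done
      using parameters apply simp
      done
    apply simp
    done
qed

end

text \<open>As \<open>t\<close> is at least \<open>n * (n + 1)\<close> and at least
  \<open>K\<close>, even the exponential quantities \<open>2 ^ n\<close> and \<open>2 ^ K\<close>
  are at most \<open>D\<close>. This is why brute force is polynomial in \<open>D\<close>.\<close>

lemma tensor_dim_bounds:
  assumes n: "n = L * (wb + 1)" and L: "L = clog (Suc T)" and T: "1 \<le> T" and p: "1 < p" "p \<le> 2 ^ K"
    and t: "t = 2 * K * (4 * (n * (n + 1)) + 1)" and D: "D = 2 ^ t"
  shows "0 < n" "L \<le> n" "wb \<le> n" "n \<le> D" "n * (n + 1) \<le> D" "K \<le> D" "p \<le> D" "t \<le> D" "2 ^ n \<le> D"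
    "2 ^ K \<le> D" "2 ^ L \<le> D"
proof -
  have L1: "1 \<le> L" using le_pow_clog[of "Suc T"] T L by (cases L) auto
  then show n0: "0 < n" using n by simp
  show Ln: "L \<le> n" using n by simp
  have "1 * wb \<le> L * (wb + 1)" using L1 by (intro mult_mono) auto
  then show "wb \<le> n" using n by simp
  have K1: "1 \<le> K" using p by (cases K) auto
  have "2 * 1 * (4 * (n * (n + 1)) + 1) \<le> t" unfolding t using K1 by (intro mult_mono) auto
  then have nt: "n * (n + 1) \<le> t" by simp
  have "2 * K * 1 \<le> t" unfolding t by (intro mult_mono) auto
  then have Kt: "K \<le> t" by simp
  have "t < D" unfolding D by (rule less_exp)
  then show tD: "t \<le> D" by simp
  show "n * (n + 1) \<le> D" using nt tD by simp
  have nt': "n \<le> t" using nt by (metis le_add2 le_trans mult.right_neutral mult_le_mono2)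
  then show "n \<le> D" using tD by simp
  show "K \<le> D" using Kt tD by simp
  show KD: "2 ^ K \<le> D" unfolding D using Kt by (intro power_increasing) auto
  with p(2) show "p \<le> D" by (rule order_trans)
  show "2 ^ n \<le> D" unfolding D using nt' by (intro power_increasing) auto
  show "2 ^ L \<le> D" unfolding D using nt' Ln by (intro power_increasing) auto
qed

section \<open>Running time of the program\<close>

context reduction_machine begin

lemmas size_bounds = tensor_dim_bounds[OF n parameters(4,2) p parameters(8,9)]

text \<open>The constant is \<open>20 + 308 + 22 + 280 + 208\<close>, the coefficients of the
  summands of \<open>entry_time\<close> with 8 added to the last.\<close>

lemma entry_time_le: "entry_time + 8 \<le> 838 * (D * D)"
proof -
  note s = size_bounds
  have D1: "1 \<le> D * D" "D \<le> D * D" using D by simp_all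
  have "K * 88 + 220 \<le> 308 * D" using s(6) D by simp
  then have "n * (n + 1) * (K * 88 + 220) \<le> D * (308 * D)" by (rule mult_le_mono[OF s(5)])
  moreover have "L * 40 + n * 40 + 200 \<le> 280 * D" using s(2,4) D by simp
  then have "2 ^ n * (L * 40 + n * 40 + 200) \<le> D * (280 * D)" by (rule mult_le_mono[OF s(9)])
  moreover have "D * (308 * D) = 308 * (D * D)" "D * (280 * D) = 280 * (D * D)" by simp_all
  ultimately show ?thesis unfolding entry_time_def using s(4,6) D1 by linarith
qed

text \<open>One factor \<open>D\<close> counts the entries of a tensor and \<open>D * D\<close>
  bounds the time for each. The prime search takes a multiple of \<open>D * D\<close> only. The
  coefficients 100, 60, 1704 and 320 add up to less than 3000.\<close>

lemma program_time_le:
  assumes "1 \<le> N"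
  shows "((L + wb + K + t + n) * 20 + p * (p * 20 + 40) + 300) + (2 * N * (D * (entry_time + 8) + 14) + 20)
    \<le> 3000 * N * D ^ 3"
proof -
  note s = size_bounds
  let ?X = "N * (D * D * D)"
  have D3: "D * D * D = D ^ 3" by (simp add: power3_eq_cube)
  have "1 * 1 \<le> D * D" using D by (intro mult_mono) auto
  then have "1 * D \<le> D * D * D" using D by (intro mult_mono) auto
  then have "1 * D \<le> N * (D * D * D)" using assms by (metis mult_le_mono nat_mult_1)
  then have DX: "D \<le> ?X" by simp
  have X1: "1 \<le> ?X" using DX D by simp
  have "1 * (D * D) \<le> D * (D * D)" using D by (intro mult_mono) auto
  then have "1 * (D * D) \<le> N * (D * (D * D))" using assms by (metis mult_le_mono nat_mult_1)
  then have DDX: "D * D \<le> ?X" by (simp add: mult.assoc)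
  have "(L + wb + K + t + n) * 20 \<le> 100 * D" using s by simp
  also have "\<dots> \<le> 100 * ?X" using DX by simp
  finally have a: "(L + wb + K + t + n) * 20 \<le> 100 * ?X" .
  have "p * 20 + 40 \<le> 60 * D" using s(7) D by simp
  then have "p * (p * 20 + 40) \<le> D * (60 * D)" by (rule mult_le_mono[OF s(7)])
  also have "\<dots> \<le> 60 * ?X" using DDX by simp
  finally have b: "p * (p * 20 + 40) \<le> 60 * ?X" .
  have "D * (entry_time + 8) \<le> D * (838 * (D * D))" using entry_time_le by (rule mult_le_mono2)
  then have "D * (entry_time + 8) + 14 \<le> 838 * (D * D * D) + 14 * (D * D * D)"
    using D by (intro add_mono) (auto simp: mult.assoc)
  then have "D * (entry_time + 8) + 14 \<le> 852 * (D * D * D)" by simp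
  then have "2 * N * (D * (entry_time + 8) + 14) \<le> 2 * N * (852 * (D * D * D))" by (rule mult_le_mono2)
  then have c: "2 * N * (D * (entry_time + 8) + 14) \<le> 1704 * ?X" by simp
  have "((L + wb + K + t + n) * 20 + p * (p * 20 + 40) + 300) + (2 * N * (D * (entry_time + 8) + 14) + 20) \<le> 3000 * ?X"
    using a b c X1 by linarith
  then show ?thesis unfolding D3 by simp
qed

lemma triple_program:
  assumes "M 0 div 2 = h" "M (Suc 0) = T" "M 2 = W" "M 3 = N" "M 4 = E" "input_mem M" "1 \<le> N"
  shows "triple program R M (3000 * N * D ^ 3)
    (\<lambda>R' M'. M' (R' 0) = t \<and> M' (R' 0 + 1) = N
      \<and> (\<forall>x<2 * N * D. M' (R' 0 + 2 + x) = of_bool (entry (x div D) (x mod D))))"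
  unfolding program_def
proof (rule triple_Seq[OF triple_setup[OF assms(1-5)] _ program_time_le[OF assms(7)]])
  fix R1 M1 assume 1: "M1 = M \<and> env R1"
  show "triple tensors_com R1 M1 (2 * N * (D * (entry_time + 8) + 14) + 20)
    (\<lambda>R' M'. M' (R' 0) = t \<and> M' (R' 0 + 1) = N
      \<and> (\<forall>x<2 * N * D. M' (R' 0 + 2 + x) = of_bool (entry (x div D) (x mod D))))"
    by (rule triple_conseq[OF triple_tensors order_refl]) (use 1 assms(6) in auto)
qed

end

section \<open>Layout of the input and the output\<close>

lemma nth_concat_uniform:
  "(\<And>xs. xs \<in> set xss \<Longrightarrow> length xs = m) \<Longrightarrow> i < length xss \<Longrightarrow> j < m \<Longrightarrow>
     concat xss ! (i * m + j) = xss ! i ! j"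
proof (induction xss arbitrary: i)
  case (Cons xs xss)
  then show ?case by (cases i) (auto simp: nth_append)
qed simp

lemma length_concat_uniform:
  "(\<And>xs. xs \<in> set xss \<Longrightarrow> length xs = m) \<Longrightarrow> length (concat xss) = length xss * m"
  by (induction xss) auto

lemma concat_rows: "concat (map (\<lambda>i. map (f i) [0..<D]) [0..<m]) = map (\<lambda>x. f (x div D) (x mod D)) [0..<m * D]"
proof (induction m)
  case (Suc m)
  have "[0..<Suc m * D] = [0..<m * D] @ map (\<lambda>x. m * D + x) [0..<D]"
    by (rule nth_equalityI) (auto simp: nth_append)
  then show ?case using Suc by (auto simp: o_def)
qed simp

lemma bp_pair_code_rows:
  obtains pre where "bp_pair_code \<epsilon> P N A B = pre @ concat (map bits_code (A @ B))"
    "length pre = bp_length P - 1 + 5 + 2 * (bp_length P - 1) * (bp_width P * bp_width P)"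
proof -
  define pre where "pre = [bp_inputs P, bp_length P, bp_width P, N, nat \<lceil>1 / \<epsilon>\<rceil>]
     @ map (bp_label P) [0 ..< bp_length P - 1]
     @ [of_bool ((i, j, b, k) \<in> bp_edges P).
          i \<leftarrow> [0 ..< bp_length P - 1], j \<leftarrow> [0 ..< bp_width P],
          b \<leftarrow> [False, True], k \<leftarrow> [0 ..< bp_width P]]"
  have "length pre = bp_length P - 1 + 5 + 2 * (bp_length P - 1) * (bp_width P * bp_width P)"
    by (simp add: pre_def length_concat o_def sum_list_triv)
  moreover have "bp_pair_code \<epsilon> P N A B = pre @ concat (map bits_code (A @ B))"
    by (simp add: bp_pair_code_def pre_def)
  ultimately show ?thesis using that by blast
qed

lemma bp_pair_code_length:
  assumes "bp_pair_instance P N A B"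
  shows "length (bp_pair_code \<epsilon> P N A B) = (bp_length P - 1 + 5) + 2 * (bp_length P - 1) * (bp_width P * bp_width P)
     + 2 * N * (bp_inputs P div 2)"
proof -
  obtain pre where pre: "bp_pair_code \<epsilon> P N A B = pre @ concat (map bits_code (A @ B))"
    "length pre = bp_length P - 1 + 5 + 2 * (bp_length P - 1) * (bp_width P * bp_width P)"
    by (rule bp_pair_code_rows)
  have "length (concat (map bits_code (A @ B))) = length (map bits_code (A @ B)) * (bp_inputs P div 2)"
    by (rule length_concat_uniform) (use assms in \<open>auto simp: bp_pair_instance_def bits_code_def\<close>)
  moreover have "length (A @ B) = 2 * N" using assms by (simp add: bp_pair_instance_def)
  ultimately show ?thesis using pre by (simp only: length_append length_map)
qed

lemma bp_pair_code_label:
  "s < bp_length P - 1 \<Longrightarrow> bp_pair_code \<epsilon> P N A B ! (5 + s) = bp_label P s"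
  by (simp add: bp_pair_code_def nth_append nth_Cons')

text \<open>The comprehension is rewritten as nested concatenations of equally long lists, so that
  the address can be resolved one level at a time.\<close>

lemma bp_pair_code_edge:
  assumes "s < bp_length P - 1" "j < bp_width P" "k < bp_width P"
  shows "bp_pair_code \<epsilon> P N A B ! (bp_length P - 1 + 5 + (((s * bp_width P + j) * 2 + of_bool \<beta>) * bp_width P + k))
    = of_bool ((s, j, \<beta>, k) \<in> bp_edges P)"
proof -
  let ?W = "bp_width P" and ?S = "bp_length P - 1"
  define f where "f i j b = map (\<lambda>k. of_bool ((i, j, b, k) \<in> bp_edges P) :: nat) [0..<?W]" for i j b
  define g where "g i j = concat (map (f i j) [False, True])" for i j
  define h where "h i = concat (map (g i) [0..<?W])" for i
  let ?H = "concat (map h [0..<?S])"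
  have lf: "length (f i j b) = ?W" for i j b by (simp add: f_def)
  have lg: "length (g i j) = 2 * ?W" for i j by (simp add: g_def lf)
  have lh: "length (h i) = ?W * (2 * ?W)" for i
    unfolding h_def by (subst length_concat_uniform[where m = "2 * ?W"]) (auto simp: lg)
  have lH: "length ?H = ?S * (?W * (2 * ?W))" by (subst length_concat_uniform[where m = "?W * (2 * ?W)"]) (auto simp: lh)
  let ?a = "of_bool \<beta> * ?W + k" and ?i = "((s * ?W + j) * 2 + of_bool \<beta>) * ?W + k"
  have a: "?a < 2 * ?W" using assms(3) by (cases \<beta>) auto
  have "j * (2 * ?W) + ?a < Suc j * (2 * ?W)" using a by simp
  also have "\<dots> \<le> ?W * (2 * ?W)" using assms(2) by (intro mult_le_mono1) simp
  finally have b: "j * (2 * ?W) + ?a < ?W * (2 * ?W)" .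
  have i: "?i = s * (?W * (2 * ?W)) + (j * (2 * ?W) + ?a)" by (simp add: algebra_simps)
  have "?H ! ?i = h s ! (j * (2 * ?W) + ?a)"
    unfolding i using assms(1) b by (subst nth_concat_uniform) (auto simp: lh)
  also have "\<dots> = g s j ! ?a"
    unfolding h_def using assms(2) a by (subst nth_concat_uniform) (auto simp: lg)
  also have "\<dots> = of_bool ((s, j, \<beta>, k) \<in> bp_edges P)"
    unfolding g_def using assms(3) by (subst nth_concat_uniform[where m = ?W]) (auto simp: lf f_def)
  finally have H: "?H ! ?i = of_bool ((s, j, \<beta>, k) \<in> bp_edges P)" .
  have "?i < length ?H"
  proof -
    have "?i < Suc s * (?W * (2 * ?W))" unfolding i using b by simp
    also have "\<dots> \<le> ?S * (?W * (2 * ?W))" using assms(1) by (intro mult_le_mono1) simp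
    finally show ?thesis unfolding lH .
  qed
  moreover have "bp_pair_code \<epsilon> P N A B = ([bp_inputs P, bp_length P, bp_width P, N, nat \<lceil>1 / \<epsilon>\<rceil>]
     @ map (bp_label P) [0 ..< bp_length P - 1]) @ ?H @ concat (map bits_code A) @ concat (map bits_code B)"
    unfolding bp_pair_code_def h_def g_def f_def by (simp only: append_assoc)
  moreover have "length ([bp_inputs P, bp_length P, bp_width P, N, nat \<lceil>1 / \<epsilon>\<rceil>] @ map (bp_label P) [0 ..< bp_length P - 1]) = ?S + 5"
    by simp
  ultimately show ?thesis using H by (metis nth_append nth_append_length_plus)
qed

lemma bp_pair_code_row:
  assumes "bp_pair_instance P N A B" "i < 2 * N" "l < bp_inputs P div 2"
  shows "bp_pair_code \<epsilon> P N A B ! (bp_length P - 1 + 5 + 2 * (bp_length P - 1) * (bp_width P * bp_width P)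
      + (i * (bp_inputs P div 2) + l)) = of_bool ((A @ B) ! i ! l)"
proof -
  obtain pre where pre: "bp_pair_code \<epsilon> P N A B = pre @ concat (map bits_code (A @ B))"
    and len: "length pre = bp_length P - 1 + 5 + 2 * (bp_length P - 1) * (bp_width P * bp_width P)"
    by (rule bp_pair_code_rows)
  have inst: "length (A @ B) = 2 * N" "\<And>x. x \<in> set (A @ B) \<Longrightarrow> length x = bp_inputs P div 2"
    using assms(1) by (auto simp: bp_pair_instance_def)
  from pre have "bp_pair_code \<epsilon> P N A B ! (length pre + (i * (bp_inputs P div 2) + l))
      = concat (map bits_code (A @ B)) ! (i * (bp_inputs P div 2) + l)" by (simp only: nth_append_length_plus)
  also have "\<dots> = map bits_code (A @ B) ! i ! l"
    by (rule nth_concat_uniform) (use inst assms in \<open>auto simp: bits_code_def\<close>)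
  also have "\<dots> = of_bool ((A @ B) ! i ! l)"
  proof -
    have "length ((A @ B) ! i) = bp_inputs P div 2" using inst assms(2) by (metis nth_mem)
    then show ?thesis using inst(1) assms(2,3) by (simp only: nth_map bits_code_def)
  qed
  finally show ?thesis by (simp only: len)
qed

section \<open>The protocol for branching programs\<close>

text \<open>Merlin's \<alpha> cancels: the first check makes \<open>?X\<close> congruent to \<alpha>
  and the second makes \<open>?Y\<close> plus \<alpha> congruent to \<open>v\<close>, so
  \<open>?X + ?Y\<close> is congruent to \<open>v\<close>.\<close>

lemma row_check_sound:
  assumes "\<not> claim p (multilinear n (\<lambda>A. of_bool (F A) + of_bool (G A))) r v"
  shows "\<not> (row_check p K n False F r v I \<and> row_check p K n True G r v I)"
proof
  let ?X = "multilinear n (\<lambda>A. of_bool (F A)) (\<lambda>i. int (r i))"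
  let ?Y = "multilinear n (\<lambda>A. of_bool (G A)) (\<lambda>i. int (r i))"
  assume "row_check p K n False F r v I \<and> row_check p K n True G r v I"
  then have *: "?X mod int p = int (block 2 I K mod p)" "(?Y mod int p + int (block 2 I K mod p)) mod int p = int v"
    by (simp_all add: row_check_def Let_def)
  from *(2) have "(?X + ?Y) mod int p = int v" unfolding *(1)[symmetric] by (simp add: mod_simps add.commute)
  then have "[?X + ?Y = int v] (mod int p)" by (metis cong_def mod_mod_trivial)
  then show False using assms by (simp add: claim_def multilinear_add)
qed

lemma row_check_complete:
  assumes p: "0 < p" "p \<le> 2 ^ K" and v: "v < p"
    and c: "claim p (multilinear n (\<lambda>A. of_bool (F A) + of_bool (G A))) r v"
  shows "1 \<le> trop_val (2 * K) (\<lambda>I. of_bool (row_check p K n False F r v I \<and> row_check p K n True G r v I))"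
proof -
  let ?X = "multilinear n (\<lambda>A. of_bool (F A)) (\<lambda>i. int (r i))"
  let ?Y = "multilinear n (\<lambda>A. of_bool (G A)) (\<lambda>i. int (r i))"
  \<comment> \<open>Merlin's honest \<alpha>: the part of the value that belongs to the first
    tensor.\<close>
  define x where "x = nat (?X mod int p)"
  define H where "H y I = (of_bool (?X mod int p = int (y mod p) \<and> (?Y mod int p + int (y mod p)) mod int p = int v) :: real)" for y I :: nat
  have x: "int x = ?X mod int p" "x < p" using p(1) by (simp_all add: x_def nat_less_iff)
  have "[?X + ?Y = int v] (mod int p)" using c by (simp add: claim_def multilinear_add)
  then have "(?Y mod int p + ?X mod int p) mod int p = int v"
    using v by (simp add: cong_def mod_simps add.commute)
  then have "1 \<le> trop_val 0 (H x)" using x by (simp add: H_def)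
  then have "1 \<le> trop_val (2 * K + 0) (\<lambda>I. H (block 2 I K) (I div 4 ^ K))"
    using x(2) p(2) by (intro trop_val_le_max[of x]) auto
  then show ?thesis by (simp add: H_def row_check_def Let_def)
qed

text \<open>The initial claim is that the formula has value 0. It is false when a walk exists, so
  reachability gives the small value and unreachability the value 1.\<close>

lemma protocol_value:
  fixes w L n K p :: nat
  assumes n: "n = L * (w + 1)" and p: "prime p" "p \<le> 2 ^ K"
    and FG: "\<And>A. of_bool (F A) + of_bool (G A) = (of_bool (case decode w A L of (s, j, k) \<Rightarrow> e s j k) :: int)"
  defines "g \<equiv> \<lambda>I. of_bool (transcript_ok p K (row_check p K n False F) (qbf_ops w n 0) (\<lambda>_. 0) 0 I
      \<and> transcript_ok p K (row_check p K n True G) (qbf_ops w n 0) (\<lambda>_. 0) 0 I) :: real"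
  shows "reach e w L 0 0 0 \<Longrightarrow> trop_val (2 * K * (4 * (n * (n + 1)) + 1)) g \<le> real (n * (n + 1)) * (4 / real p)"
    and "\<not> reach e w L 0 0 0 \<Longrightarrow> trop_val (2 * K * (4 * (n * (n + 1)) + 1)) g = 1"
proof -
  let ?ops = "qbf_ops w n 0"
  define Fe where "Fe A \<longleftrightarrow> (case decode w A L of (s, j, k) \<Rightarrow> e s j k)" for A
  define f where "f = multilinear n (\<lambda>A. of_bool (F A) + of_bool (G A))"
  define fin where "fin r v I \<longleftrightarrow> row_check p K n False F r v I \<and> row_check p K n True G r v I" for r v I
  have g: "g = (\<lambda>I. of_bool (transcript_ok p K fin ?ops (\<lambda>_. 0) 0 I))"
    unfolding g_def fin_def transcript_ok_conj ..
  have p1: "1 < p" using prime_gt_1_nat[OF p(1)] .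
  have t: "2 * K * (4 * (n * (n + 1)) + 1) = 8 * K * length ?ops + 2 * K"
    by (simp add: length_qbf_ops)
  have deg: "degree_bounded ?ops f" using qbf_ops_degree[of n f 0 w] linear_multilinear by (simp add: f_def)
  have fe: "f r = of_bool (Fe (point_num n r))" if "\<forall>i. r i \<in> {0, 1}" for r
    unfolding f_def multilinear_bool[OF that] Fe_def FG ..
  have "apply_ops ?ops f (\<lambda>_. 0) = of_bool (qbf_val w Fe (n - 0) 0 (point_num 0 (\<lambda>_. 0)))"
    by (rule apply_qbf_ops[where F = Fe], rule fe) auto
  also have "qbf_val w Fe (n - 0) 0 (point_num 0 (\<lambda>_. 0)) = reach e w L 0 0 0"
    using qbf_val_reach[of 0 L 0 w e] unfolding Fe_def n by simp
  finally have val: "apply_ops ?ops f (\<lambda>_. 0) = of_bool (reach e w L 0 0 0)" .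
  show "trop_val (2 * K * (4 * (n * (n + 1)) + 1)) g \<le> real (n * (n + 1)) * (4 / real p)" if "reach e w L 0 0 0"
  proof -
    have "\<not> claim p (apply_ops ?ops f) (\<lambda>_. 0) 0"
      using val that p1 by (simp add: claim_def cong_def)
    moreover have "\<not> fin r v I" if "\<not> claim p f r v" for r v I
      using row_check_sound that unfolding f_def fin_def by blast
    ultimately have "trop_val (8 * K * length ?ops + 2 * K) (\<lambda>I. of_bool (transcript_ok p K fin ?ops (\<lambda>_. 0) 0 I))
       \<le> real (length ?ops) * (4 / real p)"
      using p1 by (intro protocol_sound[OF p _ deg]) auto
    then show ?thesis unfolding g t by (simp only: length_qbf_ops)
  qed
  show "trop_val (2 * K * (4 * (n * (n + 1)) + 1)) g = 1" if "\<not> reach e w L 0 0 0"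
  proof -
    have "claim p (apply_ops ?ops f) (\<lambda>_. 0) 0"
      using val that by (simp add: claim_def)
    moreover have "1 \<le> trop_val (2 * K) (\<lambda>I. of_bool (fin r v I))" if "v < p" "claim p f r v" for r v
      using row_check_complete[OF _ p(2) that(1)] that(2) p1 unfolding f_def fin_def by simp
    ultimately have "1 \<le> trop_val (8 * K * length ?ops + 2 * K) (\<lambda>I. of_bool (transcript_ok p K fin ?ops (\<lambda>_. 0) 0 I))"
      using p1 p by (intro protocol_complete[OF _ p(2) _ deg]) auto
    then have "1 \<le> trop_val (2 * K * (4 * (n * (n + 1)) + 1)) g" unfolding g t .
    moreover have "trop_val (2 * K * (4 * (n * (n + 1)) + 1)) g \<le> 1"
      by (rule trop_val_le_1) (simp_all add: g)
    ultimately show ?thesis by simp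
  qed
qed

text \<open>The idle steps after the last layer pad every walk to \<open>2 ^ L\<close> steps. They
  keep the node, so the padded walk still ends at node 0 exactly if the original one does.\<close>

definition bp_step :: "bp \<Rightarrow> bool list \<Rightarrow> nat \<Rightarrow> nat \<Rightarrow> nat \<Rightarrow> bool" where
  "bp_step P x s j k \<longleftrightarrow> (if s < bp_length P - 1
     then j < bp_width P \<and> k < bp_width P \<and> (s, j, x ! bp_label P s, k) \<in> bp_edges P else j = k)"

lemma bp_accepts_iff_reach:
  assumes wf: "wf_bp P" and W: "bp_width P \<le> 2 ^ w" and T: "bp_length P \<le> 2 ^ L"
  shows "bp_accepts P x \<longleftrightarrow> reach (bp_step P x) w L 0 0 0"
proof -
  let ?S = "bp_length P - 1"
  have T1: "1 \<le> bp_length P" using wf by (simp add: wf_bp_def)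
  have iff: "reach (bp_step P x) w L 0 0 0 \<longleftrightarrow> (\<exists>f. f 0 = 0 \<and> f (2 ^ L) = 0 \<and> (\<forall>i. f i < 2 ^ w)
     \<and> (\<forall>i<2 ^ L. bp_step P x i (f i) (f (Suc i))))"
    using reach_iff_path[of 0 w 0 "bp_step P x" L 0] by simp
  show ?thesis
  proof
    assume "bp_accepts P x"
    then obtain p where p: "length p = bp_length P" "p ! 0 = 0" "p ! ?S = 0"
      "\<And>i. Suc i < bp_length P \<Longrightarrow> (i, p ! i, x ! bp_label P i, p ! Suc i) \<in> bp_edges P"
      unfolding bp_accepts_def by blast
    have bd: "p ! i < bp_width P \<and> p ! Suc i < bp_width P" if "Suc i < bp_length P" for i
    proof -
      have "j < bp_width P \<and> k < bp_width P" if "(l, j, b, k) \<in> bp_edges P" for l j b k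
        using wf that by (auto simp: wf_bp_def)
      then show ?thesis using p(4)[OF that] by blast
    qed
    define f where "f i = (if i < ?S then p ! i else 0)" for i
    have "f 0 = 0" using p(2) by (simp add: f_def)
    moreover have "f (2 ^ L) = 0" using T by (simp add: f_def)
    moreover have "f i < 2 ^ w" for i
    proof (cases "i < ?S")
      case True
      then have "p ! i < bp_width P" using bd[of i] by linarith
      then show ?thesis using True W by (simp add: f_def)
    qed (simp add: f_def)
    moreover have "bp_step P x i (f i) (f (Suc i))" if "i < 2 ^ L" for i
    proof (cases "i < ?S")
      case True
      then have "f (Suc i) = p ! Suc i" using p(3) by (cases "Suc i = ?S") (auto simp: f_def)
      then show ?thesis using True p(4)[of i] bd[of i] by (auto simp: bp_step_def f_def)
    qed (simp add: bp_step_def f_def)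
    ultimately show "reach (bp_step P x) w L 0 0 0" unfolding iff by blast
  next
    assume "reach (bp_step P x) w L 0 0 0"
    then obtain f where f: "f 0 = 0" "f (2 ^ L) = 0" "\<And>i. i < 2 ^ L \<Longrightarrow> bp_step P x i (f i) (f (Suc i))"
      unfolding iff by blast
    have SL: "?S \<le> 2 ^ L" using T by simp
    have "f i = f ?S" if "?S \<le> i" "i \<le> 2 ^ L" for i
      using that
    proof (induction i rule: dec_induct)
      case (step i)
      then show ?case using f(3)[of i] by (simp add: bp_step_def)
    qed simp
    then have S0: "f ?S = 0" using f(2) SL by (metis order_refl)
    show "bp_accepts P x"
      unfolding bp_accepts_def
    proof (intro exI[of _ "map f [0..<bp_length P]"] conjI allI impI)
      fix i assume i: "Suc i < bp_length P"
      then have "bp_step P x i (f i) (f (Suc i))" using SL by (intro f(3)) simp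
      then show "(i, map f [0..<bp_length P] ! i, x ! bp_label P i, map f [0..<bp_length P] ! Suc i) \<in> bp_edges P"
        using i by (simp add: bp_step_def split: if_splits)
    qed (use T1 f(1) S0 in auto)
  qed
qed

section \<open>Assembling the reduction\<close>

lemma tensor_code_entry: "tensor_code t (\<lambda>x. g (bits_num x)) = map (\<lambda>I. of_bool (g I)) [0..<2 ^ t]"
  unfolding tensor_code_def bits_num_n_lists[symmetric] by simp

lemma trop_sim_entry: "trop_sim t (\<lambda>x. g (bits_num x)) (\<lambda>x. h (bits_num x)) = trop_val t (\<lambda>I. of_bool (g I \<and> h I))"
  by (simp add: trop_sim_def trop_val_def of_bool_conj)

lemma nat_ceiling_inverse:
  assumes "0 < \<epsilon>"
  shows "1 / real (nat \<lceil>1 / \<epsilon>\<rceil>) \<le> \<epsilon>" "1 \<le> nat \<lceil>1 / \<epsilon>\<rceil>"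
proof -
  define m where "m = nat \<lceil>1 / \<epsilon>\<rceil>"
  have pos: "0 < 1 / \<epsilon>" using assms by simp
  have le: "1 / \<epsilon> \<le> real m" unfolding m_def by (rule real_nat_ceiling_ge)
  then have "0 < real m" using pos by linarith
  then have "1 / real m \<le> \<epsilon>" "1 \<le> m" using le assms by (simp_all add: field_simps)
  then show "1 / real (nat \<lceil>1 / \<epsilon>\<rceil>) \<le> \<epsilon>" "1 \<le> nat \<lceil>1 / \<epsilon>\<rceil>" by (simp_all only: m_def)
qed

text \<open>The part of the step relation read off row \<open>idx\<close> of the two input sets, the first \<open>N\<close> rows
  being those of the first set.\<close>

definition row_step :: "bp \<Rightarrow> nat \<Rightarrow> bool list list \<Rightarrow> nat \<Rightarrow> nat \<Rightarrow> nat \<Rightarrow> nat \<Rightarrow> bool" where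
  "row_step P N X idx s j k = (let h = bp_inputs P div 2 in
     if s < bp_length P - 1 then
        (let l = (if idx < N then bp_label P s else if bp_label P s < h then h else bp_label P s - h)
         in l < h \<and> j < bp_width P \<and> k < bp_width P \<and> (s, j, X ! idx ! l, k) \<in> bp_edges P)
      else idx < N \<and> j = k)"

text \<open>A label lies in exactly one half, so one summand vanishes and the other is the step
  itself. Thus the matrix of the formula is a sum of two functions, each reading a single input
  string.\<close>

lemma row_step_split:
  assumes inst: "bp_pair_instance P N A B" and i: "i < N" and l: "l < N"
  shows "of_bool (row_step P N (A @ B) i s j k) + of_bool (row_step P N (A @ B) (N + l) s j k)
     = (of_bool (bp_step P (A ! i @ B ! l) s j k) :: int)"
proof -
  have len: "length A = N" "length (A ! i) = bp_inputs P div 2"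
    using inst i by (auto simp: bp_pair_instance_def)
  have lab: "bp_label P s < bp_inputs P" if "s < bp_length P - 1" for s
    using inst that by (auto simp: bp_pair_instance_def wf_bp_def)
  have ev: "bp_inputs P = bp_inputs P div 2 + bp_inputs P div 2"
    using inst by (auto simp: bp_pair_instance_def elim!: evenE)
  show ?thesis
  proof (cases "s < bp_length P - 1")
    case True
    show ?thesis
    proof (cases "bp_label P s < bp_inputs P div 2")
      case T: True
      then show ?thesis using True len i by (simp add: row_step_def bp_step_def nth_append Let_def)
    next
      case F: False
      moreover have "bp_label P s - bp_inputs P div 2 < bp_inputs P div 2" using lab[OF True] ev F by linarith
      ultimately show ?thesis using True len i by (simp add: row_step_def bp_step_def nth_append Let_def)
    qed
  next
    case False
    then show ?thesis using i by (simp add: row_step_def bp_step_def Let_def)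
  qed
qed

definition tensor_row :: "nat \<Rightarrow> nat \<Rightarrow> nat \<Rightarrow> nat \<Rightarrow> nat \<Rightarrow> bool \<Rightarrow> (nat \<Rightarrow> nat \<Rightarrow> nat \<Rightarrow> bool) \<Rightarrow> nat \<Rightarrow> bool" where
  "tensor_row p K w L n side step I = transcript_ok p K
     (row_check p K n side (\<lambda>A. case decode w A L of (s, j, k) \<Rightarrow> step s j k)) (qbf_ops w n 0) (\<lambda>_. 0) 0 I"

lemma reduction_correct:
  assumes \<epsilon>: "0 < \<epsilon>" and inst: "bp_pair_instance P N A B"
  defines "t \<equiv> tensor_dim (bp_width P) (bp_length P) (nat \<lceil>1 / \<epsilon>\<rceil>)"
  defines "D \<equiv> 2 ^ t" and "inp \<equiv> bp_pair_code \<epsilon> P N A B"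
  shows "\<exists>U V :: tensor list. length U = N \<and> length V = N
     \<and> (\<forall>w. word_scale inp N D ^ 25 \<le> 2 ^ w \<longrightarrow>
          ram_computes w program inp (3000 * N * D ^ 3) (tropsim_code t U V))
     \<and> (bp_satisfying_pair P A B \<longrightarrow> min_tropsim_complete \<epsilon> t U V)
     \<and> (\<not> bp_satisfying_pair P A B \<longrightarrow> min_tropsim_sound t U V)"
proof -
  define E W T where "E = nat \<lceil>1 / \<epsilon>\<rceil>" and "W = bp_width P" and "T = bp_length P"
  define h S L w where "h = bp_inputs P div 2" and "S = T - 1" and "L = clog (Suc T)" and "w = clog W"
  define n where "n = num_vars W T"
  define p where "p = field_size (field_bound n E)"
  define K where "K = clog p"
  define eb where "eb = S + 5"
  define sb where "sb = eb + 2 * S * (W * W)"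
  define rb where "rb = sb + 2 * N * h"
  define st where "st = row_step P N (A @ B)"
  define ent where "ent idx = tensor_row p K w L n (\<not> idx < N) (st idx)" for idx
  define U V where "U = map (\<lambda>i x. ent i (bits_num x)) [0..<N]" and "V = map (\<lambda>i x. ent (N + i) (bits_num x)) [0..<N]"
  have nL: "n = L * (w + 1)" by (simp add: n_def num_vars_def L_def w_def)
  have wf: "wf_bp P" "1 \<le> N" "length A = N" "length B = N" using inst by (auto simp: bp_pair_instance_def)
  have TW: "1 \<le> T" "1 \<le> W" using wf(1) by (auto simp: wf_bp_def T_def W_def)
  have E: "1 / real E \<le> \<epsilon>" "1 \<le> E" unfolding E_def using nat_ceiling_inverse \<epsilon> by auto
  have fb: "7 \<le> field_bound n E" by (simp add: field_bound_def)
  have p: "prime p" "field_bound n E \<le> p" using field_size[OF fb] by (auto simp: p_def)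
  have p1: "1 < p" using prime_gt_1_nat[OF p(1)] .
  have pK: "p \<le> 2 ^ K" unfolding K_def by (rule le_pow_clog)
  have t: "t = 2 * K * (4 * (n * (n + 1)) + 1)"
    by (simp add: t_def tensor_dim_def n_def p_def K_def Let_def W_def T_def E_def)
  have D_eq: "D = 2 ^ t" by (simp add: D_def)
  have len: "length inp = rb"
    using bp_pair_code_length[OF inst, of \<epsilon>]
    by (simp only: inp_def rb_def sb_def eb_def S_def T_def W_def h_def)
  have val: "bp_accepts P (A ! i @ B ! l) \<Longrightarrow> trop_sim t (U ! i) (V ! l) < \<epsilon>"
    and val': "\<not> bp_accepts P (A ! i @ B ! l) \<Longrightarrow> trop_sim t (U ! i) (V ! l) = 1"
    if il: "i < N" "l < N" for i l
  proof -
    let ?F = "\<lambda>idx A. case decode w A L of (s, j, k) \<Rightarrow> st idx s j k" and ?e = "bp_step P (A ! i @ B ! l)"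
    have sim: "trop_sim t (U ! i) (V ! l) = trop_val t (\<lambda>I. of_bool (ent i I \<and> ent (N + l) I))"
      using il by (simp add: U_def V_def trop_sim_entry)
    have FG: "of_bool (?F i A') + of_bool (?F (N + l) A') = (of_bool (case decode w A' L of (s, j, k) \<Rightarrow> ?e s j k) :: int)" for A'
      using row_step_split[OF inst il] by (cases "decode w A' L") (simp add: st_def)
    have ent: "ent i I = transcript_ok p K (row_check p K n False (?F i)) (qbf_ops w n 0) (\<lambda>_. 0) 0 I"
      "ent (N + l) I = transcript_ok p K (row_check p K n True (?F (N + l))) (qbf_ops w n 0) (\<lambda>_. 0) 0 I" for I
      using il by (simp_all add: ent_def tensor_row_def)
    have acc: "bp_accepts P (A ! i @ B ! l) \<longleftrightarrow> reach ?e w L 0 0 0"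
    proof (rule bp_accepts_iff_reach[OF wf(1)])
      show "bp_width P \<le> 2 ^ w" using le_pow_clog[of W] by (simp add: w_def W_def)
      show "bp_length P \<le> 2 ^ L" using le_pow_clog[of "Suc T"] by (simp add: L_def T_def)
    qed
    show "trop_sim t (U ! i) (V ! l) = 1" if "\<not> bp_accepts P (A ! i @ B ! l)"
      unfolding sim unfolding t ent using protocol_value(2)[OF nL p(1) pK FG] that acc by simp
    show "trop_sim t (U ! i) (V ! l) < \<epsilon>" if "bp_accepts P (A ! i @ B ! l)"
    proof -
      have "trop_sim t (U ! i) (V ! l) \<le> real (n * (n + 1)) * (4 / real p)"
        unfolding sim unfolding t ent using protocol_value(1)[OF nL p(1) pK FG] that acc by simp
      also have "\<dots> < 1 / real E"
      proof -
        have "4 * (n * (n + 1)) * E < p" using p(2) by (simp add: field_bound_def)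
        then have "real (4 * (n * (n + 1)) * E) < real p" by (simp only: of_nat_less_iff)
        then show ?thesis using E(2) p1 by (simp add: field_simps)
      qed
      finally show ?thesis using E(1) by linarith
    qed
  qed
  have ram: "ram_computes ws program inp (3000 * N * D ^ 3) (tropsim_code t U V)"
    if ws: "word_scale inp N D ^ 25 \<le> 2 ^ ws" for ws
  proof -
    define sc where "sc = word_scale inp N D"
    \<comment> \<open>Most quantities are bounded by \<open>4 * sc\<close>, which is at most
      \<open>sc ^ 2\<close> as \<open>6 \<le> sc\<close>. The locale is used with
      \<open>q = 12\<close>, enough for the \<open>edeg\<close> of all expressions in the program;
      \<open>Z ^ 12 = sc ^ 24 < sc ^ 25\<close> is the origin of the exponent 25.\<close>
    define Z where "Z = sc ^ 2"
    note db = tensor_dim_bounds[OF nL L_def TW(1) p1 pK t D_eq]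
    have elem: "x \<le> sc" if "x \<in> set inp" for x
    proof -
      have "x \<le> Max (set inp)" using that by simp
      then show ?thesis by (simp add: sc_def word_scale_def)
    qed
    have "1 * D \<le> N * D" using wf(2) by (rule mult_le_mono1)
    moreover have "1 \<le> D" by (simp add: D_def)
    ultimately have ND: "D \<le> sc" "1 \<le> N * D" "rb \<le> sc" unfolding sc_def word_scale_def len by linarith+
    have "5 \<le> rb" by (simp add: rb_def sb_def eb_def)
    then have sc6: "6 \<le> sc" using ND(2) unfolding sc_def word_scale_def len by linarith
    have "4 * sc \<le> sc * sc" using sc6 by (intro mult_right_mono) auto
    then have Z4: "y \<le> Z" if "y \<le> 4 * sc" for y
      unfolding Z_def power2_eq_square by (rule order_trans[OF that])
    have hd: "bp_inputs P \<in> set inp" "T \<in> set inp" "W \<in> set inp" "N \<in> set inp" "E \<in> set inp"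
      by (simp_all add: inp_def bp_pair_code_def T_def W_def E_def)
    note hd_le = elem[OF hd(1)] elem[OF hd(2)] elem[OF hd(3)] elem[OF hd(4)] elem[OF hd(5)]
    have "h \<le> sc" unfolding h_def using hd_le(1) by linarith
    let ?edge = "\<lambda>s j \<beta> k. (s, j, \<beta>, k) \<in> bp_edges P" and ?row = "\<lambda>i l. (A @ B) ! i ! l"
    interpret M: reduction_machine ws Z 12 h S W N L w n p K t D eb sb rb "bp_label P" ?edge ?row T E
    proof unfold_locales
      show "2 \<le> Z" using sc6 by (intro Z4) simp
      have "Z ^ 12 = sc ^ 24" by (simp add: Z_def power_mult[symmetric])
      also have "\<dots> < sc ^ 25" using sc6 by (intro power_strict_increasing) auto
      finally show "Z ^ 12 < 2 ^ ws" using ws by (simp add: sc_def)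
      show "1 < p" "p \<le> 2 ^ K" "n = L * (w + 1)" "0 < D" using p1 pK nL by (simp_all add: D_def)
      show "2 ^ K \<le> Z" "2 ^ n \<le> Z" "n * (n + 1) \<le> Z" "2 * N \<le> Z" "D \<le> Z" "2 ^ L \<le> Z" "t \<le> Z" "K \<le> Z"
        "n \<le> Z" "L \<le> Z" "h \<le> Z"
        using db ND hd_le sc6 \<open>h \<le> sc\<close> by (intro Z4; linarith)+
      show "2 * (T + 1) \<le> Z" using hd_le(2) sc6 by (intro Z4) simp
      show "2 * W \<le> Z" using hd_le(3) by (intro Z4) simp
      show "2 * p \<le> Z" using db(7) ND(1) by (intro Z4) simp
      show "rb + n \<le> Z" using db(4) ND(1,3) by (intro Z4) linarith
      show "S = T - 1" "1 \<le> T" "1 \<le> W" "L = clog (Suc T)" "w = clog W" "p = field_size (field_bound n E)" "K = clog p"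
        "t = 2 * K * (4 * (n * (n + 1)) + 1)" "D = 2 ^ t" "eb = S + 5" "sb = eb + 2 * S * (W * W)" "rb = sb + 2 * N * h"
        by (fact S_def TW L_def w_def p_def K_def t D_eq eb_def sb_def rb_def)+
      show "5 + s < rb" if "s < S" for s using that by (simp add: rb_def sb_def eb_def)
      show "eb + (((s * W + j) * 2 + of_bool \<beta>) * W + k) < rb" if "s < S" "j < W" "k < W" for s j k \<beta>
      proof -
        have "(s * W + j) * 2 + of_bool \<beta> < (s * W + j + 1) * 2" by (cases \<beta>) auto
        then have "Suc ((s * W + j) * 2 + of_bool \<beta>) * W \<le> ((s * W + j + 1) * 2) * W"
          by (intro mult_le_mono1) simp
        then have "((s * W + j) * 2 + of_bool \<beta>) * W + k < ((s * W + j + 1) * 2) * W"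
          using that(3) unfolding mult_Suc by linarith
        also have "((s * W + j + 1) * 2) * W \<le> ((s + 1) * W * 2) * W"
          using that(2) by (intro mult_le_mono1) simp
        also have "\<dots> \<le> (S * W * 2) * W" using that(1) by (intro mult_le_mono1) simp
        finally show ?thesis by (simp add: rb_def sb_def mult_ac)
      qed
      show "sb + (i * h + l) < rb" if "i < 2 * N" "l < h" for i l
      proof -
        have "i * h + l < (i + 1) * h" using that(2) by simp
        also have "\<dots> \<le> 2 * N * h" using that(1) by (intro mult_le_mono1) simp
        finally show ?thesis by (simp add: rb_def)
      qed
    qed simp_all
    have leaf: "M.leaf idx = st idx" for idx
      by (intro ext) (simp only: M.leaf_def st_def row_step_def Let_def h_def[symmetric] T_def[symmetric]
        W_def[symmetric] S_def[symmetric])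
    have ent_eq: "M.entry idx I = ent idx I" for idx I
      by (simp add: M.entry_def ent_def tensor_row_def M.leaf_num_def[abs_def] leaf)
    let ?M = "\<lambda>a. if a < length inp then inp ! a else 0"
    have bnd: "M.bnd (\<lambda>_. 0) ?M"
    proof -
      have "?M a \<le> Z" for a
      proof (cases "a < length inp")
        case True
        then have "inp ! a \<le> sc" by (intro elem nth_mem)
        then show ?thesis using True by (simp add: Z4)
      qed simp
      then show ?thesis by (simp only: M.bnd_def) simp
    qed
    have mem: "M.input_mem ?M"
      unfolding M.input_mem_def
    proof (intro conjI allI impI)
      show "?M (5 + s) = bp_label P s" if "s < S" for s
        using that M.addr(1)[OF that] bp_pair_code_label[of s P \<epsilon> N A B] by (simp add: len) (simp add: inp_def S_def T_def)
      show "?M (eb + (((s * W + j) * 2 + of_bool \<beta>) * W + k)) = of_bool (?edge s j \<beta> k)"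
        if "s < S" "j < W" "k < W" for s j k \<beta>
        using M.addr(2)[OF that, of \<beta>] bp_pair_code_edge[of s P j k \<epsilon> N A B \<beta>] that
        unfolding len inp_def[symmetric] eb_def S_def T_def W_def by (simp only: if_True)
      show "?M (sb + (i * h + l)) = of_bool (?row i l)" if "i < 2 * N" "l < h" for i l
        using M.addr(3)[OF that] bp_pair_code_row[OF inst, of i l \<epsilon>] that
        unfolding len inp_def[symmetric] sb_def eb_def S_def T_def W_def h_def by (simp only: if_True)
    qed
    have "5 \<le> length inp" using \<open>5 \<le> rb\<close> len by simp
    then have "?M 0 div 2 = h" "?M (Suc 0) = T" "?M 2 = W" "?M 3 = N" "?M 4 = E"
      by (auto simp: inp_def bp_pair_code_def h_def T_def W_def E_def)
    from M.triple_program[OF this mem wf(2), of "\<lambda>_. 0"] bnd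
    obtain k R' M' where ex: "k \<le> 3000 * N * D ^ 3" "exec ws program (initial_state inp) k (R', M')"
      and out: "M' (R' 0) = t" "M' (R' 0 + 1) = N"
        "\<And>x. x < 2 * N * D \<Longrightarrow> M' (R' 0 + 2 + x) = of_bool (ent (x div D) (x mod D))"
      unfolding M.triple_def initial_state_def ent_eq by blast
    have "tropsim_code t U V = [t, N] @ concat (map (\<lambda>i. map (\<lambda>I. of_bool (ent i I)) [0..<D]) ([0..<N] @ map (\<lambda>i. N + i) [0..<N]))"
      by (simp add: tropsim_code_def U_def V_def o_def tensor_code_entry D_def)
    also have "[0..<N] @ map (\<lambda>i. N + i) [0..<N] = [0..<2 * N]"
      by (rule nth_equalityI) (auto simp: nth_append)
    also have "concat (map (\<lambda>i. map (\<lambda>I. of_bool (ent i I)) [0..<D]) [0..<2 * N])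
       = map (\<lambda>x. of_bool (ent (x div D) (x mod D))) [0..<2 * N * D]"
      by (rule concat_rows)
    finally have code: "tropsim_code t U V = [t, N] @ map (\<lambda>x. of_bool (ent (x div D) (x mod D))) [0..<2 * N * D]" .
    have "map M' [R' 0..<R' 0 + length (tropsim_code t U V)] = tropsim_code t U V"
    proof (rule nth_equalityI)
      fix i assume "i < length (map M' [R' 0..<R' 0 + length (tropsim_code t U V)])"
      then have il: "i < length (tropsim_code t U V)" by simp
      then have i: "i < 2 + 2 * N * D" by (simp add: code)
      have "map M' [R' 0..<R' 0 + length (tropsim_code t U V)] ! i = M' (R' 0 + i)"
        using il by (intro nth_map_upt) simp
      also have "\<dots> = tropsim_code t U V ! i"
      proof (cases "i < 2")
        case True
        then have "i = 0 \<or> i = 1" by auto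
        then show ?thesis using out(1,2) unfolding code by auto
      next
        case False
        then obtain x where x: "i = 2 + x" using le_Suc_ex linorder_not_less by blast
        then have "x < 2 * N * D" using i by simp
        then show ?thesis using out(3)[of x] unfolding code x by (simp add: add.assoc[symmetric])
      qed
      finally show "map M' [R' 0..<R' 0 + length (tropsim_code t U V)] ! i = tropsim_code t U V ! i" .
    qed simp
    then show ?thesis unfolding ram_computes_def using ex by blast
  qed
  have sat: "bp_satisfying_pair P A B \<longleftrightarrow> (\<exists>i<N. \<exists>l<N. bp_accepts P (A ! i @ B ! l))"
    unfolding bp_satisfying_pair_def using wf(3,4) by (metis in_set_conv_nth)
  have nthU: "x \<in> set U \<longleftrightarrow> (\<exists>i<N. x = U ! i)" "x \<in> set V \<longleftrightarrow> (\<exists>i<N. x = V ! i)" for x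
    by (auto simp: U_def V_def in_set_conv_nth)
  show ?thesis
  proof (rule exI[of _ U], rule exI[of _ V], intro conjI allI impI)
    show "length U = N" "length V = N" by (simp_all add: U_def V_def)
  next
    fix ws assume "word_scale inp N D ^ 25 \<le> 2 ^ ws"
    then show "ram_computes ws program inp (3000 * N * D ^ 3) (tropsim_code t U V)" by (rule ram)
  next
    assume "bp_satisfying_pair P A B"
    then show "min_tropsim_complete \<epsilon> t U V"
      unfolding sat min_tropsim_complete_def Bex_def nthU using val by blast
  next
    assume "\<not> bp_satisfying_pair P A B"
    then show "min_tropsim_sound t U V"
      unfolding sat min_tropsim_sound_def Ball_def nthU using val' by blast
  qed
qed

theorem theorem5p7:
  "\<exists>(prog :: com) (dim :: nat \<Rightarrow> nat \<Rightarrow> real \<Rightarrow> nat) (C :: real) (c :: nat) (d :: nat) (q :: nat).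
     (\<forall>W T \<epsilon>. 1 \<le> W \<and> 1 \<le> T \<and> 0 < \<epsilon> \<and> \<epsilon> \<le> 1 \<longrightarrow>
        even (dim W T \<epsilon>) \<and> real (dim W T \<epsilon>) \<le> C * dim_bound W T \<epsilon>)
   \<and> (\<forall>\<epsilon> :: nat \<Rightarrow> real. (\<forall>N. 0 < \<epsilon> N \<and> \<epsilon> N \<le> 1) \<longrightarrow>
        (\<forall>P N A B. bp_pair_instance P N A B \<longrightarrow>
           (let t = dim (bp_width P) (bp_length P) (\<epsilon> N);
                D = 2 ^ t;
                inp = bp_pair_code (\<epsilon> N) P N A B
            in \<exists>U V :: tensor list.
                 length U = N \<and> length V = N
               \<and> (\<forall>w. word_scale inp N D ^ q \<le> 2 ^ w \<longrightarrow>
                    ram_computes w prog inp (c * N * D ^ d) (tropsim_code t U V))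
               \<and> (bp_satisfying_pair P A B \<longrightarrow> min_tropsim_complete (\<epsilon> N) t U V)
               \<and> (\<not> bp_satisfying_pair P A B \<longrightarrow> min_tropsim_sound t U V))))"
  apply (rule exI[of _ program], rule exI[of _ "\<lambda>W T \<epsilon>. tensor_dim W T (nat \<lceil>1 / \<epsilon>\<rceil>)"], rule exI[of _ 18772],
      rule exI[of _ 3000], rule exI[of _ 3], rule exI[of _ 25], intro conjI allI impI)
  subgoal by (rule even_tensor_dim)
  subgoal by (rule tensor_dim_le) simp_all
  subgoal unfolding Let_def by (rule reduction_correct) simp_all
  done

end
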